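(* Let $G$ be a rank-$n$ hyperbolic group with $\operatorname{cd}_{\mathbb{Z}}(G)=n+1$. If $H<G$ is a subgroup of type $F_{n+1}$ satisfying $(CI_n)$, meaning that there exists a simplicial metric $K(H,1)$ with a finite $(n+1)$-skeleton such that its universal cover satisfies $(CI_n)$, then $H$ is rank-$n$ hyperbolic.
   Context: $\operatorname{cd}_{\mathbb{Z}}$ is integral cohomological dimension. A Euclidean simplicial complex is a locally finite simplicial complex in which each cell is endowed with a Euclidean metric, and the whole complex with the length metric; a simplicial metric $K(H,1)$ is a $K(H,1)$ which is a Euclidean simplicial complex. For such a complex $X$, $(C_*(X),\partial)$ is the simplicial chain complex with $\mathbb{Z}$ coefficients, $Z_k(X)=\ker(\partial\colon C_k(X)\to C_{k-1}(X))$, and $M(\sum_\sigma a_\sigma\sigma)=\sum_\sigma|a_\sigma|\operatorname{Vol}(\sigma)$. $X$ satisfies $(CI_m)$ if there is a constant $c$ such that any two points $x,x'\in X$ can be joined by a path of length at most $c\,d(x,x')$, and for all $x_0\in X$, $r>0$, $k\in\{1,\dots,m\}$ and $Z\in Z_k(X)$ with support in the ball $B_r(x_0)$ there is $S\in C_{k+1}(X)$ with $\partial S=Z$ and $M(S)\le c\,r\,M(Z)$. In this statement, a Euclidean simplicial complex $X$ satisfying $(CI_{m-1})$ is called rank-$m$ hyperbolic if there is a constant $C$ such that every $m$-cycle $Z\in Z_m(X)$ has a filling $S\in C_{m+1}(X)$, $\partial S=Z$, with $M(S)\le C\,M(Z)^{\frac{m+1}{m}}$ (this is what is called here a sub-Euclidean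 isoperimetric inequality in dimension $m$). A group $G$ is rank-$m$ hyperbolic if there is a simplicial metric $K(G,1)$ with a finite $(m+1)$-skeleton whose universal cover is rank-$m$ hyperbolic. *)

theory Defs
  imports "HOL-Analysis.Analysis" "HOL-Algebra.FiniteProduct" "HOL-Library.Extended_Nat"
begin

section \<open>Euclidean simplicial complexes\<close>

text \<open>
  Vertices are natural numbers.  This loses nothing: a connected locally finite complex has
  countably many vertices, and so has each of its connected covers.

  The Euclidean metric on a cell \<open>\<sigma>\<close> of dimension \<open>k\<close> is given by an affine chart into \<open>\<real>\<^sup>k\<close>:
  \<open>chart X \<sigma> v i\<close> is the \<open>i\<close>-th coordinate (\<open>i < k\<close>) of the image of the vertex \<open>v\<close>.
\<close>

record metric_complex =
  simplices :: "nat set set"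
  chart :: "nat set \<Rightarrow> nat \<Rightarrow> nat \<Rightarrow> real"

definition simplex_dim :: "nat set \<Rightarrow> nat" where
  "simplex_dim \<sigma> = card \<sigma> - 1"

definition chart_sqdist :: "metric_complex \<Rightarrow> nat set \<Rightarrow> nat \<Rightarrow> nat \<Rightarrow> real" where
  "chart_sqdist X \<sigma> u v = (\<Sum>i<simplex_dim \<sigma>. (chart X \<sigma> u i - chart X \<sigma> v i)\<^sup>2)"

text \<open>
  The last two clauses: the chart of each cell is a nondegenerate simplex, and the metric of a
  cell restricts to the metric of each of its faces (an affine bijection of simplices is an
  isometry iff it preserves the edge lengths).
\<close>

definition euclidean_complex :: "metric_complex \<Rightarrow> bool" where
  "euclidean_complex X \<longleftrightarrow>
     (\<forall>\<sigma>\<in>simplices X. finite \<sigma> \<and> \<sigma> \<noteq> {}) \<and>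
     (\<forall>\<sigma>\<in>simplices X. \<forall>\<tau>\<subseteq>\<sigma>. \<tau> \<noteq> {} \<longrightarrow> \<tau> \<in> simplices X) \<and>
     (\<forall>v. finite {\<sigma>\<in>simplices X. v \<in> \<sigma>}) \<and>
     (\<forall>\<sigma>\<in>simplices X. \<forall>t :: nat \<Rightarrow> real.
        (\<Sum>v\<in>\<sigma>. t v) = 0 \<and> (\<forall>i<simplex_dim \<sigma>. (\<Sum>v\<in>\<sigma>. t v * chart X \<sigma> v i) = 0)
          \<longrightarrow> (\<forall>v\<in>\<sigma>. t v = 0)) \<and>
     (\<forall>\<sigma>\<in>simplices X. \<forall>\<tau>\<in>simplices X. \<tau> \<subseteq> \<sigma> \<longrightarrow>
        (\<forall>u\<in>\<tau>. \<forall>v\<in>\<tau>. chart_sqdist X \<tau> u v = chart_sqdist X \<sigma> u v))"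

text \<open>
  Points of the realization are given by barycentric coordinates.  Topological notions below
  use the product topology of \<^typ>\<open>nat \<Rightarrow> real\<close>; on the realization of a locally finite
  Euclidean complex it coincides with the weak topology and with that of the length metric.
\<close>

definition realization :: "metric_complex \<Rightarrow> (nat \<Rightarrow> real) set" where
  "realization X =
     {x. (\<forall>v. 0 \<le> x v) \<and> {v. x v \<noteq> 0} \<in> simplices X \<and> (\<Sum>v | x v \<noteq> 0. x v) = 1}"

definition cell :: "metric_complex \<Rightarrow> nat set \<Rightarrow> (nat \<Rightarrow> real) set" where
  "cell X \<sigma> = {x \<in> realization X. {v. x v \<noteq> 0} \<subseteq> \<sigma>}"

definition cell_dist :: "metric_complex \<Rightarrow> nat set \<Rightarrow> (nat \<Rightarrow> real) \<Rightarrow> (nat \<Rightarrow> real) \<Rightarrow> real" where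
  "cell_dist X \<sigma> x y =
     sqrt (\<Sum>i<simplex_dim \<sigma>. (\<Sum>v\<in>\<sigma>. (x v - y v) * chart X \<sigma> v i)\<^sup>2)"

text \<open>
  Length of the straight segment between two points of a common cell (independent of the cell),
  and \<open>\<infinity>\<close> if there is no common cell.  The length metric is the infimum of the lengths of
  broken lines; it is \<open>\<infinity>\<close> between different components.
\<close>

definition segment_length :: "metric_complex \<Rightarrow> (nat \<Rightarrow> real) \<Rightarrow> (nat \<Rightarrow> real) \<Rightarrow> ennreal" where
  "segment_length X x y =
     (INF \<sigma>\<in>{\<sigma>\<in>simplices X. x \<in> cell X \<sigma> \<and> y \<in> cell X \<sigma>}. ennreal (cell_dist X \<sigma> x y))"

definition length_dist :: "metric_complex \<Rightarrow> (nat \<Rightarrow> real) \<Rightarrow> (nat \<Rightarrow> real) \<Rightarrow> ennreal" where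
  "length_dist X x y =
     (INF xs\<in>{xs. xs \<noteq> [] \<and> hd xs = x \<and> last xs = y}.
        \<Sum>i<length xs - 1. segment_length X (xs ! i) (xs ! Suc i))"

definition path_length :: "metric_complex \<Rightarrow> (real \<Rightarrow> nat \<Rightarrow> real) \<Rightarrow> ennreal" where
  "path_length X \<gamma> =
     (SUP ts\<in>{ts. sorted ts \<and> set ts \<subseteq> {0..1}}.
        \<Sum>i<length ts - 1. length_dist X (\<gamma> (ts ! i)) (\<gamma> (ts ! Suc i)))"

definition length_ball :: "metric_complex \<Rightarrow> (nat \<Rightarrow> real) \<Rightarrow> real \<Rightarrow> (nat \<Rightarrow> real) set" where
  "length_ball X x r = {y \<in> realization X. length_dist X x y \<le> ennreal r}"

text \<open>Lebesgue measure of the image of the cell under its chart; a vertex has volume 1.\<close>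

definition simplex_vol :: "metric_complex \<Rightarrow> nat set \<Rightarrow> real" where
  "simplex_vol X \<sigma> =
     measure (PiM {..<simplex_dim \<sigma>} (\<lambda>_. lborel))
       {\<lambda>i\<in>{..<simplex_dim \<sigma>}. \<Sum>v\<in>\<sigma>. x v * chart X \<sigma> v i | x. x \<in> cell X \<sigma>}"


section \<open>Simplicial chains, filling inequalities\<close>

text \<open>Simplices are oriented by the order of their vertices.\<close>

definition chains :: "metric_complex \<Rightarrow> nat \<Rightarrow> (nat set \<Rightarrow> int) set" where
  "chains X k =
     {c. finite {\<sigma>. c \<sigma> \<noteq> 0} \<and> {\<sigma>. c \<sigma> \<noteq> 0} \<subseteq> {\<sigma>\<in>simplices X. card \<sigma> = Suc k}}"

text \<open>The case distinction makes the boundary of a 0-chain zero (no augmentation).\<close>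

definition boundary :: "(nat set \<Rightarrow> int) \<Rightarrow> nat set \<Rightarrow> int" where
  "boundary c = (\<lambda>\<tau>. if \<tau> = {} then 0 else
     \<Sum>\<sigma> | c \<sigma> \<noteq> 0. \<Sum>v\<in>\<sigma>. if \<sigma> - {v} = \<tau> then (- 1) ^ card {u\<in>\<sigma>. u < v} * c \<sigma> else 0)"

definition cycles :: "metric_complex \<Rightarrow> nat \<Rightarrow> (nat set \<Rightarrow> int) set" where
  "cycles X k = {c \<in> chains X k. boundary c = (\<lambda>_. 0)}"

definition chain_support :: "metric_complex \<Rightarrow> (nat set \<Rightarrow> int) \<Rightarrow> (nat \<Rightarrow> real) set" where
  "chain_support X c = (\<Union>\<sigma>\<in>{\<sigma>. c \<sigma> \<noteq> 0}. cell X \<sigma>)"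

definition mass :: "metric_complex \<Rightarrow> (nat set \<Rightarrow> int) \<Rightarrow> real" where
  "mass X c = (\<Sum>\<sigma> | c \<sigma> \<noteq> 0. \<bar>real_of_int (c \<sigma>)\<bar> * simplex_vol X \<sigma>)"

definition satisfies_CI :: "nat \<Rightarrow> metric_complex \<Rightarrow> bool" where
  "satisfies_CI m X \<longleftrightarrow>
     (\<exists>c>0.
        (\<forall>x\<in>realization X. \<forall>x'\<in>realization X. \<exists>\<gamma>. path \<gamma> \<and> path_image \<gamma> \<subseteq> realization X \<and>
           pathstart \<gamma> = x \<and> pathfinish \<gamma> = x' \<and>
           path_length X \<gamma> \<le> ennreal c * length_dist X x x') \<and>
        (\<forall>x0\<in>realization X. \<forall>r>0. \<forall>k\<in>{1..m}. \<forall>Z\<in>cycles X k.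
           chain_support X Z \<subseteq> length_ball X x0 r \<longrightarrow>
             (\<exists>S\<in>chains X (Suc k). boundary S = Z \<and> mass X S \<le> c * r * mass X Z)))"

definition rank_hyperbolic :: "nat \<Rightarrow> metric_complex \<Rightarrow> bool" where
  "rank_hyperbolic m X \<longleftrightarrow>
     euclidean_complex X \<and> satisfies_CI (m - 1) X \<and>
     (\<exists>C. \<forall>Z\<in>cycles X m. \<exists>S\<in>chains X (Suc m).
        boundary S = Z \<and> mass X S \<le> C * mass X Z powr ((real m + 1) / real m))"


section \<open>Fundamental group, universal cover, Eilenberg--MacLane complexes\<close>

definition loop_class :: "'a::topological_space set \<Rightarrow> (real \<Rightarrow> 'a) \<Rightarrow> (real \<Rightarrow> 'a) set" where
  "loop_class S \<gamma> = {\<delta>. homotopic_paths S \<gamma> \<delta>}"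

definition fundamental_group :: "'a::topological_space set \<Rightarrow> 'a \<Rightarrow> (real \<Rightarrow> 'a) set monoid" where
  "fundamental_group S a =
     \<lparr>carrier = {loop_class S \<gamma> | \<gamma>.
        path \<gamma> \<and> path_image \<gamma> \<subseteq> S \<and> pathstart \<gamma> = a \<and> pathfinish \<gamma> = a},
      mult = (\<lambda>A B. loop_class S ((SOME \<gamma>. \<gamma> \<in> A) +++ (SOME \<delta>. \<delta> \<in> B))),
      one = loop_class S (\<lambda>_. a)\<rparr>"

text \<open>Affine extension of a vertex map to the realization.\<close>

definition affine_ext :: "(nat \<Rightarrow> nat) \<Rightarrow> (nat \<Rightarrow> real) \<Rightarrow> nat \<Rightarrow> real" where
  "affine_ext p x = (\<lambda>w. \<Sum>v | x v \<noteq> 0 \<and> p v = w. x v)"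

text \<open>
  The universal cover carries the lifted simplicial structure and the lifted Euclidean metric.
  (A simplicial map that is a covering map is injective on each simplex, so the charts on both
  sides of the last clause have the same dimension.)
\<close>

definition universal_cover :: "metric_complex \<Rightarrow> (nat \<Rightarrow> nat) \<Rightarrow> metric_complex \<Rightarrow> bool" where
  "universal_cover X p K \<longleftrightarrow>
     euclidean_complex X \<and>
     (\<forall>\<sigma>\<in>simplices X. p ` \<sigma> \<in> simplices K) \<and>
     covering_space (realization X) (affine_ext p) (realization K) \<and>
     simply_connected (realization X) \<and>
     (\<forall>\<sigma>\<in>simplices X. \<forall>v\<in>\<sigma>. chart X \<sigma> v = chart K (p ` \<sigma>) (p v))"

definition simplicial_metric_K1 :: "('g, 'x) monoid_scheme \<Rightarrow> metric_complex \<Rightarrow> bool" where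
  "simplicial_metric_K1 G K \<longleftrightarrow>
     euclidean_complex K \<and> path_connected (realization K) \<and>
     (\<exists>a\<in>realization K. fundamental_group (realization K) a \<cong> G) \<and>
     (\<exists>X p. universal_cover X p K \<and> contractible (realization X))"

definition finite_skeleton :: "nat \<Rightarrow> metric_complex \<Rightarrow> bool" where
  "finite_skeleton k K \<longleftrightarrow> finite {\<sigma>\<in>simplices K. simplex_dim \<sigma> \<le> k}"

definition rank_hyperbolic_group :: "nat \<Rightarrow> ('g, 'x) monoid_scheme \<Rightarrow> bool" where
  "rank_hyperbolic_group m G \<longleftrightarrow>
     (\<exists>K X p. simplicial_metric_K1 G K \<and> finite_skeleton (m + 1) K \<and>
        universal_cover X p K \<and> rank_hyperbolic m X)"

definition CI_group :: "nat \<Rightarrow> ('g, 'x) monoid_scheme \<Rightarrow> bool" where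
  "CI_group m G \<longleftrightarrow>
     (\<exists>K X p. simplicial_metric_K1 G K \<and> finite_skeleton (m + 1) K \<and>
        universal_cover X p K \<and> satisfies_CI m X)"


section \<open>Group cohomology and cohomological dimension\<close>

text \<open>A \<open>\<int>G\<close>-module is an abelian group \<open>A\<close>, written multiplicatively, with a \<open>G\<close>-action.\<close>

definition group_module ::
    "('g, 'x) monoid_scheme \<Rightarrow> ('a, 'y) monoid_scheme \<Rightarrow> ('g \<Rightarrow> 'a \<Rightarrow> 'a) \<Rightarrow> bool" where
  "group_module G A act \<longleftrightarrow>
     comm_group A \<and>
     (\<forall>g\<in>carrier G. act g \<in> hom A A) \<and>
     (\<forall>a\<in>carrier A. act \<one>\<^bsub>G\<^esub> a = a) \<and>
     (\<forall>g\<in>carrier G. \<forall>h\<in>carrier G. \<forall>a\<in>carrier A. act (g \<otimes>\<^bsub>G\<^esub> h) a = act g (act h a))"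

text \<open>Inhomogeneous cochains: functions on \<open>G\<^sup>k\<close>.\<close>

definition tuples :: "('g, 'x) monoid_scheme \<Rightarrow> nat \<Rightarrow> 'g list set" where
  "tuples G k = {xs. length xs = k \<and> set xs \<subseteq> carrier G}"

definition cochains ::
    "('g, 'x) monoid_scheme \<Rightarrow> ('a, 'y) monoid_scheme \<Rightarrow> nat \<Rightarrow> ('g list \<Rightarrow> 'a) set" where
  "cochains G A k = tuples G k \<rightarrow>\<^sub>E carrier A"

definition mult_adjacent :: "('g, 'x) monoid_scheme \<Rightarrow> nat \<Rightarrow> 'g list \<Rightarrow> 'g list" where
  "mult_adjacent G i xs = take i xs @ (xs ! i \<otimes>\<^bsub>G\<^esub> xs ! Suc i) # drop (i + 2) xs"

text \<open>
  In additive notation, the value at \<open>(g\<^sub>0, \<dots>, g\<^sub>k)\<close> is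
  \<open>g\<^sub>0 f(g\<^sub>1, \<dots>, g\<^sub>k) + (\<Sum>i<k. (-1)^(i+1) f(\<dots>, g\<^sub>i g\<^sub>i\<^sub>+\<^sub>1, \<dots>)) + (-1)^(k+1) f(g\<^sub>0, \<dots>, g\<^sub>k\<^sub>-\<^sub>1)\<close>.
\<close>

definition codiff ::
    "('g, 'x) monoid_scheme \<Rightarrow> ('a, 'y) monoid_scheme \<Rightarrow> ('g \<Rightarrow> 'a \<Rightarrow> 'a) \<Rightarrow> nat
       \<Rightarrow> ('g list \<Rightarrow> 'a) \<Rightarrow> 'g list \<Rightarrow> 'a" where
  "codiff G A act k f = (\<lambda>xs\<in>tuples G (Suc k).
     act (hd xs) (f (tl xs)) \<otimes>\<^bsub>A\<^esub>
     finprod A (\<lambda>i. f (mult_adjacent G i xs) [^]\<^bsub>A\<^esub> ((- 1 :: int) ^ Suc i)) {..<k} \<otimes>\<^bsub>A\<^esub>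
     f (butlast xs) [^]\<^bsub>A\<^esub> ((- 1 :: int) ^ Suc k))"

definition cocycles ::
    "('g, 'x) monoid_scheme \<Rightarrow> ('a, 'y) monoid_scheme \<Rightarrow> ('g \<Rightarrow> 'a \<Rightarrow> 'a) \<Rightarrow> nat
       \<Rightarrow> ('g list \<Rightarrow> 'a) set" where
  "cocycles G A act k =
     {f \<in> cochains G A k. codiff G A act k f = (\<lambda>_\<in>tuples G (Suc k). \<one>\<^bsub>A\<^esub>)}"

definition coboundaries ::
    "('g, 'x) monoid_scheme \<Rightarrow> ('a, 'y) monoid_scheme \<Rightarrow> ('g \<Rightarrow> 'a \<Rightarrow> 'a) \<Rightarrow> nat
       \<Rightarrow> ('g list \<Rightarrow> 'a) set" where
  "coboundaries G A act k =
     (case k of 0 \<Rightarrow> {\<lambda>_\<in>tuples G 0. \<one>\<^bsub>A\<^esub>} | Suc j \<Rightarrow> codiff G A act j ` cochains G A j)"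

text \<open>
  The supremum of all \<open>k\<close> with \<open>H\<^sup>k(G; A) \<noteq> 0\<close> for some \<open>\<int>G\<close>-module \<open>A\<close>.  HOL cannot quantify over
  all types of modules, but modules with carrier in \<^typ>\<open>'g list \<Rightarrow> int\<close> suffice: if
  \<open>H\<^sup>k(G; A) \<noteq> 0\<close> for any \<open>A\<close>, then also for the module of \<open>(k-1)\<close>-boundaries of the bar
  resolution (augmented by \<open>\<int>\<close> in degree \<open>-1\<close>) if \<open>k\<close> is the cohomological dimension, and for
  infinitely many \<open>k\<close> if the dimension is infinite, because each \<open>k\<close>-cocycle factors through that
  module.  Its elements are finitely supported functions from lists over \<open>G\<close> to \<open>\<int>\<close>.
\<close>

definition cohomological_dim :: "('g, 'x) monoid_scheme \<Rightarrow> enat" where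
  "cohomological_dim G =
     (SUP k\<in>{k. \<exists>(A :: ('g list \<Rightarrow> int) monoid) act.
                 group_module G A act \<and> cocycles G A act k \<noteq> coboundaries G A act k}. enat k)"

end

theory Submission
  imports Defs "HOL-Library.Poly_Mapping"
begin

text \<open>
  Let \<open>X\<close> and \<open>Y\<close> be the universal covers for \<open>G\<close> and \<open>H\<close>.  The deck groups act freely, so the
  augmented simplicial chain complexes of \<open>X\<close> and \<open>Y\<close> are complexes of free modules, and the filling
  hypotheses make them exact up to dimension \<open>n\<close>.  Since \<open>H\<^sup>n\<^sup>+\<^sup>2(G; Z\<^sub>n\<^sub>+\<^sub>1(X)) = 0\<close>, there is a
  \<open>G\<close>-equivariant \<open>\<pi>\<close> on \<open>C\<^sub>n\<^sub>+\<^sub>1(X)\<close> with \<open>\<partial>\<pi> = \<partial>\<close> that vanishes on cycles.  Choose \<open>H\<close>-equivariant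
  chain maps \<open>f : Y \<rightarrow> X\<close> and \<open>g : X \<rightarrow> Y\<close> and a homotopy \<open>h\<close> from \<open>g f\<close> to the identity.  If \<open>S\<close> fills
  \<open>f(Z)\<close> for an \<open>n\<close>-cycle \<open>Z = \<partial>T\<close> of \<open>Y\<close>, then \<open>\<pi>(S) = \<pi>(f(T))\<close> lies in the span of finitely many
  \<open>H\<close>-orbits of simplices, on which \<open>g\<close> is bounded, although \<open>g\<close> is unbounded in general.  Hence
  \<open>g(\<pi>(S)) - h(Z)\<close> is a filling of \<open>Z\<close> whose mass is linearly bounded by that of \<open>S\<close> and \<open>Z\<close>.
\<close>

section \<open>Deck transformations and the fundamental group\<close>

text \<open>The obstacle is that \<open>H\<close> may have infinite index in \<open>G\<close>: the
  \<open>(n + 1)\<close>-simplices of \<open>X\<close> then form infinitely many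
  \<open>H\<close>-orbits, and a filling taken from \<open>X\<close> may wander through all of them.
  Since \<open>\<pi>\<close> vanishes on cycles, \<open>\<pi>(S)\<close> depends only on the
  boundary of \<open>S\<close>. Its size is read off from \<open>S\<close>, its support from
  \<open>f(T)\<close>, whose size is unknown and irrelevant. Such a \<open>\<pi>\<close> splits the
  surjection of \<open>C\<^sub>n\<^sub>+\<^sub>1(X)\<close> onto the \<open>n\<close>-boundaries;
  the obstruction is a class in degree \<open>n + 2\<close>, one above the cohomological dimension.

  Estimates are made in the l1-norm of coefficients. It is comparable with the mass because a finite
  skeleton has finitely many simplex volumes, all positive. The linear error term is absorbed by the
  power \<open>(n + 1) / n\<close> because nonzero integral chains have norm at least 1.

  Complexes are augmented and indexed by the number of vertices, so dimension \<open>n\<close> is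
  index \<open>n + 1\<close>, and the general results are applied with
  \<open>N = n + 1\<close>.\<close>

definition unit_cube :: "(nat \<Rightarrow> real) set" where
  "unit_cube = {x. \<forall>v. 0 \<le> x v \<and> x v \<le> 1}"

text \<open>The lifting theorems for covering spaces are stated for normed spaces; the weights \<open>2\<^sup>-\<^sup>v\<close>
  make the product topology on the cube agree with that of the sup norm.\<close>

definition cube_emb :: "(nat \<Rightarrow> real) \<Rightarrow> nat \<Rightarrow>\<^sub>C real" where
  "cube_emb x = Bcontfun (\<lambda>v. x v / 2 ^ v)"

definition cube_proj :: "(nat \<Rightarrow>\<^sub>C real) \<Rightarrow> nat \<Rightarrow> real" where
  "cube_proj f = (\<lambda>v. apply_bcontfun f v * 2 ^ v)"

lemma apply_cube_emb:
  assumes "x \<in> unit_cube"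
  shows "apply_bcontfun (cube_emb x) v = x v / 2 ^ v"
proof -
  have "(\<lambda>v. x v / 2 ^ v) \<in> bcontfun"
  proof (rule bcontfun_normI)
    fix v :: nat
    show "norm (x v / 2 ^ v) \<le> 1"
      using assms by (simp add: unit_cube_def divide_le_eq) (meson one_le_numeral one_le_power order_trans)
  qed auto
  then show ?thesis by (simp add: cube_emb_def Bcontfun_inverse)
qed

lemma cube_proj_emb: "x \<in> unit_cube \<Longrightarrow> cube_proj (cube_emb x) = x"
  by (simp add: cube_proj_def apply_cube_emb fun_eq_iff)

lemma continuous_on_cube_proj: "continuous_on S cube_proj"
proof -
  have "continuous_on S (\<lambda>f::nat \<Rightarrow>\<^sub>C real. apply_bcontfun f v)" for v
    unfolding continuous_on_iff by (metis dist_bounded order.strict_trans1)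
  then show ?thesis
    unfolding cube_proj_def
    by (intro continuous_on_coordinatewise_then_product continuous_on_mult_right)
qed

lemma continuous_on_cube_emb: "continuous_on unit_cube cube_emb"
  unfolding continuous_on_iff
proof (intro ballI allI impI)
  fix x :: "nat \<Rightarrow> real" and e :: real
  assume x: "x \<in> unit_cube" and "0 < e"
  \<comment> \<open>Coordinates of two cube points differ by at most 1, so past \<open>N\<close> the
    weight alone makes the difference small; the product topology has to control only the finitely
    many coordinates up to \<open>N\<close>.\<close>
  obtain N where N: "(1/2::real) ^ N < e / 2"
    using real_arch_pow_inv[of "e/2" "1/2"] \<open>0 < e\<close> by auto
  define U where "U = {y::nat\<Rightarrow>real. \<forall>v\<in>{..N}. y v \<in> ball (x v) (e/2)}"
  have "open U"
  proof -
    have "U = (\<Inter>v\<in>{..N}. (\<lambda>y. y v) -` ball (x v) (e/2))" by (auto simp: U_def)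
    also have "open \<dots>" by (intro open_INT open_vimage ballI) (auto intro: continuous_on_product_coordinates)
    finally show ?thesis .
  qed
  moreover have "x \<in> U" using \<open>0 < e\<close> by (simp add: U_def)
  ultimately obtain d where d: "d > 0" "ball x d \<subseteq> U" by (meson open_contains_ball)
  have "dist (cube_emb y) (cube_emb x) < e" if y: "y \<in> unit_cube" "dist y x < d" for y
  proof -
    have yU: "y \<in> U" using d that by (auto simp: dist_commute)
    have "dist (cube_emb y) (cube_emb x) \<le> e / 2"
    proof (rule dist_bound)
      fix v
      have eq: "dist (apply_bcontfun (cube_emb y) v) (apply_bcontfun (cube_emb x) v) = \<bar>y v - x v\<bar> / 2 ^ v"
        using x y by (simp add: apply_cube_emb dist_real_def flip: diff_divide_distrib)
      show "dist (apply_bcontfun (cube_emb y) v) (apply_bcontfun (cube_emb x) v) \<le> e / 2"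
      proof (cases "v \<le> N")
        case True
        then have "\<bar>y v - x v\<bar> < e/2" using yU by (auto simp: U_def dist_real_def abs_minus_commute)
        moreover have "\<bar>y v - x v\<bar> / 2 ^ v \<le> \<bar>y v - x v\<bar>"
          by (simp add: divide_le_eq mult_left_le_one_le mult_le_cancel_left1)
        ultimately show ?thesis using eq by linarith
      next
        case False
        have "\<bar>y v - x v\<bar> \<le> 1"
          using x y by (simp add: unit_cube_def abs_le_iff) (smt (verit))
        then have "\<bar>y v - x v\<bar> / 2 ^ v \<le> (1/2) ^ v"
          by (simp add: power_one_over divide_right_mono)
        also have "\<dots> \<le> (1/2) ^ N" using False by (intro power_decreasing) auto
        finally show ?thesis using eq N by linarith
      qed
    qed
    then show ?thesis using \<open>0 < e\<close> by linarith
  qed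
  then show "\<exists>d>0. \<forall>x'\<in>unit_cube. dist x' x < d \<longrightarrow> dist (cube_emb x') (cube_emb x) < e"
    using d(1) by blast
qed

lemma homeomorphism_cube_emb:
  "S \<subseteq> unit_cube \<Longrightarrow> homeomorphism S (cube_emb ` S) cube_emb cube_proj"
  by (rule homeomorphismI)
    (auto simp: cube_proj_emb subset_iff continuous_on_cube_proj
      intro: continuous_on_subset[OF continuous_on_cube_emb])

text \<open>The homeomorphisms carry evenly covered sets along: the sheets over the
  \<open>k\<close>-image of \<open>T\<close> are the \<open>e\<close>-images of the sheets over
  \<open>T\<close>. With \<open>cube_emb\<close> on both sides it moves a covering of realizations
  into a normed space.\<close>

lemma covering_space_homeomorphic_image:
  assumes cov: "covering_space C p S"
    and e: "homeomorphism C C' e e'" and k: "homeomorphism S S' k k'"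
  shows "covering_space C' (k \<circ> p \<circ> e') S'"
proof
  have pC: "continuous_on C p" "p ` C = S" using cov by (auto simp: covering_space_def)
  have e': "e' ` C' = C" "e ` C = C'" "continuous_on C' e'" "\<And>x. x \<in> C \<Longrightarrow> e' (e x) = x" "\<And>x. x \<in> C' \<Longrightarrow> e (e' x) = x"
    using e by (auto simp: homeomorphism_def)
  have k': "k' ` S' = S" "k ` S = S'" "continuous_on S k" "\<And>x. x \<in> S \<Longrightarrow> k' (k x) = x" "\<And>x. x \<in> S' \<Longrightarrow> k (k' x) = x"
    using k by (auto simp: homeomorphism_def)
  show "continuous_on C' (k \<circ> p \<circ> e')"
    by (intro continuous_on_compose) (use e' k' pC in auto)
  show "(k \<circ> p \<circ> e') ` C' = S'"
    using e'(1) k'(2) pC(2) by (metis image_comp)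
  fix y assume "y \<in> S'"
  then have "k' y \<in> S" using k' by auto
  then obtain T v where T: "k' y \<in> T" "openin (top_of_set S) T"
    and v: "\<Union>v = C \<inter> p -` T" "\<forall>u\<in>v. openin (top_of_set C) u" "pairwise disjnt v"
      "\<forall>u\<in>v. \<exists>q. homeomorphism u T p q"
    using cov unfolding covering_space_def by metis
  have TS: "T \<subseteq> S" using T(2) by (meson openin_imp_subset)
  have uC: "u \<subseteq> C" if "u \<in> v" for u using v(1) that by auto
  show "\<exists>T. y \<in> T \<and> openin (top_of_set S') T \<and>
      (\<exists>v. \<Union>v = C' \<inter> (k \<circ> p \<circ> e') -` T \<and> (\<forall>u\<in>v. openin (top_of_set C') u) \<and>
        pairwise disjnt v \<and> (\<forall>u\<in>v. \<exists>q. homeomorphism u T (k \<circ> p \<circ> e') q))"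
  proof (intro exI conjI)
    show "y \<in> k ` T" using T(1) k'(5) \<open>y \<in> S'\<close> by (metis imageI)
    show "openin (top_of_set S') (k ` T)"
      using homeomorphism_imp_open_map[OF k T(2)] .
    show "\<Union>((`) e ` v) = C' \<inter> (k \<circ> p \<circ> e') -` k ` T"
    proof
      show "\<Union>((`) e ` v) \<subseteq> C' \<inter> (k \<circ> p \<circ> e') -` k ` T"
      proof clarify
        fix u x assume "u \<in> v" "x \<in> u"
        then have "x \<in> C" "p x \<in> T" using v(1) by auto
        then show "e x \<in> C' \<inter> (k \<circ> p \<circ> e') -` k ` T" using e' by auto
      qed
      show "C' \<inter> (k \<circ> p \<circ> e') -` k ` T \<subseteq> \<Union>((`) e ` v)"
      proof
        fix x assume x: "x \<in> C' \<inter> (k \<circ> p \<circ> e') -` k ` T"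
        then have xC: "e' x \<in> C" using e' by auto
        from x obtain t where t: "t \<in> T" "k (p (e' x)) = k t" by auto
        then have "p (e' x) = t" using k'(4) xC pC(2) TS by (metis imageI subsetD)
        then have "e' x \<in> \<Union>v" using v(1) xC t by auto
        then obtain u where "u \<in> v" "e' x \<in> u" by auto
        then show "x \<in> \<Union>((`) e ` v)" using e'(5) x by (metis IntD1 UN_I imageI)
      qed
    qed
    show "\<forall>u\<in>(`) e ` v. openin (top_of_set C') u"
      using v(2) homeomorphism_imp_open_map[OF e] by auto
    show "pairwise disjnt ((`) e ` v)"
    proof (rule pairwise_imageI)
      fix a b assume ab: "a \<in> v" "b \<in> v" "a \<noteq> b"
      then have "disjnt a b" using v(3) by (meson pairwiseD)
      then show "disjnt (e ` a) (e ` b)"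
        using uC[OF ab(1)] uC[OF ab(2)] e'(4) unfolding disjnt_iff by (metis image_iff subsetD)
    qed
    show "\<forall>u\<in>(`) e ` v. \<exists>q. homeomorphism u (k ` T) (k \<circ> p \<circ> e') q"
    proof clarify
      fix u assume u: "u \<in> v"
      then obtain q where q: "homeomorphism u T p q" using v(4) by auto
      have "homeomorphism u (e ` u) e e'"
        by (rule homeomorphism_of_subsets[OF e uC[OF u] _ refl]) (use uC[OF u] e' in auto)
      then have "homeomorphism (e ` u) T (p \<circ> e') (e \<circ> q)"
        using homeomorphism_compose[OF homeomorphism_symD q] by blast
      moreover have "homeomorphism T (k ` T) k k'"
        by (rule homeomorphism_of_subsets[OF k TS _ refl]) (use TS k' in auto)
      ultimately have "homeomorphism (e ` u) (k ` T) (k \<circ> (p \<circ> e')) ((e \<circ> q) \<circ> k')"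
        by (rule homeomorphism_compose)
      then show "\<exists>q. homeomorphism (e ` u) (k ` T) (k \<circ> p \<circ> e') q" by (metis comp_assoc)
    qed
  qed
qed


section \<open>Lifting and monodromy for coverings between subsets of the cube\<close>

context
  fixes C S :: "(nat \<Rightarrow> real) set" and p :: "(nat \<Rightarrow> real) \<Rightarrow> nat \<Rightarrow> real"
  assumes cov: "covering_space C p S" and C: "C \<subseteq> unit_cube" and S: "S \<subseteq> unit_cube"
begin

lemma covering_space_cube_emb:
  "covering_space (cube_emb ` C) (cube_emb \<circ> p \<circ> cube_proj) (cube_emb ` S)"
  using covering_space_homeomorphic_image[OF cov] homeomorphism_cube_emb C S by blast

private lemma pC: "x \<in> C \<Longrightarrow> p x \<in> S"
  using cov by (auto simp: covering_space_def)

private lemma proj_emb: "x \<in> C \<Longrightarrow> cube_proj (cube_emb x) = x" "x \<in> S \<Longrightarrow> cube_proj (cube_emb x) = x"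
  using C S by (auto simp: cube_proj_emb)

private lemma emb_S_eqD: "cube_emb x = cube_emb y \<Longrightarrow> x \<in> S \<Longrightarrow> y \<in> S \<Longrightarrow> x = y"
  using proj_emb(2) by metis

private lemma continuous_on_emb: "continuous_on C cube_emb" "continuous_on S cube_emb"
  using C S continuous_on_subset[OF continuous_on_cube_emb] by auto

private lemma path_emb:
  "path g \<Longrightarrow> path_image g \<subseteq> C \<Longrightarrow> path (cube_emb \<circ> g)"
  "path g \<Longrightarrow> path_image g \<subseteq> S \<Longrightarrow> path (cube_emb \<circ> g)"
  using continuous_on_emb by (metis continuous_on_subset path_continuous_image)+

lemma cube_covering_lift_path:
  assumes a: "a \<in> C" and g: "path g" "path_image g \<subseteq> S" "pathstart g = p a"
  obtains h where "path h" "path_image h \<subseteq> C" "pathstart h = a" "\<And>t. t \<in> {0..1} \<Longrightarrow> p (h t) = g t"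
proof -
  obtain h where h: "path h" "path_image h \<subseteq> cube_emb ` C" "pathstart h = cube_emb a"
    and ph: "\<And>t. t \<in> {0..1} \<Longrightarrow> (cube_emb \<circ> p \<circ> cube_proj) (h t) = (cube_emb \<circ> g) t"
  proof (rule covering_space_lift_path_strong[OF covering_space_cube_emb, of "cube_emb a" "cube_emb \<circ> g"])
    show "path (cube_emb \<circ> g)" using g path_emb by blast
    show "path_image (cube_emb \<circ> g) \<subseteq> cube_emb ` S" using g by (auto simp: path_image_def)
    show "pathstart (cube_emb \<circ> g) = (cube_emb \<circ> p \<circ> cube_proj) (cube_emb a)"
      using g proj_emb(1)[OF a] by (simp add: pathstart_def)
  qed (use a in auto)
  have hC: "cube_proj (h t) \<in> C" "cube_emb (cube_proj (h t)) = h t" if "t \<in> {0..1}" for t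
    using h(2) that proj_emb by (fastforce simp: path_image_def)+
  show ?thesis
  proof
    show "path (cube_proj \<circ> h)"
      using h(1) by (intro path_continuous_image continuous_on_cube_proj)
    show "path_image (cube_proj \<circ> h) \<subseteq> C" using hC by (auto simp: path_image_def)
    show "pathstart (cube_proj \<circ> h) = a" using h(3) proj_emb(1)[OF a] by (simp add: pathstart_def)
    fix t :: real assume t: "t \<in> {0..1}"
    have "g t \<in> S" using g t by (auto simp: path_image_def)
    then show "p ((cube_proj \<circ> h) t) = g t"
      using ph[OF t] pC[OF hC(1)[OF t]] emb_S_eqD by auto
  qed
qed

lemma cube_covering_monodromy:
  assumes hom: "homotopic_paths S g1 g2"
    and h1: "path h1" "path_image h1 \<subseteq> C" "\<And>t. t \<in> {0..1} \<Longrightarrow> p (h1 t) = g1 t"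
    and h2: "path h2" "path_image h2 \<subseteq> C" "\<And>t. t \<in> {0..1} \<Longrightarrow> p (h2 t) = g2 t"
    and st: "pathstart h1 = pathstart h2"
  shows "pathfinish h1 = pathfinish h2"
proof -
  have hom': "homotopic_paths (cube_emb ` S) (cube_emb \<circ> g1) (cube_emb \<circ> g2)"
    by (rule homotopic_paths_continuous_image[OF hom]) (use continuous_on_emb in auto)
  have lift: "(cube_emb \<circ> p \<circ> cube_proj) ((cube_emb \<circ> h) t) = (cube_emb \<circ> g) t"
    if "path_image h \<subseteq> C" "\<And>t. t \<in> {0..1} \<Longrightarrow> p (h t) = g t" "t \<in> {0..1}" for h g and t :: real
    proof -
    have "h t \<in> C" using that by (auto simp: path_image_def)
    then show ?thesis using that proj_emb(1)[of "h t"] by simp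
  qed
  have "pathfinish (cube_emb \<circ> h1) = pathfinish (cube_emb \<circ> h2)"
  proof (rule covering_space_monodromy[OF covering_space_cube_emb _ _ _ _ hom' _ _ _ _ _ _])
    show "path (cube_emb \<circ> g1)" "path (cube_emb \<circ> g2)"
      "path_image (cube_emb \<circ> g1) \<subseteq> cube_emb ` S" "path_image (cube_emb \<circ> g2) \<subseteq> cube_emb ` S"
      using homotopic_paths_imp_path[OF hom'] homotopic_paths_imp_subset[OF hom'] by auto
    show "path (cube_emb \<circ> h1)" "path (cube_emb \<circ> h2)" using h1 h2 path_emb by blast+
    show "path_image (cube_emb \<circ> h1) \<subseteq> cube_emb ` C" "path_image (cube_emb \<circ> h2) \<subseteq> cube_emb ` C"
      using h1 h2 by (auto simp: path_image_def)
    show "pathstart (cube_emb \<circ> h1) = pathstart (cube_emb \<circ> h2)" using st by (simp add: pathstart_def)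
    show "(cube_emb \<circ> p \<circ> cube_proj) ((cube_emb \<circ> h1) t) = (cube_emb \<circ> g1) t" if "t \<in> {0..1}" for t
      by (rule lift) (use h1 that in auto)
    show "(cube_emb \<circ> p \<circ> cube_proj) ((cube_emb \<circ> h2) t) = (cube_emb \<circ> g2) t" if "t \<in> {0..1}" for t
      by (rule lift) (use h2 that in auto)
  qed
  moreover have "pathfinish h1 \<in> C" "pathfinish h2 \<in> C"
    using h1(2) h2(2) by (auto simp: path_image_def pathfinish_def)
  ultimately show ?thesis using proj_emb(1) by (metis pathfinish_compose)
qed

lemma cube_covering_lift:
  assumes U: "U \<subseteq> unit_cube" "simply_connected U" "locally path_connected U"
    and f: "continuous_on U f" "f \<in> U \<rightarrow> S" and a: "a \<in> C" "z \<in> U" "f z = p a"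
  obtains g where "continuous_on U g" "g \<in> U \<rightarrow> C" "g z = a" "\<And>y. y \<in> U \<Longrightarrow> p (g y) = f y"
proof -
  have homU: "homeomorphism U (cube_emb ` U) cube_emb cube_proj"
    using homeomorphism_cube_emb U by blast
  then have "U homeomorphic cube_emb ` U" using homeomorphic_def by blast
  then have U': "simply_connected (cube_emb ` U)" "locally path_connected (cube_emb ` U)"
    using U(2,3) homeomorphic_simply_connected_eq[of U "cube_emb ` U"]
      homeomorphic_locally[of U "cube_emb ` U" path_connected path_connected]
    by (simp_all add: homeomorphic_path_connectedness)
  have peU: "cube_proj (cube_emb y) = y" if "y \<in> U" for y using that U(1) by (auto simp: cube_proj_emb)
  obtain g where g: "continuous_on (cube_emb ` U) g" "g \<in> cube_emb ` U \<rightarrow> cube_emb ` C"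
     "g (cube_emb z) = cube_emb a" and
     pg: "\<And>y. y \<in> cube_emb ` U \<Longrightarrow> (cube_emb \<circ> p \<circ> cube_proj) (g y) = (cube_emb \<circ> f \<circ> cube_proj) y"
  proof (rule covering_space_lift_strong[OF covering_space_cube_emb _ _ U', of "cube_emb a" "cube_emb z"
        "cube_emb \<circ> f \<circ> cube_proj"])
    show "continuous_on (cube_emb ` U) (cube_emb \<circ> f \<circ> cube_proj)"
    proof (intro continuous_on_compose continuous_on_cube_proj)
      have "cube_proj ` cube_emb ` U = U" using peU by (auto simp: image_iff)
      then show "continuous_on (cube_proj ` cube_emb ` U) f" using f by simp
      show "continuous_on (f ` cube_proj ` cube_emb ` U) cube_emb"
        by (rule continuous_on_subset[OF continuous_on_emb(2)]) (use f peU in auto)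
    qed
    show "(cube_emb \<circ> f \<circ> cube_proj) (cube_emb z) = (cube_emb \<circ> p \<circ> cube_proj) (cube_emb a)"
      using a peU proj_emb by simp
  qed (use a f peU in auto)
  have gC: "cube_proj (g (cube_emb y)) \<in> C" if "y \<in> U" for y
  proof -
    have "g (cube_emb y) \<in> cube_emb ` C" using g(2) that by auto
    then show ?thesis using proj_emb(1) by auto
  qed
  show ?thesis
  proof
    show "continuous_on U (cube_proj \<circ> g \<circ> cube_emb)"
      by (intro continuous_on_compose continuous_on_cube_proj g continuous_on_subset[OF continuous_on_cube_emb U(1)])
    show "cube_proj \<circ> g \<circ> cube_emb \<in> U \<rightarrow> C" using gC by auto
    show "(cube_proj \<circ> g \<circ> cube_emb) z = a" using g(3) proj_emb a by simp
    fix y assume y: "y \<in> U"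
    have "f y \<in> S" using f y by auto
    then show "p ((cube_proj \<circ> g \<circ> cube_emb) y) = f y"
      using pg[of "cube_emb y"] y peU pC[OF gC[OF y]] emb_S_eqD by auto
  qed
qed

lemma cube_covering_lift_unique:
  fixes f :: "'a::topological_space \<Rightarrow> nat \<Rightarrow> real"
  assumes "g1 a = g2 a" "continuous_on T f" "f \<in> T \<rightarrow> S"
    and g1: "continuous_on T g1" "g1 \<in> T \<rightarrow> C" "\<And>x. x \<in> T \<Longrightarrow> f x = p (g1 x)"
    and g2: "continuous_on T g2" "g2 \<in> T \<rightarrow> C" "\<And>x. x \<in> T \<Longrightarrow> f x = p (g2 x)"
    and T: "connected T" "a \<in> T" "x \<in> T"
  shows "g1 x = g2 x"
proof -
  have "(cube_emb \<circ> g1) x = (cube_emb \<circ> g2) x"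
  proof (rule covering_space_lift_unique[OF covering_space_cube_emb _ _ _ _ _ _ _ _ _ T, of _ _ "cube_emb \<circ> f"])
    have cont: "continuous_on T (cube_emb \<circ> h)" if "continuous_on T h" "h \<in> T \<rightarrow> C \<or> h \<in> T \<rightarrow> S" for h
      using that continuous_on_emb
      by (intro continuous_on_compose) (auto intro: continuous_on_subset)
    show "continuous_on T (cube_emb \<circ> f)" "continuous_on T (cube_emb \<circ> g1)" "continuous_on T (cube_emb \<circ> g2)"
      using assms(2,3) g1 g2 by (blast intro: cont)+
    show "(cube_emb \<circ> f) y = (cube_emb \<circ> p \<circ> cube_proj) ((cube_emb \<circ> g1) y)" if "y \<in> T" for y
      using g1(3)[OF that] proj_emb(1)[OF funcset_mem[OF g1(2) that]] by simp
    show "(cube_emb \<circ> f) y = (cube_emb \<circ> p \<circ> cube_proj) ((cube_emb \<circ> g2) y)" if "y \<in> T" for y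
      using g2(3)[OF that] proj_emb(1)[OF funcset_mem[OF g2(2) that]] by simp
    show "cube_emb \<circ> f \<in> T \<rightarrow> cube_emb ` S" using assms(3) by auto
    show "cube_emb \<circ> g1 \<in> T \<rightarrow> cube_emb ` C" "cube_emb \<circ> g2 \<in> T \<rightarrow> cube_emb ` C" using g1(2) g2(2) by auto
  qed (use assms(1) in simp)
  moreover have "g1 x \<in> C" "g2 x \<in> C" using g1 g2 T by auto
  ultimately show ?thesis using proj_emb(1) by (metis comp_apply)
qed

end

text \<open>Null homotopies are found on the \<open>cube_emb\<close> image and pulled back along
  \<open>cube_proj\<close>, which turns the degenerate \<open>linepath\<close> of the normed space
  into the constant path.\<close>

lemma cube_simply_connected_imp:
  fixes U :: "(nat \<Rightarrow> real) set"
  assumes "U \<subseteq> unit_cube" "simply_connected U"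
  shows "path_connected U"
    and "\<And>g. path g \<Longrightarrow> path_image g \<subseteq> U \<Longrightarrow> pathstart g = a \<Longrightarrow> pathfinish g = a \<Longrightarrow> homotopic_paths U g (\<lambda>_. a)"
proof -
  have hom: "homeomorphism U (cube_emb ` U) cube_emb cube_proj"
    using homeomorphism_cube_emb assms by blast
  then have "U homeomorphic cube_emb ` U" using homeomorphic_def by blast
  then have sc: "simply_connected (cube_emb ` U)" and pc: "path_connected U \<longleftrightarrow> path_connected (cube_emb ` U)"
    using assms homeomorphic_simply_connected_eq homeomorphic_path_connectedness by blast+
  show "path_connected U" using pc sc simply_connected_imp_path_connected by blast
  fix g assume g: "path g" "path_image g \<subseteq> U" "pathstart g = a" "pathfinish g = a"
  have pe: "cube_proj (cube_emb y) = y" if "y \<in> U" for y using that assms by (auto simp: cube_proj_emb)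
  have aU: "a \<in> U" using g by (metis pathstart_in_path_image subsetD)
  have "path (cube_emb \<circ> g)"
    by (intro path_continuous_image g continuous_on_subset[OF continuous_on_cube_emb]) (use g assms in auto)
  moreover have "path_image (cube_emb \<circ> g) \<subseteq> cube_emb ` U"
    using g(2) by (auto simp: path_image_def)
  moreover have "pathstart (cube_emb \<circ> g) = cube_emb a" "pathfinish (cube_emb \<circ> g) = cube_emb a"
    using g(3,4) by (simp_all add: pathstart_compose pathfinish_compose)
  ultimately have "homotopic_paths (cube_emb ` U) (cube_emb \<circ> g) (linepath (cube_emb a) (cube_emb a))"
    using sc[unfolded simply_connected_eq_contractible_path] by auto
  then have "homotopic_paths U (cube_proj \<circ> (cube_emb \<circ> g)) (cube_proj \<circ> linepath (cube_emb a) (cube_emb a))"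
    by (rule homotopic_paths_continuous_image) (use pe continuous_on_cube_proj in auto)
  moreover have "cube_proj \<circ> linepath (cube_emb a) (cube_emb a) = (\<lambda>_. a)"
    using pe[OF aU] by (auto simp: fun_eq_iff linepath_refl)
  moreover have "homotopic_paths U g (cube_proj \<circ> (cube_emb \<circ> g))"
    by (rule homotopic_paths_eq) (use g in \<open>auto simp: path_image_def pe image_subset_iff\<close>)
  ultimately show "homotopic_paths U g (\<lambda>_. a)" using homotopic_paths_trans by metis
qed

section \<open>Cells, segments and local structure of a Euclidean complex\<close>

definition vtx :: "nat \<Rightarrow> nat \<Rightarrow> real" where
  "vtx v = (\<lambda>w. if w = v then 1 else 0)"

definition supp :: "(nat \<Rightarrow> real) \<Rightarrow> nat set" where
  "supp x = {v. x v \<noteq> 0}"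

definition segment_point :: "(nat \<Rightarrow> real) \<Rightarrow> (nat \<Rightarrow> real) \<Rightarrow> real \<Rightarrow> nat \<Rightarrow> real" where
  "segment_point x y t = (\<lambda>v. (1 - t) * x v + t * y v)"

lemma supp_vtx [simp]: "supp (vtx v) = {v}"
  by (auto simp: supp_def vtx_def)

lemma vtx_inject [simp]: "vtx u = vtx v \<longleftrightarrow> u = v"
  by (metis singleton_inject supp_vtx)

lemma segment_point_simps [simp]: "segment_point x y 0 = x" "segment_point x y 1 = y"
  by (simp_all add: segment_point_def)

lemma continuous_on_segment_point: "continuous_on A (segment_point x y)"
  unfolding segment_point_def
  by (rule continuous_on_coordinatewise_then_product) (intro continuous_intros)

lemma path_segment_point [simp]: "path (segment_point x y)"
  by (simp add: path_def continuous_on_segment_point)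

lemma realization_iff:
  "x \<in> realization X \<longleftrightarrow> (\<forall>v. 0 \<le> x v) \<and> supp x \<in> simplices X \<and> sum x (supp x) = 1"
  by (simp add: realization_def supp_def)

lemma cell_iff_supp: "x \<in> cell X \<sigma> \<longleftrightarrow> x \<in> realization X \<and> supp x \<subseteq> \<sigma>"
  by (simp add: cell_def supp_def)

context
  fixes X assumes X: "euclidean_complex X"
begin

lemma simplex_finite: "\<sigma> \<in> simplices X \<Longrightarrow> finite \<sigma>"
  and simplex_nonempty: "\<sigma> \<in> simplices X \<Longrightarrow> \<sigma> \<noteq> {}"
  using X[unfolded euclidean_complex_def, THEN conjunct1] by simp_all

lemma simplex_face: "\<sigma> \<in> simplices X \<Longrightarrow> \<tau> \<subseteq> \<sigma> \<Longrightarrow> \<tau> \<noteq> {} \<Longrightarrow> \<tau> \<in> simplices X"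
  using X[unfolded euclidean_complex_def, THEN conjunct2, THEN conjunct1] by simp

lemma locally_finite: "finite {\<sigma>\<in>simplices X. v \<in> \<sigma>}"
  using X[unfolded euclidean_complex_def, THEN conjunct2, THEN conjunct2, THEN conjunct1] by simp

lemma simplex_vertex: "\<sigma> \<in> simplices X \<Longrightarrow> v \<in> \<sigma> \<Longrightarrow> {v} \<in> simplices X"
  by (rule simplex_face) auto

lemma cell_iff:
  assumes "\<sigma> \<in> simplices X"
  shows "x \<in> cell X \<sigma> \<longleftrightarrow> (\<forall>v. 0 \<le> x v) \<and> (\<forall>v. v \<notin> \<sigma> \<longrightarrow> x v = 0) \<and> sum x \<sigma> = 1"
proof -
  have eq: "sum x (supp x) = sum x \<sigma>" if "supp x \<subseteq> \<sigma>"
    using that simplex_finite[OF assms] by (intro sum.mono_neutral_left) (auto simp: supp_def)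
  have "supp x \<in> simplices X" if "supp x \<subseteq> \<sigma>" "sum x \<sigma> = 1"
  proof (rule simplex_face[OF assms that(1)])
    show "supp x \<noteq> {}"
    proof
      assume "supp x = {}"
      then have "sum x \<sigma> = 0" by (intro sum.neutral) (auto simp: supp_def)
      then show False using that by simp
    qed
  qed
  moreover have "supp x \<subseteq> \<sigma> \<longleftrightarrow> (\<forall>v. v \<notin> \<sigma> \<longrightarrow> x v = 0)" by (auto simp: supp_def)
  ultimately show ?thesis using eq by (auto simp: cell_iff_supp realization_iff)
qed

lemma cell_subset: "cell X \<sigma> \<subseteq> realization X"
  by (auto simp: cell_def)

lemma in_own_cell: "x \<in> realization X \<Longrightarrow> x \<in> cell X (supp x)"
  by (simp add: cell_iff_supp)

lemma supp_simplex: "x \<in> realization X \<Longrightarrow> supp x \<in> simplices X"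
  by (simp add: realization_iff)

lemma cell_mono: "x \<in> cell X \<sigma> \<Longrightarrow> \<sigma> \<subseteq> \<tau> \<Longrightarrow> x \<in> cell X \<tau>"
  by (auto simp: cell_iff_supp)

lemma segment_point_cell:
  assumes "\<sigma> \<in> simplices X" "x \<in> cell X \<sigma>" "y \<in> cell X \<sigma>" "t \<in> {0..1}"
  shows "segment_point x y t \<in> cell X \<sigma>"
  using assms unfolding cell_iff[OF assms(1)] segment_point_def
  by (auto simp: sum.distrib simp flip: sum_distrib_left)

lemma vtx_in_cell: "\<sigma> \<in> simplices X \<Longrightarrow> v \<in> \<sigma> \<Longrightarrow> vtx v \<in> cell X \<sigma>"
  using simplex_finite[of \<sigma>] by (subst cell_iff) (auto simp: vtx_def)

lemma vtx_in_realization: "{v} \<in> simplices X \<Longrightarrow> vtx v \<in> realization X"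
  using vtx_in_cell[of "{v}" v] cell_subset by blast

lemma realization_subset_unit_cube: "realization X \<subseteq> unit_cube"
proof
  fix x assume x: "x \<in> realization X"
  have "x v \<le> 1" for v
  proof (cases "v \<in> supp x")
    case True
    have "x v \<le> sum x (supp x)"
      using x simplex_finite[OF supp_simplex[OF x]] True by (intro member_le_sum) (auto simp: realization_iff)
    then show ?thesis using x by (simp add: realization_iff)
  qed (simp add: supp_def)
  then show "x \<in> unit_cube" using x by (simp add: unit_cube_def realization_iff)
qed

lemma path_connected_star_shaped:
  assumes "x \<in> U" and "\<And>y t. y \<in> U \<Longrightarrow> t \<in> {0..1} \<Longrightarrow> segment_point x y t \<in> U"
  shows "path_connected U"
proof -
  have *: "path_component U x y" if "y \<in> U" for y
    unfolding path_component_def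
    using that assms path_segment_point[of x y]
    by (intro exI[of _ "segment_point x y"]) (auto simp: path_image_def pathstart_def pathfinish_def)
  show ?thesis
    unfolding path_connected_component
  proof (intro ballI)
    fix y z assume "y \<in> U" "z \<in> U"
    then show "path_component U y z"
      using path_component_trans[OF path_component_sym[OF *] *] by simp
  qed
qed

lemma path_connected_cell:
  assumes "\<sigma> \<in> simplices X" shows "path_connected (cell X \<sigma>)"
proof -
  obtain v where "v \<in> \<sigma>" using simplex_nonempty[OF assms] by auto
  then have v: "vtx v \<in> cell X \<sigma>" using vtx_in_cell assms by simp
  show ?thesis
    using segment_point_cell[OF assms v] by (rule path_connected_star_shaped[OF v])
qed

text \<open>Near \<open>x\<close> only finitely many coordinates matter: a point whose support
  contains the vertex \<open>v0\<close> of \<open>supp x\<close> has its support in the finite star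
  \<open>N\<close> of \<open>v0\<close>. A nearby point \<open>y\<close> satisfies
  \<open>supp x \<subseteq> supp y\<close>, so the segment from \<open>x\<close> to \<open>y\<close>
  stays in the cell of \<open>supp y\<close>, and the neighbourhood \<open>U\<close> is star-shaped
  about \<open>x\<close>.\<close>

lemma locally_path_connected_realization: "locally path_connected (realization X)"
  unfolding locally_path_connected
proof (intro allI impI, elim conjE)
  fix V x assume V: "openin (top_of_set (realization X)) V" and xV: "x \<in> V"
  then obtain W where W: "open W" "V = realization X \<inter> W" by (auto simp: openin_open)
  have xX: "x \<in> realization X" using W xV by auto
  have sx: "supp x \<in> simplices X" using supp_simplex[OF xX] .
  obtain v0 where v0: "v0 \<in> supp x" using simplex_nonempty[OF sx] by auto
  define N where "N = \<Union>{\<sigma>\<in>simplices X. v0 \<in> \<sigma>}"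
  have N: "finite N" "supp x \<subseteq> N"
    using locally_finite simplex_finite sx v0 by (auto simp: N_def)
  have xpos: "x v > 0" if "v \<in> supp x" for v
    using that xX by (auto simp: realization_iff supp_def less_le)
  obtain B where B: "x \<in> (\<Pi>\<^sub>E i\<in>UNIV. B i)" "\<And>i. open (B i)" "(\<Pi>\<^sub>E i\<in>UNIV. B i) \<subseteq> W"
  proof -
    have "openin (product_topology (\<lambda>i. euclidean) UNIV) W" using W(1) by (simp add: open_fun_def)
    from product_topology_open_contains_basis[OF this, of x] xV W(2) show ?thesis
      by (auto intro: that)
  qed
  have "\<forall>v\<in>N. \<exists>e>0. ball (x v) e \<subseteq> B v"
    using B(1,2) by (metis PiE_mem UNIV_I open_contains_ball)
  then obtain e where e: "\<And>v. v \<in> N \<Longrightarrow> e v > 0" "\<And>v. v \<in> N \<Longrightarrow> ball (x v) (e v) \<subseteq> B v" by metis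
  \<comment> \<open>Being at most \<open>x v\<close> on \<open>supp x\<close>, the radius keeps each
    such coordinate nonzero, which forces \<open>supp y \<subseteq> N\<close>; being at most
    \<open>e v\<close> on \<open>N\<close>, it keeps \<open>y\<close> inside the box
    \<open>B\<close>.\<close>
  define d where "d = Min (e ` N \<union> x ` supp x)"
  have fin: "finite (e ` N \<union> x ` supp x)" "e ` N \<union> x ` supp x \<noteq> {}"
    using N v0 finite_subset by auto
  have d: "d > 0" "\<And>v. v \<in> N \<Longrightarrow> d \<le> e v" "\<And>v. v \<in> supp x \<Longrightarrow> d \<le> x v"
    unfolding d_def using fin e(1) xpos by auto
  define U where "U = {y \<in> realization X. \<forall>v\<in>N. y v \<in> ball (x v) d}"
  have sub: "supp x \<subseteq> supp y" "supp y \<subseteq> N" if y: "y \<in> U" for y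
  proof -
    show *: "supp x \<subseteq> supp y"
    proof
      fix v assume v: "v \<in> supp x"
      then have "\<bar>x v - y v\<bar> < d" using y N by (auto simp: U_def dist_real_def)
      then show "v \<in> supp y" using d(3)[OF v] by (auto simp: supp_def)
    qed
    have "supp y \<in> simplices X" using y supp_simplex by (auto simp: U_def)
    then show "supp y \<subseteq> N" using * v0 by (auto simp: N_def)
  qed
  have xU: "x \<in> U" using xX d(1) by (simp add: U_def)
  show "\<exists>U. openin (top_of_set (realization X)) U \<and> path_connected U \<and> x \<in> U \<and> U \<subseteq> V"
  proof (intro exI conjI)
    have "U = realization X \<inter> (\<Inter>v\<in>N. (\<lambda>y. y v) -` ball (x v) d)" by (auto simp: U_def)
    moreover have "open (\<Inter>v\<in>N. (\<lambda>y::nat\<Rightarrow>real. y v) -` ball (x v) d)"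
      using N(1) by (intro open_INT open_vimage ballI) (auto intro: continuous_on_product_coordinates)
    ultimately show "openin (top_of_set (realization X)) U" by (metis openin_open)
    show "path_connected U"
    proof (rule path_connected_star_shaped[OF xU])
      fix y t assume y: "y \<in> U" and t: "t \<in> {0..1::real}"
      have yX: "y \<in> realization X" using y by (simp add: U_def)
      have "segment_point x y t \<in> cell X (supp y)"
        using segment_point_cell[OF supp_simplex[OF yX]] t sub[OF y] in_own_cell yX xX cell_mono by meson
      moreover have "segment_point x y t v \<in> ball (x v) d" if "v \<in> N" for v
      proof -
        have *: "x v \<in> ball (x v) d" "y v \<in> ball (x v) d" using y that d(1) by (auto simp: U_def)
        have "(1 - t) *\<^sub>R x v + t *\<^sub>R y v \<in> ball (x v) d"
          using convexD_alt[OF convex_ball * ] t by auto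
        then show ?thesis by (simp add: segment_point_def)
      qed
      ultimately show "segment_point x y t \<in> U" by (auto simp: U_def cell_def)
    qed
    show "x \<in> U" by fact
    show "U \<subseteq> V"
    proof
      fix y assume y: "y \<in> U"
      have "y v \<in> B v" for v
      proof (cases "v \<in> N")
        case True
        then have "y v \<in> ball (x v) (e v)" using y d(2) by (fastforce simp: U_def)
        then show ?thesis using e(2)[OF True] by blast
      next
        case False
        then have "v \<notin> supp y" "v \<notin> supp x" using sub[OF y] N by auto
        then have "y v = x v" by (simp add: supp_def)
        then show ?thesis using PiE_mem[OF B(1)] by simp
      qed
      then have "y \<in> W" using B(3) by (simp add: PiE_UNIV_domain subset_iff)
      then show "y \<in> V" using W y by (auto simp: U_def)
    qed
  qed
qed

text \<open>Two edge components would disconnect the realization. The vertices of a simplex lie in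
  one edge component, so the points with a positive coordinate in the component of \<open>u\<close>
  and those with one outside it are separated by open sets.\<close>

lemma edge_path:
  assumes "connected (realization X)" "{u} \<in> simplices X" "{v} \<in> simplices X"
  shows "(u, v) \<in> {(a, b). {a, b} \<in> simplices X}\<^sup>*"
proof (rule ccontr)
  define E where "E = {(a, b). {a, b} \<in> simplices X}"
  assume "(u, v) \<notin> {(a, b). {a, b} \<in> simplices X}\<^sup>*"
  then have uv: "(u, v) \<notin> E\<^sup>*" by (simp add: E_def)
  define O1 where "O1 = (\<Union>w\<in>{w. (u, w) \<in> E\<^sup>*}. {x::nat\<Rightarrow>real. x w > 0})"
  define O2 where "O2 = (\<Union>w\<in>{w. (u, w) \<notin> E\<^sup>*}. {x::nat\<Rightarrow>real. x w > 0})"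
  have op: "open {x::nat\<Rightarrow>real. x w > 0}" for w
    by (intro open_Collect_less continuous_on_product_coordinates continuous_on_const)
  have "open O1" "open O2" unfolding O1_def O2_def by (intro open_UN ballI op)+
  moreover have "O1 \<inter> O2 \<inter> realization X = {}"
  proof -
    have False if x: "x \<in> realization X" and w: "(u, w) \<in> E\<^sup>*" "(u, w') \<notin> E\<^sup>*" "x w > 0" "x w' > 0" for x w w'
    proof -
      have "{w, w'} \<in> simplices X"
        by (rule simplex_face[OF supp_simplex[OF x]]) (use w in \<open>auto simp: supp_def\<close>)
      then have "(w, w') \<in> E" by (simp add: E_def)
      then show False using w rtrancl_into_rtrancl by metis
    qed
    then show ?thesis by (auto simp: O1_def O2_def)
  qed
  moreover have "realization X \<subseteq> O1 \<union> O2"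
  proof
    fix x assume x: "x \<in> realization X"
    obtain w where "w \<in> supp x" using simplex_nonempty[OF supp_simplex[OF x]] by auto
    then have "x w > 0" using x by (auto simp: realization_iff supp_def less_le)
    then show "x \<in> O1 \<union> O2" by (auto simp: O1_def O2_def)
  qed
  moreover have "vtx u \<in> O1 \<inter> realization X" "vtx v \<in> O2 \<inter> realization X"
    using vtx_in_realization assms(2,3) uv by (auto simp: O1_def O2_def vtx_def)
  ultimately show False
    using connectedD[OF assms(1) \<open>open O1\<close> \<open>open O2\<close>] by (metis Int_iff empty_iff)
qed

end

lemma in_supp_iff: "v \<in> supp x \<longleftrightarrow> x v \<noteq> 0"
  by (simp add: supp_def)

section \<open>Simplicial covers and their deck maps\<close>

locale simplicial_cover =
  fixes X p K
  assumes cover: "universal_cover X p K" and K: "euclidean_complex K"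
begin

abbreviation "q \<equiv> affine_ext p"

lemma X: "euclidean_complex X"
  and image_simplex: "\<sigma> \<in> simplices X \<Longrightarrow> p ` \<sigma> \<in> simplices K"
  and covering: "covering_space (realization X) q (realization K)"
  and simply_connected: "simply_connected (realization X)"
  and chart_eq: "\<sigma> \<in> simplices X \<Longrightarrow> v \<in> \<sigma> \<Longrightarrow> chart X \<sigma> v = chart K (p ` \<sigma>) (p v)"
  using cover by (simp_all add: universal_cover_def)

lemma affine_ext_eq:
  assumes "finite \<sigma>" "supp x \<subseteq> \<sigma>"
  shows "q x w = (\<Sum>v\<in>{v\<in>\<sigma>. p v = w}. x v)"
  unfolding affine_ext_def
  by (rule sum.mono_neutral_left) (use assms in \<open>auto simp: in_supp_iff\<close>)

lemma q_in: "x \<in> realization X \<Longrightarrow> q x \<in> realization K"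
  using covering by (auto simp: covering_space_def)

lemma supp_q:
  assumes x: "x \<in> realization X"
  shows "supp (q x) = p ` supp x"
proof -
  have fin: "finite (supp x)" using simplex_finite[OF X supp_simplex[OF X x]] .
  have nonneg: "x v \<ge> 0" for v using x by (simp add: realization_iff)
  have "q x w \<noteq> 0 \<longleftrightarrow> w \<in> p ` supp x" for w
  proof -
    have "q x w = 0 \<longleftrightarrow> (\<forall>v\<in>{v\<in>supp x. p v = w}. x v = 0)"
      unfolding affine_ext_eq[OF fin order_refl]
      by (rule sum_nonneg_eq_0_iff) (use fin nonneg in auto)
    then show ?thesis by (auto simp: in_supp_iff)
  qed
  then show ?thesis by (auto simp: in_supp_iff)
qed

lemma q_segment_point:
  assumes "\<sigma> \<in> simplices X" "x \<in> cell X \<sigma>" "y \<in> cell X \<sigma>"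
  shows "q (segment_point x y t) = segment_point (q x) (q y) t"
proof
  fix w
  have s: "finite \<sigma>" "supp x \<subseteq> \<sigma>" "supp y \<subseteq> \<sigma>"
    using simplex_finite[OF X assms(1)] assms(2,3) by (auto simp: cell_iff_supp)
  have "segment_point x y t u = 0" if "u \<notin> \<sigma>" for u
  proof -
    have "u \<notin> supp x" "u \<notin> supp y" using that s by auto
    then show ?thesis by (simp add: segment_point_def in_supp_iff)
  qed
  then have s': "supp (segment_point x y t) \<subseteq> \<sigma>" unfolding subset_iff in_supp_iff by blast
  show "q (segment_point x y t) w = segment_point (q x) (q y) t w"
    unfolding segment_point_def[of "q x"] affine_ext_eq[OF s(1,2)] affine_ext_eq[OF s(1,3)] affine_ext_eq[OF s(1) s']
    by (simp add: segment_point_def sum.distrib sum_distrib_left)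
qed

lemma q_vtx: "q (vtx v) = vtx (p v)"
proof
  fix w
  have "q (vtx v) w = (\<Sum>u\<in>{u\<in>{v}. p u = w}. vtx v u)" by (rule affine_ext_eq) auto
  also have "{u\<in>{v}. p u = w} = (if p v = w then {v} else {})" by auto
  also have "(\<Sum>u\<in>(if p v = w then {v} else {}). vtx v u) = vtx (p v) w" by (auto simp: vtx_def)
  finally show "q (vtx v) w = vtx (p v) w" .
qed

text \<open>The covering is injective near \<open>vtx w\<close>, and the short initial pieces of the
  segments towards \<open>u\<close> and \<open>v\<close> have the same image. The centre may be
  \<open>u\<close> itself, where \<open>{w, u}\<close> is a vertex; this case gives
  \<open>p_inj_on\<close>.\<close>

lemma star_inj:
  assumes u: "{w, u} \<in> simplices X" and v: "{w, v} \<in> simplices X" and "p u = p v"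
  shows "u = v"
proof -
  have w: "vtx w \<in> realization X"
    using simplex_vertex[OF X u] vtx_in_realization[OF X] by simp
  obtain T U r where T: "vtx w \<in> T" "openin (top_of_set (realization X)) T" "homeomorphism T U q r"
    using covering_space_local_homeomorphism[OF covering w] by metis
  obtain W where W: "open W" "T = realization X \<inter> W" using T(2) by (auto simp: openin_open)
  have small: "\<forall>\<^sub>F t in at_right (0::real). segment_point (vtx w) (vtx z) t \<in> W" for z
  proof -
    have "isCont (segment_point (vtx w) (vtx z)) 0"
      using continuous_on_segment_point[of UNIV] by (simp add: continuous_on_eq_continuous_at)
    then have "(segment_point (vtx w) (vtx z) \<longlongrightarrow> vtx w) (at 0)"
      by (simp add: isCont_def)
    then have "(segment_point (vtx w) (vtx z) \<longlongrightarrow> vtx w) (at_right 0)"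
      using tendsto_mono[OF at_le[OF subset_UNIV]] by blast
    then show ?thesis using W T(1) by (metis IntD2 topological_tendstoD)
  qed
  have "\<forall>\<^sub>F t in at_right (0::real). t \<in> {0<..<1}"
    by (rule eventually_at_right_real) simp
  with small[of u] small[of v] have "\<forall>\<^sub>F t in at_right (0::real).
      t \<in> {0<..<1} \<and> segment_point (vtx w) (vtx u) t \<in> W \<and> segment_point (vtx w) (vtx v) t \<in> W"
    by eventually_elim simp
  then obtain t :: real where t: "t \<in> {0<..<1}" "segment_point (vtx w) (vtx u) t \<in> W"
      "segment_point (vtx w) (vtx v) t \<in> W"
    using eventually_happens'[OF trivial_limit_at_right_real] by blast
  have in_cell: "segment_point (vtx w) (vtx z) t \<in> cell X {w, z}"
    and q_eq: "q (segment_point (vtx w) (vtx z) t) = segment_point (vtx (p w)) (vtx (p z)) t"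
    if "{w, z} \<in> simplices X" for z
    using segment_point_cell[OF X that vtx_in_cell[OF X that] vtx_in_cell[OF X that]]
      q_segment_point[OF that vtx_in_cell[OF X that] vtx_in_cell[OF X that]] t(1)
    by (auto simp: q_vtx)
  have "segment_point (vtx w) (vtx u) t \<in> T" "segment_point (vtx w) (vtx v) t \<in> T"
    using t in_cell u v cell_subset[OF X] W by blast+
  moreover have "inj_on q T" using T(3) by (metis homeomorphism_apply1 inj_on_inverseI)
  ultimately have "segment_point (vtx w) (vtx u) t = segment_point (vtx w) (vtx v) t"
    using q_eq[OF u] q_eq[OF v] \<open>p u = p v\<close> by (metis inj_onD)
  then have "segment_point (vtx w) (vtx u) t u = segment_point (vtx w) (vtx v) t u" by simp
  then show ?thesis using t(1) by (auto simp: segment_point_def vtx_def split: if_splits)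
qed

lemma p_inj_on:
  assumes "\<sigma> \<in> simplices X" shows "inj_on p \<sigma>"
proof (rule inj_onI)
  fix u v assume "u \<in> \<sigma>" "v \<in> \<sigma>" "p u = p v"
  moreover have "{u, u} \<in> simplices X" "{u, v} \<in> simplices X"
    using simplex_face[OF X assms] \<open>u \<in> \<sigma>\<close> \<open>v \<in> \<sigma>\<close> by auto
  ultimately show "u = v" using star_inj by blast
qed

lemma q_coordinate:
  assumes "\<sigma> \<in> simplices X" "x \<in> cell X \<sigma>" "v \<in> \<sigma>"
  shows "q x (p v) = x v"
proof -
  have "q x (p v) = (\<Sum>u\<in>{u\<in>\<sigma>. p u = p v}. x u)"
    using assms simplex_finite[OF X] by (intro affine_ext_eq) (auto simp: cell_iff_supp)
  also have "{u\<in>\<sigma>. p u = p v} = {v}" using p_inj_on[OF assms(1)] assms(3) by (auto dest: inj_onD)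
  finally show ?thesis by simp
qed

text \<open>A deck map is a lift of \<open>q\<close> through itself, so its existence and uniqueness
  are instances of the lifting theorems; local path connectedness of the realization enters through
  existence.\<close>

definition deck_map :: "((nat \<Rightarrow> real) \<Rightarrow> nat \<Rightarrow> real) \<Rightarrow> bool" where
  "deck_map F \<longleftrightarrow> continuous_on (realization X) F \<and> F \<in> realization X \<rightarrow> realization X \<and>
     (\<forall>x\<in>realization X. q (F x) = q x)"

lemma deck_mapD:
  assumes "deck_map F"
  shows "continuous_on (realization X) F" "x \<in> realization X \<Longrightarrow> F x \<in> realization X"
    "x \<in> realization X \<Longrightarrow> q (F x) = q x"
  using assms by (auto simp: deck_map_def)

lemma deck_map_compose: "deck_map F \<Longrightarrow> deck_map F' \<Longrightarrow> deck_map (F \<circ> F')"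
  unfolding deck_map_def
  by (auto intro!: continuous_on_compose2[of "realization X" F] simp: Pi_iff)

lemma deck_map_id: "deck_map (\<lambda>x. x)"
  by (simp add: deck_map_def)

lemma unit_cubes: "realization X \<subseteq> unit_cube" "realization K \<subseteq> unit_cube"
  using realization_subset_unit_cube X K by blast+

lemma path_connected_X: "path_connected (realization X)"
  using cube_simply_connected_imp(1)[OF unit_cubes(1) simply_connected] .

lemma continuous_on_q: "continuous_on (realization X) q"
  using covering by (simp add: covering_space_def)

lemma deck_map_unique:
  assumes "deck_map F" "deck_map F'" "a \<in> realization X" "F a = F' a" "x \<in> realization X"
  shows "F x = F' x"
  by (rule cube_covering_lift_unique[OF covering unit_cubes, where a=a and f=q and T="realization X" and ?g1.0=F and ?g2.0=F' and x=x])
    (use assms deck_mapD q_in continuous_on_q path_connected_X path_connected_imp_connected in auto)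

lemma deck_map_exists:
  assumes "a \<in> realization X" "b \<in> realization X" "q a = q b"
  obtains F where "deck_map F" "F a = b"
proof -
  obtain F where "continuous_on (realization X) F" "F \<in> realization X \<rightarrow> realization X" "F a = b"
    "\<And>y. y \<in> realization X \<Longrightarrow> q (F y) = q y"
    using cube_covering_lift[OF covering unit_cubes unit_cubes(1) simply_connected
        locally_path_connected_realization[OF X] continuous_on_q _ assms(2) assms(1) assms(3)] q_in by blast
  then show ?thesis using that[of F] by (simp add: deck_map_def)
qed

lemma realization_eq_vtx:
  assumes "x \<in> realization X" "supp x = {v}" shows "x = vtx v"
proof
  fix w show "x w = vtx v w"
    using assms by (cases "w = v") (auto simp: realization_iff vtx_def supp_def)
qed

text \<open>The support of \<open>F (vtx v)\<close> is a simplex, on which \<open>p\<close> is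
  injective, and its image is the single vertex \<open>p v\<close>; so it has one element.\<close>

lemma deck_map_vertex:
  assumes F: "deck_map F" and v: "{v} \<in> simplices X"
  shows "\<exists>w. F (vtx v) = vtx w \<and> {w} \<in> simplices X \<and> p w = p v"
proof -
  let ?y = "F (vtx v)"
  have vX: "vtx v \<in> realization X" using v vtx_in_realization[OF X] by simp
  have y: "?y \<in> realization X" using deck_mapD(2)[OF F vX] .
  have "p ` supp ?y = {p v}"
    using supp_q[OF y] deck_mapD(3)[OF F vX] supp_q[OF vX] by simp
  moreover have "inj_on p (supp ?y)" using p_inj_on[OF supp_simplex[OF X y]] .
  ultimately obtain w where w: "supp ?y = {w}" "p w = p v"
    by (metis card_1_singletonE card_image image_insert image_is_empty is_singletonI is_singleton_altdef singleton_inject)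
  then show ?thesis using realization_eq_vtx[OF y] supp_simplex[OF X y] by auto
qed

definition vertex_map :: "((nat \<Rightarrow> real) \<Rightarrow> nat \<Rightarrow> real) \<Rightarrow> nat \<Rightarrow> nat" where
  "vertex_map F v = (THE w. F (vtx v) = vtx w)"

lemma vertex_map:
  assumes "deck_map F" "{v} \<in> simplices X"
  shows "F (vtx v) = vtx (vertex_map F v)" "p (vertex_map F v) = p v" "{vertex_map F v} \<in> simplices X"
proof -
  obtain w where w: "F (vtx v) = vtx w" "{w} \<in> simplices X" "p w = p v"
    using deck_map_vertex[OF assms] by auto
  then have "vertex_map F v = w" unfolding vertex_map_def by (intro the_equality) auto
  then show "F (vtx v) = vtx (vertex_map F v)" "p (vertex_map F v) = p v" "{vertex_map F v} \<in> simplices X"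
    using w by auto
qed

text \<open>On a closed cell, a deck map agrees with the affine map onto the cell that contains the image
  of the barycentre, since both lift the covering projection.\<close>

lemma vertex_map_simplex:
  assumes F: "deck_map F" and \<sigma>: "\<sigma> \<in> simplices X"
  shows "vertex_map F ` \<sigma> \<in> simplices X"
proof -
  have fin: "finite \<sigma>" and ne: "\<sigma> \<noteq> {}" using simplex_finite[OF X \<sigma>] simplex_nonempty[OF X \<sigma>] .
  define b where "b = (\<lambda>v. if v \<in> \<sigma> then 1 / real (card \<sigma>) else 0)"
  have b: "b \<in> cell X \<sigma>" "supp b = \<sigma>"
    using fin ne by (auto simp: cell_iff[OF X \<sigma>] b_def supp_def)
  have bX: "b \<in> realization X" using b(1) cell_subset[OF X] by blast
  define \<tau> where "\<tau> = supp (F b)"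
  have FbX: "F b \<in> realization X" using deck_mapD(2)[OF F bX] .
  have \<tau>: "\<tau> \<in> simplices X" unfolding \<tau>_def using supp_simplex[OF X FbX] .
  have pp: "p ` \<tau> = p ` \<sigma>"
    using supp_q[OF FbX] supp_q[OF bX] deck_mapD(3)[OF F bX] b(2) by (simp add: \<tau>_def)
  have injs: "inj_on p \<sigma>" "inj_on p \<tau>" using p_inj_on \<sigma> \<tau> by auto
  \<comment> \<open>This matches \<open>\<tau>\<close> with \<open>\<sigma>\<close> over their
    common image in \<open>K\<close>. The affine map that it induces on barycentric coordinates is
    \<open>g\<close> below, and it lifts \<open>q\<close> because on one cell \<open>q\<close>
    merely renames coordinates.\<close>
  define m where "m = (\<lambda>w. inv_into \<sigma> p (p w))"
  have m: "m w \<in> \<sigma>" "p (m w) = p w" if "w \<in> \<tau>" for w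
  proof -
    have "p w \<in> p ` \<sigma>" using that pp by blast
    then show "m w \<in> \<sigma>" "p (m w) = p w" unfolding m_def by (rule inv_into_into, rule f_inv_into_f)
  qed
  have bij: "bij_betw m \<tau> \<sigma>"
  proof (rule bij_betwI')
    show "m x = m y \<longleftrightarrow> x = y" if "x \<in> \<tau>" "y \<in> \<tau>" for x y
      using m(2)[OF that(1)] m(2)[OF that(2)] inj_onD[OF injs(2) _ that] by auto
    show "m x \<in> \<sigma>" if "x \<in> \<tau>" for x using m that by simp
    show "\<exists>x\<in>\<tau>. y = m x" if "y \<in> \<sigma>" for y
    proof -
      have "p y \<in> p ` \<tau>" using pp that by simp
      then obtain w where w: "w \<in> \<tau>" "p y = p w" by auto
      then have "y = m w" using m[OF w(1)] inj_onD[OF injs(1) _ that] by simp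
      then show ?thesis using w by auto
    qed
  qed
  define g where "g = (\<lambda>x w. if w \<in> \<tau> then x (m w) else (0::real))"
  have g_cell: "g x \<in> cell X \<tau>" if "x \<in> cell X \<sigma>" for x
  proof -
    have "sum (g x) \<tau> = sum x \<sigma>"
      using sum.reindex_bij_betw[OF bij, of x] by (simp add: g_def)
    then show ?thesis using that by (auto simp: cell_iff[OF X \<sigma>] cell_iff[OF X \<tau>] g_def)
  qed
  have q_g: "q (g x) = q x" if x: "x \<in> cell X \<sigma>" for x
  proof
    fix z
    have xX: "x \<in> realization X" "g x \<in> realization X" using x g_cell cell_subset[OF X] by blast+
    show "q (g x) z = q x z"
    proof (cases "z \<in> p ` \<tau>")
      case True
      then obtain w where w: "w \<in> \<tau>" "z = p w" by auto
      have "q (g x) (p w) = x (m w)" using q_coordinate[OF \<tau> g_cell[OF x] w(1)] w by (simp add: g_def)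
      also have "\<dots> = q x (p (m w))" using q_coordinate[OF \<sigma> x m(1)[OF w(1)]] by simp
      finally show ?thesis using w m by simp
    next
      case False
      have "supp (q x) \<subseteq> p ` \<sigma>" "supp (q (g x)) \<subseteq> p ` \<tau>"
        using supp_q xX x g_cell[OF x] by (auto simp: cell_iff_supp)
      then show ?thesis using False pp by (metis in_supp_iff subsetD)
    qed
  qed
  have "F (vtx v) = g (vtx v)" if v: "v \<in> \<sigma>" for v
  proof (rule cube_covering_lift_unique[OF covering unit_cubes, where a=b and f=q and T="cell X \<sigma>" and ?g1.0=F and ?g2.0=g and x="vtx v"])
    \<comment> \<open>Both points lie in the cell of \<open>\<tau>\<close>, where \<open>q\<close>
      is injective, and both lie over \<open>q b\<close>.\<close>
    show "F b = g b"
    proof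
      fix w show "F b w = g b w"
      proof (cases "w \<in> \<tau>")
        case True
        have "F b w = q (F b) (p w)"
          using q_coordinate[OF \<tau> _ True] FbX by (simp add: \<tau>_def cell_iff_supp)
        also have "\<dots> = q (g b) (p w)" using deck_mapD(3)[OF F bX] q_g[OF b(1)] by simp
        also have "\<dots> = g b w" using q_coordinate[OF \<tau> g_cell[OF b(1)] True] .
        finally show ?thesis .
      next
        case False
        then show ?thesis by (simp add: g_def \<tau>_def in_supp_iff)
      qed
    qed
    show "continuous_on (cell X \<sigma>) q" "continuous_on (cell X \<sigma>) F"
      using continuous_on_q deck_mapD(1)[OF F] cell_subset[OF X] continuous_on_subset by blast+
    show "continuous_on (cell X \<sigma>) g"
      unfolding g_def
    proof (rule continuous_on_coordinatewise_then_product)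
      show "continuous_on (cell X \<sigma>) (\<lambda>x. if i \<in> \<tau> then x (m i) else 0)" for i
        by (cases "i \<in> \<tau>") (simp_all add: continuous_on_subset[OF continuous_on_product_coordinates subset_UNIV])
    qed
    show "connected (cell X \<sigma>)" using path_connected_cell[OF X \<sigma>] path_connected_imp_connected by blast
    show "vtx v \<in> cell X \<sigma>" using vtx_in_cell[OF X \<sigma> v] .
    show "b \<in> cell X \<sigma>" by (rule b(1))
    have sub: "x \<in> realization X" if "x \<in> cell X \<sigma>" for x using that cell_subset[OF X] by blast
    show "q \<in> cell X \<sigma> \<rightarrow> realization K" "F \<in> cell X \<sigma> \<rightarrow> realization X"
      using sub q_in deck_mapD(2)[OF F] by auto
    show "g \<in> cell X \<sigma> \<rightarrow> realization X" using g_cell cell_subset[OF X] by blast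
    show "q x = q (F x)" "q x = q (g x)" if "x \<in> cell X \<sigma>" for x
      using deck_mapD(3)[OF F sub[OF that]] q_g[OF that] by simp_all
  qed
  then have "supp (F (vtx v)) \<subseteq> \<tau>" if "v \<in> \<sigma>" for v
    using that by (auto simp: g_def in_supp_iff split: if_splits)
  then have "vertex_map F ` \<sigma> \<subseteq> \<tau>"
    using vertex_map(1)[OF F simplex_vertex[OF X \<sigma>]] by (auto simp: image_subset_iff)
  then show ?thesis using simplex_face[OF X \<tau>] ne by blast
qed

end

section \<open>The fundamental group as a group of deck maps\<close>

context simplicial_cover
begin

definition is_loop :: "(nat \<Rightarrow> real) \<Rightarrow> (real \<Rightarrow> nat \<Rightarrow> real) \<Rightarrow> bool" where
  "is_loop a \<gamma> \<longleftrightarrow> path \<gamma> \<and> path_image \<gamma> \<subseteq> realization K \<and> pathstart \<gamma> = a \<and> pathfinish \<gamma> = a"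

definition lifts :: "(real \<Rightarrow> nat \<Rightarrow> real) \<Rightarrow> (real \<Rightarrow> nat \<Rightarrow> real) \<Rightarrow> bool" where
  "lifts h \<gamma> \<longleftrightarrow> path h \<and> path_image h \<subseteq> realization X \<and> (\<forall>t\<in>{0..1}. q (h t) = \<gamma> t)"

lemma lift_exists:
  assumes "is_loop a \<gamma>" "b \<in> realization X" "q b = a"
  obtains h where "lifts h \<gamma>" "pathstart h = b"
  using cube_covering_lift_path[OF covering unit_cubes assms(2), of \<gamma>] assms(1,3)
  unfolding is_loop_def lifts_def by (metis (no_types, lifting))

lemma lift_finish_eq:
  assumes "homotopic_paths (realization K) \<gamma> \<delta>" "lifts h \<gamma>" "lifts k \<delta>" "pathstart h = pathstart k"
  shows "pathfinish h = pathfinish k"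
  using cube_covering_monodromy[OF covering unit_cubes assms(1)] assms(2-4) by (auto simp: lifts_def)

lemma homotopic_loop_refl: "is_loop a \<gamma> \<Longrightarrow> homotopic_paths (realization K) \<gamma> \<gamma>"
  by (simp add: is_loop_def)

lemma homotopic_loop: "homotopic_paths (realization K) \<gamma> \<delta> \<Longrightarrow> is_loop a \<gamma> \<Longrightarrow> is_loop a \<delta>"
  unfolding is_loop_def
  by (metis homotopic_paths_imp_path homotopic_paths_imp_pathfinish homotopic_paths_imp_pathstart
      homotopic_paths_imp_subset)

lemma loop_class_eq_iff:
  assumes "is_loop a \<gamma>"
  shows "loop_class (realization K) \<gamma> = loop_class (realization K) \<delta> \<longleftrightarrow> homotopic_paths (realization K) \<gamma> \<delta>"
proof
  assume "loop_class (realization K) \<gamma> = loop_class (realization K) \<delta>"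
  then have "homotopic_paths (realization K) \<delta> \<gamma>"
    using homotopic_loop_refl[OF assms] by (auto simp: loop_class_def)
  then show "homotopic_paths (realization K) \<gamma> \<delta>" by (rule homotopic_paths_sym)
next
  assume "homotopic_paths (realization K) \<gamma> \<delta>"
  then show "loop_class (realization K) \<gamma> = loop_class (realization K) \<delta>"
    unfolding loop_class_def using homotopic_paths_trans homotopic_paths_sym by blast
qed

text \<open>This names the choice hidden in the multiplication of \<open>fundamental_group\<close>,
  so that products unfold to concatenations of representatives.\<close>

definition rep :: "(real \<Rightarrow> nat \<Rightarrow> real) set \<Rightarrow> real \<Rightarrow> nat \<Rightarrow> real" where
  "rep A = (SOME \<gamma>. \<gamma> \<in> A)"

lemma rep:
  assumes "is_loop a \<gamma>"
  shows "homotopic_paths (realization K) \<gamma> (rep (loop_class (realization K) \<gamma>))"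
proof -
  have "\<gamma> \<in> loop_class (realization K) \<gamma>" using homotopic_loop_refl[OF assms] by (simp add: loop_class_def)
  then have "rep (loop_class (realization K) \<gamma>) \<in> loop_class (realization K) \<gamma>"
    unfolding rep_def by (metis someI_ex)
  then show ?thesis by (simp add: loop_class_def)
qed

context
  fixes a b :: "nat \<Rightarrow> real"
  assumes b: "b \<in> realization X" and qb: "q b = a"
begin

abbreviation "\<pi> \<equiv> fundamental_group (realization K) a"

lemma carrier_\<pi>: "carrier \<pi> = {loop_class (realization K) \<gamma> | \<gamma>. is_loop a \<gamma>}"
  by (simp add: fundamental_group_def is_loop_def)

lemma rep_loop: "A \<in> carrier \<pi> \<Longrightarrow> is_loop a (rep A)"
  and class_rep: "A \<in> carrier \<pi> \<Longrightarrow> loop_class (realization K) (rep A) = A"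
  using rep homotopic_loop loop_class_eq_iff unfolding carrier_\<pi> by blast+

lemma mult_\<pi>: "A \<otimes>\<^bsub>\<pi>\<^esub> B = loop_class (realization K) (rep A +++ rep B)"
  by (simp add: fundamental_group_def rep_def)

lemma loop_join: "is_loop a \<gamma> \<Longrightarrow> is_loop a \<delta> \<Longrightarrow> is_loop a (\<gamma> +++ \<delta>)"
  by (simp add: is_loop_def path_image_join)

lemma mult_closed_\<pi>: "A \<in> carrier \<pi> \<Longrightarrow> B \<in> carrier \<pi> \<Longrightarrow> A \<otimes>\<^bsub>\<pi>\<^esub> B \<in> carrier \<pi>"
  using loop_join[OF rep_loop rep_loop] unfolding mult_\<pi> carrier_\<pi> by blast

text \<open>The end of the lift of \<open>A\<close> from \<open>b\<close> determines the deck map on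
  the realization. By monodromy any other representative of \<open>A\<close> has a lift with the
  same end, which is \<open>deck_base\<close>.\<close>

definition deck :: "(real \<Rightarrow> nat \<Rightarrow> real) set \<Rightarrow> (nat \<Rightarrow> real) \<Rightarrow> nat \<Rightarrow> real" where
  "deck A = (SOME F. deck_map F \<and> (\<exists>h. lifts h (rep A) \<and> pathstart h = b \<and> pathfinish h = F b))"

lemma deck_spec:
  assumes "A \<in> carrier \<pi>"
  shows "deck_map (deck A) \<and> (\<exists>h. lifts h (rep A) \<and> pathstart h = b \<and> pathfinish h = deck A b)"
proof -
  obtain h where h: "lifts h (rep A)" "pathstart h = b"
    by (rule lift_exists[OF rep_loop[OF assms] b qb])
  have hX: "pathfinish h \<in> realization X"
    using h(1) unfolding lifts_def by (meson pathfinish_in_path_image subsetD)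
  have "q (pathfinish h) = a"
    using h(1) rep_loop[OF assms] by (auto simp: lifts_def is_loop_def pathfinish_def)
  then obtain F where "deck_map F" "F b = pathfinish h" using deck_map_exists[OF b hX] qb by metis
  then have "\<exists>F. deck_map F \<and> (\<exists>h. lifts h (rep A) \<and> pathstart h = b \<and> pathfinish h = F b)"
    using h by metis
  then show ?thesis unfolding deck_def by (rule someI_ex)
qed

lemma deck_map_deck: "A \<in> carrier \<pi> \<Longrightarrow> deck_map (deck A)"
  using deck_spec by blast

lemma deck_base:
  assumes A: "A \<in> carrier \<pi>" and h: "lifts h \<gamma>" "pathstart h = b" and eq: "loop_class (realization K) \<gamma> = A"
    and \<gamma>: "is_loop a \<gamma>"
  shows "deck A b = pathfinish h"
proof -
  obtain k where k: "lifts k (rep A)" "pathstart k = b" "pathfinish k = deck A b"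
    using deck_spec[OF A] by blast
  have "homotopic_paths (realization K) \<gamma> (rep A)" using rep[OF \<gamma>] eq by simp
  then show ?thesis using lift_finish_eq[OF _ h(1) k(1)] h(2) k(2,3) by metis
qed

text \<open>The lift of \<open>rep A +++ rep B\<close> from \<open>b\<close> is the lift of
  \<open>rep A\<close> followed by the \<open>deck A\<close> translate of the lift of
  \<open>rep B\<close>; it ends at \<open>deck A (deck B b)\<close>. Agreement at \<open>b\<close>
  suffices by uniqueness of deck maps.\<close>

lemma deck_mult:
  assumes A: "A \<in> carrier \<pi>" and B: "B \<in> carrier \<pi>" and x: "x \<in> realization X"
  shows "deck (A \<otimes>\<^bsub>\<pi>\<^esub> B) x = deck A (deck B x)"
proof -
  obtain h where h: "lifts h (rep A)" "pathstart h = b" "pathfinish h = deck A b"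
    using deck_spec[OF A] by blast
  obtain k where k: "lifts k (rep B)" "pathstart k = b" "pathfinish k = deck B b"
    using deck_spec[OF B] by blast
  note F = deck_map_deck[OF A] and F' = deck_map_deck[OF B]
  have kX: "path_image k \<subseteq> realization X" using k(1) by (simp add: lifts_def)
  have Fk: "lifts (deck A \<circ> k) (rep B)"
    unfolding lifts_def
  proof (intro conjI ballI)
    show "path (deck A \<circ> k)"
      using k(1) continuous_on_subset[OF deck_mapD(1)[OF F] kX]
      by (intro path_continuous_image) (auto simp: lifts_def)
    show "path_image (deck A \<circ> k) \<subseteq> realization X"
      using deck_mapD(2)[OF F] kX by (auto simp: path_image_def)
    show "q ((deck A \<circ> k) t) = rep B t" if "t \<in> {0..1}" for t
    proof -
      have "k t \<in> realization X" using kX that by (auto simp: path_image_def)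
      then show ?thesis using k(1) deck_mapD(3)[OF F, of "k t"] that by (simp add: lifts_def)
    qed
  qed
  have fit: "pathfinish h = pathstart (deck A \<circ> k)" using h(3) k(2) by (simp add: pathstart_compose)
  have "lifts (h +++ (deck A \<circ> k)) (rep A +++ rep B)"
    unfolding lifts_def
  proof (intro conjI ballI)
    show "path (h +++ (deck A \<circ> k))" using h(1) Fk fit by (simp add: lifts_def)
    show "path_image (h +++ (deck A \<circ> k)) \<subseteq> realization X"
      using h(1) Fk fit by (simp add: lifts_def path_image_join)
    show "q ((h +++ (deck A \<circ> k)) t) = (rep A +++ rep B) t" if "t \<in> {0..1}" for t
    proof -
      have "q (h s) = rep A s" "q ((deck A \<circ> k) s) = rep B s" if "s \<in> {0..1}" for s
        using h(1) Fk that unfolding lifts_def by blast+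
      from this(1)[of "2 * t"] this(2)[of "2 * t - 1"] that show ?thesis by (simp add: joinpaths_def)
    qed
  qed
  then have "deck (A \<otimes>\<^bsub>\<pi>\<^esub> B) b = pathfinish (h +++ (deck A \<circ> k))"
    by (rule deck_base[OF mult_closed_\<pi>[OF A B] _ _ mult_\<pi>[symmetric] loop_join[OF rep_loop[OF A] rep_loop[OF B]]])
      (simp add: h(2))
  also have "\<dots> = deck A (deck B b)" using k(3) by (simp add: pathfinish_compose)
  finally have "deck (A \<otimes>\<^bsub>\<pi>\<^esub> B) b = deck A (deck B b)" .
  then show ?thesis
    using deck_map_unique[OF deck_map_deck[OF mult_closed_\<pi>[OF A B]] deck_map_compose[OF F F'] b _ x]
    by simp
qed

text \<open>A deck map with a fixed point is the identity, so the lift of \<open>rep A\<close> is a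
  closed loop. It is null homotopic upstairs, and the covering projects the homotopy.\<close>

lemma deck_fixed_point:
  assumes A: "A \<in> carrier \<pi>" and y: "y \<in> realization X" "deck A y = y"
  shows "A = loop_class (realization K) (\<lambda>_. a)"
proof -
  obtain h where h: "lifts h (rep A)" "pathstart h = b" "pathfinish h = deck A b"
    using deck_spec[OF A] by blast
  have "deck A b = b" using deck_map_unique[OF deck_map_deck[OF A] deck_map_id y b] .
  then have "homotopic_paths (realization X) h (\<lambda>_. b)"
    using h by (intro cube_simply_connected_imp(2)[OF unit_cubes(1) simply_connected]) (auto simp: lifts_def)
  then have "homotopic_paths (realization K) (q \<circ> h) (q \<circ> (\<lambda>_. b))"
    by (rule homotopic_paths_continuous_image) (use continuous_on_q q_in in auto)
  moreover have "homotopic_paths (realization K) (rep A) (q \<circ> h)"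
    using rep_loop[OF A] h(1) by (intro homotopic_paths_eq) (auto simp: lifts_def is_loop_def)
  ultimately have "homotopic_paths (realization K) (rep A) (\<lambda>_. a)"
    using homotopic_paths_trans qb by (auto simp: o_def)
  then show ?thesis using loop_class_eq_iff[OF rep_loop[OF A]] class_rep[OF A] by simp
qed

text \<open>Some deck map \<open>F\<close> sends \<open>y\<close> to \<open>z\<close>; the class
  wanted is that of the projection of any path from \<open>b\<close> to \<open>F b\<close>.\<close>

lemma deck_transitive:
  assumes y: "y \<in> realization X" and z: "z \<in> realization X" and yz: "q y = q z"
  obtains A where "A \<in> carrier \<pi>" "deck A y = z"
proof -
  obtain F where F: "deck_map F" "F y = z" using deck_map_exists[OF y z yz] .
  obtain h where h: "path h" "path_image h \<subseteq> realization X" "pathstart h = b" "pathfinish h = F b"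
    using path_connected_X deck_mapD(2)[OF F(1) b] b unfolding path_connected_def by metis
  have loop: "is_loop a (q \<circ> h)"
    unfolding is_loop_def
  proof (intro conjI)
    show "path (q \<circ> h)" using h(1,2) continuous_on_q continuous_on_subset by (intro path_continuous_image) auto
    show "path_image (q \<circ> h) \<subseteq> realization K" using h(2) q_in by (auto simp: path_image_def)
    show "pathstart (q \<circ> h) = a" using h(3) qb by (simp add: pathstart_compose)
    show "pathfinish (q \<circ> h) = a" using h(4) qb deck_mapD(3)[OF F(1) b] by (simp add: pathfinish_compose)
  qed
  define A where "A = loop_class (realization K) (q \<circ> h)"
  have A: "A \<in> carrier \<pi>" using loop by (auto simp: A_def carrier_\<pi>)
  have "deck A b = F b"
    using deck_base[OF A, of h "q \<circ> h"] h loop by (simp add: A_def lifts_def)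
  then have "deck A y = F y" using deck_map_unique[OF deck_map_deck[OF A] F(1) b _ y] by simp
  then show ?thesis using that A F(2) by simp
qed

end

text \<open>Here the topology is turned into combinatorics: from now on the fundamental group enters
  only through these six properties of an action on vertices.\<close>

lemma deck_action:
  fixes G :: "('g, 'x) monoid_scheme"
  assumes G: "group G" and a: "a \<in> realization K" and iso: "fundamental_group (realization K) a \<cong> G"
  obtains act :: "'g \<Rightarrow> nat \<Rightarrow> nat" where
    "\<And>g \<sigma>. g \<in> carrier G \<Longrightarrow> \<sigma> \<in> simplices X \<Longrightarrow> act g ` \<sigma> \<in> simplices X"
    "\<And>g v. g \<in> carrier G \<Longrightarrow> {v} \<in> simplices X \<Longrightarrow> p (act g v) = p v"
    "\<And>g h v. g \<in> carrier G \<Longrightarrow> h \<in> carrier G \<Longrightarrow> {v} \<in> simplices X \<Longrightarrow> act (g \<otimes>\<^bsub>G\<^esub> h) v = act g (act h v)"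
    "\<And>v. {v} \<in> simplices X \<Longrightarrow> act \<one>\<^bsub>G\<^esub> v = v"
    "\<And>g v. g \<in> carrier G \<Longrightarrow> {v} \<in> simplices X \<Longrightarrow> act g v = v \<Longrightarrow> g = \<one>\<^bsub>G\<^esub>"
    "\<And>u v. {u} \<in> simplices X \<Longrightarrow> {v} \<in> simplices X \<Longrightarrow> p u = p v \<Longrightarrow> \<exists>g\<in>carrier G. act g u = v"
proof -
  interpret G: group G by (rule G)
  obtain b where b: "b \<in> realization X" "q b = a"
    using a covering_space_imp_surjective[OF covering] by (metis imageE)
  let ?\<pi> = "fundamental_group (realization K) a"
  obtain f where f: "f \<in> hom ?\<pi> G" "bij_betw f (carrier ?\<pi>) (carrier G)"
    using iso by (auto simp: is_iso_def iso_def)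
  define k where "k = inv_into (carrier ?\<pi>) f"
  have k: "k g \<in> carrier ?\<pi>" "f (k g) = g" if "g \<in> carrier G" for g
    using bij_betw_inv_into_right[OF f(2) that] bij_betwE[OF bij_betw_inv_into[OF f(2)]] that
    by (auto simp: k_def)
  have k_mult: "k (g \<otimes>\<^bsub>G\<^esub> h) = k g \<otimes>\<^bsub>?\<pi>\<^esub> k h" if "g \<in> carrier G" "h \<in> carrier G" for g h
  proof -
    have "f (k g \<otimes>\<^bsub>?\<pi>\<^esub> k h) = g \<otimes>\<^bsub>G\<^esub> h" using f(1) k that by (simp add: hom_def)
    moreover have "k g \<otimes>\<^bsub>?\<pi>\<^esub> k h \<in> carrier ?\<pi>" using mult_closed_\<pi>[OF b] k that by simp
    ultimately show ?thesis using bij_betw_inv_into_left[OF f(2)] unfolding k_def by metis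
  qed
  let ?D = "\<lambda>g. deck b (k g)"
  have D: "deck_map (?D g)" if "g \<in> carrier G" for g using deck_map_deck[OF b k(1)[OF that]] .
  have D_mult: "?D (g \<otimes>\<^bsub>G\<^esub> h) x = ?D g (?D h x)" if "g \<in> carrier G" "h \<in> carrier G" "x \<in> realization X" for g h x
    using deck_mult[OF b k(1)[OF that(1)] k(1)[OF that(2)] that(3)] k_mult that by simp
  have D_one: "?D \<one>\<^bsub>G\<^esub> x = x" if x: "x \<in> realization X" for x
  proof -
    \<comment> \<open>Idempotence gives \<open>?D \<one>\<close> a fixed point, so it is the
      identity by uniqueness; there is no need to compare \<open>k \<one>\<close> with the constant
      loop.\<close>
    have "?D \<one>\<^bsub>G\<^esub> (?D \<one>\<^bsub>G\<^esub> b) = ?D \<one>\<^bsub>G\<^esub> b" using D_mult[of "\<one>\<^bsub>G\<^esub>" "\<one>\<^bsub>G\<^esub>" b] b(1) by simp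
    moreover have "?D \<one>\<^bsub>G\<^esub> b \<in> realization X" using deck_mapD(2)[OF D b(1)] by simp
    ultimately show ?thesis using deck_map_unique[OF D deck_map_id _ _ x] by simp
  qed
  have D_free: "g = \<one>\<^bsub>G\<^esub>" if "g \<in> carrier G" "x \<in> realization X" "?D g x = x" for g x
  proof -
    have "k g = k \<one>\<^bsub>G\<^esub>"
      by (rule trans[OF deck_fixed_point[OF b k(1)[OF that(1)] that(2,3)]
            deck_fixed_point[OF b k(1)[OF G.one_closed] b(1) D_one[OF b(1)], symmetric]])
    then show ?thesis using k(2)[OF that(1)] k(2)[OF G.one_closed] by metis
  qed
  have V: "vtx v \<in> realization X" if "{v} \<in> simplices X" for v using vtx_in_realization[OF X that] .
  show ?thesis
  proof (rule that[of "\<lambda>g. vertex_map (?D g)"])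
    show "vertex_map (?D g) ` \<sigma> \<in> simplices X" if "g \<in> carrier G" "\<sigma> \<in> simplices X" for g \<sigma>
      by (rule vertex_map_simplex[OF D[OF that(1)] that(2)])
    show "p (vertex_map (?D g) v) = p v" if "g \<in> carrier G" "{v} \<in> simplices X" for g v
      by (rule vertex_map(2)[OF D[OF that(1)] that(2)])
    show "vertex_map (?D (g \<otimes>\<^bsub>G\<^esub> h)) v = vertex_map (?D g) (vertex_map (?D h) v)"
      if "g \<in> carrier G" "h \<in> carrier G" "{v} \<in> simplices X" for g h v
    proof -
      have "vtx (vertex_map (?D (g \<otimes>\<^bsub>G\<^esub> h)) v) = ?D g (vtx (vertex_map (?D h) v))"
        using vertex_map(1)[OF D that(3)] D_mult[OF that(1,2) V[OF that(3)]] that by simp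
      also have "\<dots> = vtx (vertex_map (?D g) (vertex_map (?D h) v))"
        using vertex_map(1)[OF D vertex_map(3)[OF D that(3)]] that by simp
      finally show ?thesis by simp
    qed
    show "vertex_map (?D \<one>\<^bsub>G\<^esub>) v = v" if "{v} \<in> simplices X" for v
      using vertex_map(1)[OF D[OF G.one_closed] that] D_one[OF V[OF that]] by simp
    show "g = \<one>\<^bsub>G\<^esub>" if "g \<in> carrier G" "{v} \<in> simplices X" "vertex_map (?D g) v = v" for g v
      using D_free[OF that(1) V[OF that(2)]] vertex_map(1)[OF D[OF that(1)] that(2)] that(3) by simp
    show "\<exists>g\<in>carrier G. vertex_map (?D g) u = v"
      if uv: "{u} \<in> simplices X" "{v} \<in> simplices X" "p u = p v" for u v
    proof -
      have "q (vtx u) = q (vtx v)" using uv(3) by (simp add: q_vtx)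
      then obtain A where A: "A \<in> carrier ?\<pi>" "deck b A (vtx u) = vtx v"
        using deck_transitive[OF b V[OF uv(1)] V[OF uv(2)]] by metis
      have g: "f A \<in> carrier G" "k (f A) = A"
        using f A(1) bij_betw_inv_into_left[OF f(2)] by (auto simp: k_def hom_def)
      then have "vtx (vertex_map (?D (f A)) u) = vtx v"
        using vertex_map(1)[OF D[OF g(1)] uv(1)] A(2) by simp
      then show ?thesis using g(1) by auto
    qed
  qed
qed

end

section \<open>Volumes of simplices\<close>

text \<open>Gaussian elimination for as many independent vectors as there are coordinates: a vector
  \<open>w a\<close> with nonzero entry at \<open>i0\<close> is the pivot, and the induction
  hypothesis is applied to the vectors \<open>w'\<close>, whose entry at \<open>i0\<close> has been
  cleared.\<close>

lemma square_system_solvable: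
  fixes w :: "'v \<Rightarrow> 'i \<Rightarrow> real"
  assumes "finite I" "finite S" "card S = card I"
    and "\<And>t v. (\<And>i. i \<in> I \<Longrightarrow> (\<Sum>v\<in>S. t v * w v i) = 0) \<Longrightarrow> v \<in> S \<Longrightarrow> t v = 0"
  shows "\<exists>t. \<forall>i\<in>I. (\<Sum>v\<in>S. t v * w v i) = y i"
  using assms
proof (induction I arbitrary: S w y rule: finite_induct)
  case (insert i0 I)
  note fin = \<open>finite S\<close> and ind = insert.prems(3)
  have card: "card S = Suc (card I)" using insert by simp
  have "\<exists>a\<in>S. w a i0 \<noteq> 0"
  proof (rule ccontr)
    assume "\<not> (\<exists>a\<in>S. w a i0 \<noteq> 0)"
    then have 0: "w v i0 = 0" if "v \<in> S" for v using that by auto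
    obtain b where b: "b \<in> S" using card by fastforce
    \<comment> \<open>If \<open>i0\<close> vanished on all of \<open>S\<close>, the vectors other
      than \<open>w b\<close> would already span the coordinates in \<open>I\<close>, and
      \<open>w b\<close> would depend on them.\<close>
    have "\<exists>t. \<forall>i\<in>I. (\<Sum>v\<in>S - {b}. t v * w v i) = w b i"
    proof (rule insert.IH)
      show "finite (S - {b})" "card (S - {b}) = card I" using fin card b by auto
      fix t v assume t: "\<And>i. i \<in> I \<Longrightarrow> (\<Sum>v\<in>S - {b}. t v * w v i) = 0" and v: "v \<in> S - {b}"
      have "(t(b := 0)) v = 0"
      proof (rule ind[where t="t(b := 0)" and v=v])
        fix i assume i: "i \<in> insert i0 I"
        have "(\<Sum>v\<in>S. (t(b := 0)) v * w v i) = (\<Sum>v\<in>S - {b}. t v * w v i)"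
          by (subst sum.remove[OF fin b]) (auto intro!: sum.cong)
        also have "\<dots> = 0" using i t 0 by (cases "i = i0") auto
        finally show "(\<Sum>v\<in>S. (t(b := 0)) v * w v i) = 0" .
      qed (use v in auto)
      then show "t v = 0" using v by simp
    qed
    then obtain t where t: "\<And>i. i \<in> I \<Longrightarrow> (\<Sum>v\<in>S - {b}. t v * w v i) = w b i" by blast
    have "(t(b := -1)) b = 0"
    proof (rule ind[where t="t(b := -1)" and v=b])
      fix i assume i: "i \<in> insert i0 I"
      have "(\<Sum>v\<in>S. (t(b := -1)) v * w v i) = - w b i + (\<Sum>v\<in>S - {b}. t v * w v i)"
        by (subst sum.remove[OF fin b]) (auto intro!: sum.cong)
      also have "\<dots> = 0" using i t 0 b by (cases "i = i0") auto
      finally show "(\<Sum>v\<in>S. (t(b := -1)) v * w v i) = 0" .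
    qed (rule b)
    then show False by simp
  qed
  then obtain a where a: "a \<in> S" "w a i0 \<noteq> 0" by blast
  define w' where "w' v i = w v i - w v i0 / w a i0 * w a i" for v i
  have ext: "(\<Sum>v\<in>S. (t(a := s)) v * w v i) = s * w a i + (\<Sum>v\<in>S - {a}. t v * w v i)" for t s i
    by (subst sum.remove[OF fin a(1)]) (auto intro!: sum.cong)
  have w'_sum: "(\<Sum>v\<in>S - {a}. t v * w' v i)
      = (\<Sum>v\<in>S - {a}. t v * w v i) - (\<Sum>v\<in>S - {a}. t v * w v i0) / w a i0 * w a i" for t i
    by (simp add: w'_def algebra_simps sum_subtractf sum_divide_distrib sum_distrib_left)
  have "\<exists>t. \<forall>i\<in>I. (\<Sum>v\<in>S - {a}. t v * w' v i) = y i - y i0 / w a i0 * w a i"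
  proof (rule insert.IH)
    show "finite (S - {a})" "card (S - {a}) = card I" using fin card a by auto
    fix t v assume t: "\<And>i. i \<in> I \<Longrightarrow> (\<Sum>v\<in>S - {a}. t v * w' v i) = 0" and v: "v \<in> S - {a}"
    \<comment> \<open>With this coefficient of the pivot the combination vanishes at
      \<open>i0\<close>, and elsewhere it equals the given combination of the \<open>w'\<close>; so
      a relation among the \<open>w'\<close> extends to one among the \<open>w\<close>.\<close>
    let ?s = "- (\<Sum>v\<in>S - {a}. t v * w v i0) / w a i0"
    have "(t(a := ?s)) v = 0"
    proof (rule ind[where t="t(a := ?s)" and v=v])
      show "(\<Sum>v\<in>S. (t(a := ?s)) v * w v i) = 0" if "i \<in> insert i0 I" for i
        using that t[of i] w'_sum[of t i] a(2) unfolding ext by (cases "i = i0") auto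
    qed (use v in auto)
    then show "t v = 0" using v by simp
  qed
  then obtain t where t: "\<And>i. i \<in> I \<Longrightarrow> (\<Sum>v\<in>S - {a}. t v * w' v i) = y i - y i0 / w a i0 * w a i" by blast
  \<comment> \<open>The coordinate \<open>i0\<close> dictates the coefficient of the pivot; the
    right-hand side used for \<open>w'\<close> was adjusted so that the other coordinates then come
    out as \<open>y i\<close>.\<close>
  let ?s = "(y i0 - (\<Sum>v\<in>S - {a}. t v * w v i0)) / w a i0"
  have "(\<Sum>v\<in>S. (t(a := ?s)) v * w v i) = y i" if "i \<in> insert i0 I" for i
    using that t[of i] w'_sum[of t i] a(2) unfolding ext
    by (cases "i = i0") (auto simp: field_simps)
  then show ?case by blast
qed simp

text \<open>In barycentric coordinates the chart image of the cell is a set \<open>T\<close> cut out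
  by linear inequalities. A box about the barycentre fits into \<open>T\<close>. A box around
  \<open>T\<close> is wanted as well, because \<open>measure\<close> gives 0 to sets of infinite
  measure.\<close>

lemma simplex_vol_pos:
  assumes X: "euclidean_complex X" and \<sigma>: "\<sigma> \<in> simplices X"
  shows "simplex_vol X \<sigma> > 0"
proof -
  define k where "k = simplex_dim \<sigma>"
  have fin: "finite \<sigma>" and ne: "\<sigma> \<noteq> {}" using simplex_finite[OF X \<sigma>] simplex_nonempty[OF X \<sigma>] .
  have card: "card \<sigma> = Suc k" using fin ne by (simp add: k_def simplex_dim_def card_gt_0_iff)
  \<comment> \<open>A constant last coordinate 1 turns the affine nondegeneracy of the chart into
    linear independence of a square system.\<close>
  define w where "w v i = (if i = k then 1 else chart X \<sigma> v i)" for v i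
  have w_k: "(\<Sum>v\<in>\<sigma>. t v * w v k) = (\<Sum>v\<in>\<sigma>. t v)" for t by (simp add: w_def)
  have w_i: "(\<Sum>v\<in>\<sigma>. t v * w v i) = (\<Sum>v\<in>\<sigma>. t v * chart X \<sigma> v i)" if "i < k" for t i
    using that by (simp add: w_def)
  have ind: "t v = 0" if t: "\<And>i. i \<in> {..k} \<Longrightarrow> (\<Sum>v\<in>\<sigma>. t v * w v i) = 0" and v: "v \<in> \<sigma>" for t v
  proof -
    have "(\<Sum>v\<in>\<sigma>. t v) = 0" using t[of k] w_k by simp
    moreover have "(\<Sum>v\<in>\<sigma>. t v * chart X \<sigma> v i) = 0" if "i < k" for i using t[of i] w_i that by simp
    moreover have "\<forall>\<sigma>\<in>simplices X. \<forall>t :: nat \<Rightarrow> real.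
        (\<Sum>v\<in>\<sigma>. t v) = 0 \<and> (\<forall>i<simplex_dim \<sigma>. (\<Sum>v\<in>\<sigma>. t v * chart X \<sigma> v i) = 0)
          \<longrightarrow> (\<forall>v\<in>\<sigma>. t v = 0)"
      using X[unfolded euclidean_complex_def] by (elim conjE)
    ultimately show ?thesis using \<sigma> v unfolding k_def by blast
  qed
  have "\<forall>j. \<exists>t. \<forall>i\<in>{..k}. (\<Sum>v\<in>\<sigma>. t v * w v i) = (if i = j then 1 else 0)"
    using square_system_solvable[of "{..k}" \<sigma> w] ind card fin by simp
  \<comment> \<open>\<open>A\<close> inverts the square matrix \<open>w\<close>. Hence
    \<open>coord v\<close> is the barycentric coordinate of \<open>v\<close> as an affine function
    of the chart point, with constant term \<open>A k v\<close>.\<close>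
  then obtain A where A: "\<And>j i. i \<in> {..k} \<Longrightarrow> (\<Sum>v\<in>\<sigma>. A j v * w v i) = (if i = j then 1 else 0)" by metis
  define coord where "coord v y = (\<Sum>j<k. y j * A j v) + A k v" for v y
  have coord_w: "(\<Sum>v\<in>\<sigma>. coord v y * w v i) = (if i = k then 1 else y i)" if i: "i \<in> {..k}" for y i
  proof -
    have "(\<Sum>v\<in>\<sigma>. coord v y * w v i) = (\<Sum>j<k. y j * (\<Sum>v\<in>\<sigma>. A j v * w v i)) + (\<Sum>v\<in>\<sigma>. A k v * w v i)"
      unfolding coord_def distrib_right sum.distrib sum_distrib_right sum_distrib_left
      by (subst sum.swap) (simp add: mult.assoc)
    also have "\<dots> = (\<Sum>j<k. y j * (if i = j then 1 else 0)) + (if i = k then 1 else 0)"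
      using A[OF i] by simp
    also have "\<dots> = (if i = k then 1 else y i)" using i by (auto simp: if_distrib cong: if_cong)
    finally show ?thesis .
  qed
  have coord_unique: "coord v y = t v"
    if t: "(\<Sum>v\<in>\<sigma>. t v) = 1" "\<And>i. i < k \<Longrightarrow> (\<Sum>v\<in>\<sigma>. t v * chart X \<sigma> v i) = y i" and v: "v \<in> \<sigma>" for t y v
  proof -
    have "coord v y - t v = 0"
    proof (rule ind[where t="\<lambda>v. coord v y - t v" and v=v])
      fix i assume i: "i \<in> {..k}"
      have "(\<Sum>v\<in>\<sigma>. t v * w v i) = (if i = k then 1 else y i)"
        using i t w_k[of t] w_i[of i t] by auto
      then show "(\<Sum>v\<in>\<sigma>. (coord v y - t v) * w v i) = 0"
        using coord_w[OF i, of y] by (simp add: left_diff_distrib sum_subtractf)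
    qed (rule v)
    then show ?thesis by simp
  qed
  let ?M = "PiM {..<k} (\<lambda>_. lborel :: real measure)"
  define T where "T = {y \<in> space ?M. \<forall>v\<in>\<sigma>. 0 \<le> coord v y}"
  have T_eq: "{\<lambda>i\<in>{..<simplex_dim \<sigma>}. \<Sum>v\<in>\<sigma>. x v * chart X \<sigma> v i | x. x \<in> cell X \<sigma>} = T"
  proof (intro equalityI subsetI)
    fix y assume "y \<in> {\<lambda>i\<in>{..<simplex_dim \<sigma>}. \<Sum>v\<in>\<sigma>. x v * chart X \<sigma> v i | x. x \<in> cell X \<sigma>}"
    then obtain x where x: "x \<in> cell X \<sigma>" "y = (\<lambda>i\<in>{..<k}. \<Sum>v\<in>\<sigma>. x v * chart X \<sigma> v i)"
      by (auto simp: k_def)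
    have xs: "(\<Sum>v\<in>\<sigma>. x v) = 1" "\<And>v. 0 \<le> x v" using x(1) by (auto simp: cell_iff[OF X \<sigma>])
    have "coord v y = x v" if "v \<in> \<sigma>" for v
      by (rule coord_unique[OF xs(1) _ that]) (simp add: x(2))
    then show "y \<in> T" using xs by (auto simp: T_def x(2) space_PiM)
  next
    fix y assume y: "y \<in> T"
    define x where "x v = (if v \<in> \<sigma> then coord v y else 0)" for v
    have sums: "(\<Sum>v\<in>\<sigma>. x v * w v i) = (if i = k then 1 else y i)" if "i \<in> {..k}" for i
      using coord_w[OF that, of y] by (simp add: x_def)
    have "x \<in> cell X \<sigma>"
      using y sums[of k] w_k[of x] by (auto simp: cell_iff[OF X \<sigma>] T_def x_def)
    moreover have "y = (\<lambda>i\<in>{..<k}. \<Sum>v\<in>\<sigma>. x v * chart X \<sigma> v i)"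
    proof
      fix i show "y i = (\<lambda>i\<in>{..<k}. \<Sum>v\<in>\<sigma>. x v * chart X \<sigma> v i) i"
        using y sums[of i] w_i[of i x] by (auto simp: T_def space_PiM PiE_def extensional_def)
    qed
    ultimately show "y \<in> {\<lambda>i\<in>{..<simplex_dim \<sigma>}. \<Sum>v\<in>\<sigma>. x v * chart X \<sigma> v i | x. x \<in> cell X \<sigma>}"
      unfolding k_def[symmetric] by blast
  qed
  interpret finite_product_sigma_finite "\<lambda>_. lborel :: real measure" "{..<k}"
    by unfold_locales simp
  have box_measure: "emeasure ?M (PiE {..<k} (\<lambda>i. {l i..u i})) = ennreal (\<Prod>i<k. u i - l i)"
    if "\<And>i. l i \<le> u i" for l u :: "nat \<Rightarrow> real"
    using that by (subst emeasure_PiM) (auto simp: prod_ennreal)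
  have T_meas: "T \<in> sets ?M"
    unfolding T_def coord_def by (measurable) (use fin in auto)
  define L where "L i = (\<Sum>v\<in>\<sigma>. \<bar>chart X \<sigma> v i\<bar>)" for i
  have "T \<subseteq> PiE {..<k} (\<lambda>i. {- L i..L i})"
  proof
    fix y assume y: "y \<in> T"
    then obtain x where x: "x \<in> cell X \<sigma>" "y = (\<lambda>i\<in>{..<k}. \<Sum>v\<in>\<sigma>. x v * chart X \<sigma> v i)"
      unfolding T_eq[symmetric] by (auto simp: k_def)
    have x01: "0 \<le> x v" "x v \<le> 1" for v
      using x(1) realization_subset_unit_cube[OF X] cell_subset[OF X] by (auto simp: unit_cube_def)
    have "\<bar>\<Sum>v\<in>\<sigma>. x v * chart X \<sigma> v i\<bar> \<le> L i" for i
      unfolding L_def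
      by (rule order_trans[OF sum_abs sum_mono]) (use x01 in \<open>simp add: abs_mult mult_left_le_one_le\<close>)
    then show "y \<in> PiE {..<k} (\<lambda>i. {- L i..L i})" by (auto simp: x(2) abs_le_iff minus_le_iff)
  qed
  then have "emeasure ?M T \<le> emeasure ?M (PiE {..<k} (\<lambda>i. {- L i..L i}))"
    by (intro emeasure_mono) auto
  also have "\<dots> < \<infinity>"
    by (subst box_measure) (auto simp: L_def sum_nonneg intro!: order_trans[of "- _" 0])
  finally have T_fin: "emeasure ?M T < \<infinity>" .
  \<comment> \<open>\<open>c\<close> bounds the slopes of all barycentric coordinates, and the added
    1 keeps it positive. Moving each chart coordinate by at most \<open>\<delta>\<close> changes
    \<open>coord v\<close> by at most \<open>1 / card \<sigma>\<close>, its value at the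
    barycentre.\<close>
  define c where "c = (\<Sum>v\<in>\<sigma>. \<Sum>j<k. \<bar>A j v\<bar>) + 1"
  define \<delta> where "\<delta> = 1 / (real (card \<sigma>) * c)"
  have c: "c > 0" unfolding c_def by (intro add_nonneg_pos sum_nonneg) auto
  have \<delta>: "\<delta> > 0" using c card by (simp add: \<delta>_def)
  define y0 where "y0 i = (\<Sum>v\<in>\<sigma>. 1 / real (card \<sigma>) * chart X \<sigma> v i)" for i
  have coord_y0: "coord v y0 = 1 / real (card \<sigma>)" if "v \<in> \<sigma>" for v
    by (rule coord_unique[OF _ _ that]) (simp_all add: y0_def card)
  have "PiE {..<k} (\<lambda>i. {y0 i - \<delta>..y0 i + \<delta>}) \<subseteq> T"
  proof
    fix y assume y: "y \<in> PiE {..<k} (\<lambda>i. {y0 i - \<delta>..y0 i + \<delta>})"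
    have "0 \<le> coord v y" if v: "v \<in> \<sigma>" for v
    proof -
      have "\<bar>\<Sum>j<k. (y j - y0 j) * A j v\<bar> \<le> (\<Sum>j<k. \<delta> * \<bar>A j v\<bar>)"
      proof (rule order_trans[OF sum_abs sum_mono])
        fix j assume "j \<in> {..<k}"
        then have "y j \<in> {y0 j - \<delta>..y0 j + \<delta>}" using y by blast
        then have "\<bar>y j - y0 j\<bar> \<le> \<delta>" by (simp add: abs_le_iff)
        then show "\<bar>(y j - y0 j) * A j v\<bar> \<le> \<delta> * \<bar>A j v\<bar>" by (simp add: abs_mult mult_right_mono)
      qed
      also have "\<dots> \<le> \<delta> * c"
      proof -
        have "(\<Sum>j<k. \<bar>A j v\<bar>) \<le> (\<Sum>v\<in>\<sigma>. \<Sum>j<k. \<bar>A j v\<bar>)"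
          by (rule member_le_sum[OF v]) (auto simp: fin sum_nonneg)
        then show ?thesis using \<delta> by (simp add: c_def flip: sum_distrib_left)
      qed
      also have "\<dots> = 1 / real (card \<sigma>)" using c by (simp add: \<delta>_def)
      finally have "\<bar>coord v y - coord v y0\<bar> \<le> 1 / real (card \<sigma>)"
        by (simp add: coord_def left_diff_distrib sum_subtractf)
      then show ?thesis using coord_y0[OF v] by linarith
    qed
    then show "y \<in> T" using y by (auto simp: T_def space_PiM)
  qed
  then have le: "emeasure ?M (PiE {..<k} (\<lambda>i. {y0 i - \<delta>..y0 i + \<delta>})) \<le> emeasure ?M T"
    using T_meas by (intro emeasure_mono)
  have pos: "emeasure ?M (PiE {..<k} (\<lambda>i. {y0 i - \<delta>..y0 i + \<delta>})) > 0"
    using \<delta> by (subst box_measure) (auto simp: prod_pos)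
  have "emeasure ?M T > 0" by (rule order_less_le_trans[OF pos le])
  then have "measure ?M T > 0" using T_fin by (simp add: measure_def enn2real_positive_iff)
  then show ?thesis unfolding simplex_vol_def T_eq by (simp only: k_def)
qed

section \<open>Comparison of free complexes\<close>

abbreviation (input) keys where "keys \<equiv> Poly_Mapping.keys"
abbreviation (input) lookup where "lookup \<equiv> Poly_Mapping.lookup"

definition frag_map :: "('a \<Rightarrow> 'b) \<Rightarrow> ('a \<Rightarrow>\<^sub>0 int) \<Rightarrow> 'b \<Rightarrow>\<^sub>0 int" where
  "frag_map f = frag_extend (\<lambda>x. frag_of (f x))"

lemma frag_extend_frag_extend:
  "frag_extend f (frag_extend g c) = frag_extend (\<lambda>x. frag_extend f (g x)) c"
  by (rule frag_induction[of c UNIV "\<lambda>c. frag_extend f (frag_extend g c) = frag_extend (\<lambda>x. frag_extend f (g x)) c"])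
    (simp_all add: frag_extend_diff)

lemma frag_extend_diff_fun: "frag_extend (\<lambda>x. f x - g x) c = frag_extend f c - frag_extend g c"
  by (rule frag_induction[of c UNIV "\<lambda>c. frag_extend (\<lambda>x. f x - g x) c = frag_extend f c - frag_extend g c"])
    (simp_all add: frag_extend_diff)

lemma frag_extend_frag_of: "frag_extend frag_of c = c"
  by (rule frag_expansion[symmetric])

lemma frag_extend_subset:
  assumes "keys c \<subseteq> E" "\<And>x. x \<in> E \<Longrightarrow> keys (f x) \<subseteq> F"
  shows "keys (frag_extend f c) \<subseteq> F"
  using keys_frag_extend[of f c] assms by blast

lemma frag_extend_cong_keys:
  assumes "keys c \<subseteq> E" "\<And>x. x \<in> E \<Longrightarrow> f x = g x"
  shows "frag_extend f c = frag_extend g c"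
  by (rule frag_extend_eq) (use assms in auto)

lemma frag_map_frag_of [simp]: "frag_map f (frag_of x) = frag_of (f x)"
  and frag_map_zero [simp]: "frag_map f 0 = 0"
  and frag_map_diff: "frag_map f (a - b) = frag_map f a - frag_map f b"
  and frag_map_add: "frag_map f (a + b) = frag_map f a + frag_map f b"
  by (simp_all add: frag_map_def frag_extend_diff frag_extend_add)

lemma frag_extend_frag_map: "frag_extend f (frag_map g c) = frag_extend (\<lambda>x. f (g x)) c"
  by (simp add: frag_map_def frag_extend_frag_extend)

lemma frag_map_frag_extend: "frag_map f (frag_extend g c) = frag_extend (\<lambda>x. frag_map f (g x)) c"
  by (simp add: frag_map_def frag_extend_frag_extend)

lemma frag_map_frag_map: "frag_map f (frag_map g c) = frag_map (\<lambda>x. f (g x)) c"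
  by (simp add: frag_map_def frag_extend_frag_extend)

lemma frag_map_subset:
  assumes "keys c \<subseteq> E" "\<And>x. x \<in> E \<Longrightarrow> f x \<in> F"
  shows "keys (frag_map f c) \<subseteq> F"
  unfolding frag_map_def by (rule frag_extend_subset[OF assms(1)]) (use assms(2) in auto)

lemma frag_map_cong:
  assumes "keys c \<subseteq> E" "\<And>x. x \<in> E \<Longrightarrow> f x = g x"
  shows "frag_map f c = frag_map g c"
  unfolding frag_map_def by (rule frag_extend_cong_keys[OF assms(1)]) (use assms(2) in auto)

lemma frag_map_ident:
  assumes "keys c \<subseteq> E" "\<And>x. x \<in> E \<Longrightarrow> f x = x"
  shows "frag_map f c = c"
  using frag_map_cong[OF assms] by (simp add: frag_map_def frag_extend_frag_of)

lemma keys_diff_subset: "keys a \<subseteq> E \<Longrightarrow> keys b \<subseteq> E \<Longrightarrow> keys (a - b :: 'a \<Rightarrow>\<^sub>0 int) \<subseteq> E"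
  using keys_diff[of a b] by blast

text \<open>Chain groups are given by their bases: \<open>P k\<close> spans dimension
  \<open>k - 1\<close>, and \<open>P 0\<close> is the generator of the augmentation, fixed by the
  group. From index 1 on the basis is a free \<open>G\<close>-set. The group permutes it without
  signs, so the simplices of a cover must be oriented in a way that deck maps preserve.\<close>

locale augmented_complex = group G for G :: "('g, 'x) monoid_scheme" (structure) +
  fixes act :: "'g \<Rightarrow> 'b \<Rightarrow> 'b" and P :: "nat \<Rightarrow> 'b set" and d :: "'b \<Rightarrow> 'b \<Rightarrow>\<^sub>0 int" and z :: 'b
  assumes P0: "P 0 = {z}"
    and act_closed: "g \<in> carrier G \<Longrightarrow> b \<in> P k \<Longrightarrow> act g b \<in> P k"
    and act_mult: "g \<in> carrier G \<Longrightarrow> h \<in> carrier G \<Longrightarrow> b \<in> P k \<Longrightarrow> act (g \<otimes> h) b = act g (act h b)"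
    and act_one: "b \<in> P k \<Longrightarrow> act \<one> b = b"
    and act_free: "g \<in> carrier G \<Longrightarrow> b \<in> P (Suc k) \<Longrightarrow> act g b = b \<Longrightarrow> g = \<one>"
    and degree_unique: "b \<in> P k \<Longrightarrow> b \<in> P l \<Longrightarrow> k = l"
    and d_zero: "d z = 0"
    and d_keys: "b \<in> P (Suc k) \<Longrightarrow> keys (d b) \<subseteq> P k"
    and d_d: "b \<in> P k \<Longrightarrow> frag_extend d (d b) = 0"
    and d_act: "g \<in> carrier G \<Longrightarrow> b \<in> P k \<Longrightarrow> d (act g b) = frag_map (act g) (d b)"
begin

lemma act_base: "g \<in> carrier G \<Longrightarrow> act g z = z"
  using act_closed[of g z 0] P0 by auto

end

text \<open>Index 0 says that the augmentation is onto. Cycles of index \<open>N + 1\<close>, the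
  top chain group in the application, need not bound.\<close>

definition exact_upto :: "nat \<Rightarrow> (nat \<Rightarrow> 'b set) \<Rightarrow> ('b \<Rightarrow> 'b \<Rightarrow>\<^sub>0 int) \<Rightarrow> bool" where
  "exact_upto N P d \<longleftrightarrow> (\<forall>k\<le>N. \<forall>z. keys z \<subseteq> P k \<and> frag_extend d z = 0 \<longrightarrow>
     (\<exists>w. keys w \<subseteq> P (Suc k) \<and> frag_extend d w = z))"

definition equivariant_on ::
    "('g, 'x) monoid_scheme \<Rightarrow> ('g \<Rightarrow> 'b \<Rightarrow> 'b) \<Rightarrow> ('g \<Rightarrow> 'c \<Rightarrow> 'c) \<Rightarrow> 'b set \<Rightarrow> ('b \<Rightarrow> 'c \<Rightarrow>\<^sub>0 int) \<Rightarrow> bool" where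
  "equivariant_on G act act' E f \<longleftrightarrow>
     (\<forall>g\<in>carrier G. \<forall>b\<in>E. f (act g b) = frag_map (act' g) (f b))"

lemma equivariant_onD:
  "equivariant_on G act act' E f \<Longrightarrow> g \<in> carrier G \<Longrightarrow> b \<in> E \<Longrightarrow> f (act g b) = frag_map (act' g) (f b)"
  by (simp add: equivariant_on_def)

lemma equivariant_on_extend:
  assumes "equivariant_on G act act' E f" "g \<in> carrier G" "keys c \<subseteq> E"
  shows "frag_extend f (frag_map (act g) c) = frag_map (act' g) (frag_extend f c)"
  unfolding frag_extend_frag_map frag_map_frag_extend
  by (rule frag_extend_cong_keys[OF assms(3)]) (use assms in \<open>simp add: equivariant_on_def\<close>)

text \<open>Choose on one representative per orbit and transport. Freeness makes the element
  \<open>\<gamma> b\<close> that carries the representative to \<open>b\<close> unique, hence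
  compatible with the action. The law for \<open>act'\<close> is asked only on values related by
  \<open>R\<close>, since an action on basis elements gives a group law only for chains over the
  basis.\<close>

lemma (in group) equivariant_choice:
  assumes act: "\<And>g b. g \<in> carrier G \<Longrightarrow> b \<in> E \<Longrightarrow> act g b \<in> E"
      "\<And>g h b. g \<in> carrier G \<Longrightarrow> h \<in> carrier G \<Longrightarrow> b \<in> E \<Longrightarrow> act (g \<otimes> h) b = act g (act h b)"
      "\<And>b. b \<in> E \<Longrightarrow> act \<one> b = b"
      "\<And>g b. g \<in> carrier G \<Longrightarrow> b \<in> E \<Longrightarrow> act g b = b \<Longrightarrow> g = \<one>"
    and ex: "\<And>b. b \<in> E \<Longrightarrow> \<exists>w. R b w"
    and R: "\<And>g b w. g \<in> carrier G \<Longrightarrow> b \<in> E \<Longrightarrow> R b w \<Longrightarrow> R (act g b) (act' g w)"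
    and act': "\<And>g h b w. g \<in> carrier G \<Longrightarrow> h \<in> carrier G \<Longrightarrow> b \<in> E \<Longrightarrow> R b w \<Longrightarrow>
      act' (g \<otimes> h) w = act' g (act' h w)"
  obtains f where "\<And>b. b \<in> E \<Longrightarrow> R b (f b)"
    "\<And>g b. g \<in> carrier G \<Longrightarrow> b \<in> E \<Longrightarrow> f (act g b) = act' g (f b)"
proof -
  define orb where "orb b = {act g b | g. g \<in> carrier G}" for b
  \<comment> \<open>The choice is made from the orbit as a set, so all its elements get the same
    representative.\<close>
  define r where "r b = (SOME x. x \<in> orb b)" for b
  have orb_act: "orb (act g b) = orb b" if "g \<in> carrier G" "b \<in> E" for g b
  proof
    show "orb (act g b) \<subseteq> orb b"
    proof
      fix x assume "x \<in> orb (act g b)"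
      then obtain h where h: "h \<in> carrier G" "x = act h (act g b)" by (auto simp: orb_def)
      then have "x = act (h \<otimes> g) b" using act(2)[of h g b] that by simp
      then show "x \<in> orb b" using h that by (auto simp: orb_def)
    qed
    show "orb b \<subseteq> orb (act g b)"
    proof
      fix x assume "x \<in> orb b"
      then obtain h where h: "h \<in> carrier G" "x = act h b" by (auto simp: orb_def)
      have "x = act (h \<otimes> inv g \<otimes> g) b" using h that by (simp add: m_assoc)
      also have "\<dots> = act (h \<otimes> inv g) (act g b)" using h that by (intro act(2)) auto
      finally show "x \<in> orb (act g b)" using h that by (auto simp: orb_def)
    qed
  qed
  have r_orb: "r b \<in> orb b" if "b \<in> E" for b
    unfolding r_def by (rule someI[of _ b]) (use act(3)[OF that] in \<open>force simp: orb_def\<close>)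
  have rE: "r b \<in> E" if "b \<in> E" for b using r_orb[OF that] act(1) that by (auto simp: orb_def)
  have "\<exists>g. g \<in> carrier G \<and> act g (r b) = b" if b: "b \<in> E" for b
  proof -
    obtain h where h: "h \<in> carrier G" "r b = act h b" using r_orb[OF b] by (auto simp: orb_def)
    then have "act (inv h) (r b) = b" using act(2)[of "inv h" h b] act(3) b by simp
    then show ?thesis using h by (metis inv_closed)
  qed
  then obtain \<gamma> where \<gamma>: "\<And>b. b \<in> E \<Longrightarrow> \<gamma> b \<in> carrier G" "\<And>b. b \<in> E \<Longrightarrow> act (\<gamma> b) (r b) = b"
    by metis
  have \<gamma>_act: "\<gamma> (act g b) = g \<otimes> \<gamma> b" if g: "g \<in> carrier G" and b: "b \<in> E" for g b
  proof -
    have r: "r (act g b) = r b" using orb_act[OF g b] by (simp add: r_def)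
    have eq: "act (\<gamma> (act g b)) (r b) = act (g \<otimes> \<gamma> b) (r b)"
      using \<gamma>(2)[OF act(1)[OF g b]] r act(2)[OF g \<gamma>(1)[OF b] rE[OF b]] \<gamma>(2)[OF b] by simp
    have c: "\<gamma> (act g b) \<in> carrier G" "g \<otimes> \<gamma> b \<in> carrier G" using \<gamma>(1) act(1) g b by auto
    have "act (inv (g \<otimes> \<gamma> b) \<otimes> \<gamma> (act g b)) (r b) = r b"
      using act(2)[OF inv_closed[OF c(2)] c(1) rE[OF b]] eq
        act(2)[OF inv_closed[OF c(2)] c(2) rE[OF b]] act(3)[OF rE[OF b]] c by simp
    then have "inv (g \<otimes> \<gamma> b) \<otimes> \<gamma> (act g b) = \<one>" using act(4)[OF _ rE[OF b]] c by simp
    then show ?thesis using c by (metis inv_equality inv_inv inv_closed)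
  qed
  define f where "f b = act' (\<gamma> b) (SOME w. R (r b) w)" for b
  have Rr: "R (r b) (SOME w. R (r b) w)" if "b \<in> E" for b
    using ex[OF rE[OF that]] by (rule someI_ex)
  show ?thesis
  proof
    show "R b (f b)" if "b \<in> E" for b
      using R[OF \<gamma>(1)[OF that] rE[OF that] Rr[OF that]] \<gamma>(2)[OF that] by (simp add: f_def)
    show "f (act g b) = act' g (f b)" if "g \<in> carrier G" "b \<in> E" for g b
    proof -
      have "r (act g b) = r b" using orb_act[OF that] by (simp add: r_def)
      then show ?thesis
        using act'[OF that(1) \<gamma>(1)[OF that(2)] rE[OF that(2)] Rr[OF that(2)]] \<gamma>_act[OF that]
        by (simp add: f_def)
    qed
  qed
qed

section \<open>Equivariant chain maps and homotopies\<close>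

locale complex_pair =
  P: augmented_complex G actP P dP zP + Q: augmented_complex G actQ Q dQ zQ
  for G :: "('g, 'x) monoid_scheme" (structure) and actP :: "'g \<Rightarrow> 'b \<Rightarrow> 'b" and P dP zP
    and actQ :: "'g \<Rightarrow> 'c \<Rightarrow> 'c" and Q dQ zQ
begin

lemma frag_map_act_mult:
  assumes "g \<in> carrier G" "h \<in> carrier G" "keys c \<subseteq> Q k"
  shows "frag_map (actQ (g \<otimes> h)) c = frag_map (actQ g) (frag_map (actQ h) c)"
  unfolding frag_map_frag_map by (rule frag_map_cong[OF assms(3)]) (use assms Q.act_mult in simp)

text \<open>The inductive step shared by \<open>chain_map_exists\<close> and
  \<open>homotopy_exists\<close>: exactness of \<open>Q\<close> provides preimages of the cycles
  \<open>T b\<close>, and freeness of the basis of \<open>P\<close> makes the choice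
  equivariant.\<close>

lemma lift_cycles:
  assumes ex: "exact_upto N Q dQ" "j \<le> N"
    and T: "equivariant_on G actP actQ (P (Suc k)) T" "\<And>b. b \<in> P (Suc k) \<Longrightarrow> keys (T b) \<subseteq> Q j"
      "\<And>b. b \<in> P (Suc k) \<Longrightarrow> frag_extend dQ (T b) = 0"
  obtains f where "equivariant_on G actP actQ (P (Suc k)) f"
    "\<And>b. b \<in> P (Suc k) \<Longrightarrow> keys (f b) \<subseteq> Q (Suc j)"
    "\<And>b. b \<in> P (Suc k) \<Longrightarrow> frag_extend dQ (f b) = T b"
proof -
  note result = that
  have dQ_eq: "frag_extend dQ (frag_map (actQ g) w) = frag_map (actQ g) (frag_extend dQ w)"
    if "g \<in> carrier G" "keys w \<subseteq> Q (Suc j)" for g w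
    by (rule equivariant_on_extend[of G actQ actQ "Q (Suc j)" dQ])
      (use that Q.d_act in \<open>auto simp: equivariant_on_def\<close>)
  show ?thesis
  proof (rule P.equivariant_choice[of "P (Suc k)" actP "\<lambda>b w. keys w \<subseteq> Q (Suc j) \<and> frag_extend dQ w = T b"
        "\<lambda>g. frag_map (actQ g)"])
    show "\<exists>w. keys w \<subseteq> Q (Suc j) \<and> frag_extend dQ w = T b" if "b \<in> P (Suc k)" for b
      using ex T(2,3)[OF that] unfolding exact_upto_def by blast
    show "keys (frag_map (actQ g) w) \<subseteq> Q (Suc j) \<and> frag_extend dQ (frag_map (actQ g) w) = T (actP g b)"
      if "g \<in> carrier G" "b \<in> P (Suc k)" "keys w \<subseteq> Q (Suc j) \<and> frag_extend dQ w = T b" for g b w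
      using that dQ_eq equivariant_onD[OF T(1) that(1,2)] Q.act_closed[OF that(1)]
        frag_map_subset[of w "Q (Suc j)" "actQ g" "Q (Suc j)"] by simp
    show thesis if "\<And>b. b \<in> P (Suc k) \<Longrightarrow> keys (f b) \<subseteq> Q (Suc j) \<and> frag_extend dQ (f b) = T b"
      "\<And>g b. g \<in> carrier G \<Longrightarrow> b \<in> P (Suc k) \<Longrightarrow> f (actP g b) = frag_map (actQ g) (f b)" for f
      by (rule result[of f]) (use that in \<open>auto simp: equivariant_on_def\<close>)
    show "frag_map (actQ (g \<otimes> h)) w = frag_map (actQ g) (frag_map (actQ h) w)"
      if "g \<in> carrier G" "h \<in> carrier G" "keys w \<subseteq> Q (Suc j) \<and> frag_extend dQ w = T b" for g h w b
      using frag_map_act_mult[of g h w "Suc j"] that by simp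
  qed (simp_all add: P.act_closed P.act_mult[of _ _ _ "Suc k"] P.act_one[of _ "Suc k"] P.act_free[of _ _ k])
qed

definition chain_map :: "nat \<Rightarrow> ('b \<Rightarrow> 'c \<Rightarrow>\<^sub>0 int) \<Rightarrow> bool" where
  "chain_map N f \<longleftrightarrow> f zP = frag_of zQ \<and>
     (\<forall>k\<le>N. equivariant_on G actP actQ (P k) f \<and>
       (\<forall>b\<in>P k. keys (f b) \<subseteq> Q k \<and> frag_extend dQ (f b) = frag_extend f (dP b)))"

lemma chain_mapD:
  assumes "chain_map N f" "k \<le> N"
  shows "equivariant_on G actP actQ (P k) f" "b \<in> P k \<Longrightarrow> keys (f b) \<subseteq> Q k"
    "b \<in> P k \<Longrightarrow> frag_extend dQ (f b) = frag_extend f (dP b)"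
  using assms by (auto simp: chain_map_def)

lemma chain_map_extend:
  assumes "chain_map N f" "k \<le> N" "keys c \<subseteq> P k"
  shows "keys (frag_extend f c) \<subseteq> Q k"
    "frag_extend dQ (frag_extend f c) = frag_extend f (frag_extend dP c)"
proof -
  show "keys (frag_extend f c) \<subseteq> Q k"
    using assms(3) chain_mapD(2)[OF assms(1,2)] by (rule frag_extend_subset)
  show "frag_extend dQ (frag_extend f c) = frag_extend f (frag_extend dP c)"
    unfolding frag_extend_frag_extend
    by (rule frag_extend_cong_keys[OF assms(3)]) (rule chain_mapD(3)[OF assms(1,2)])
qed

text \<open>The value at index \<open>Suc k\<close> fills a cycle of index \<open>k\<close> in
  \<open>Q\<close>; so exactness through \<open>N\<close> carries the map one index further, to
  \<open>Suc N\<close>.\<close>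

lemma chain_map_exists:
  assumes "exact_upto N Q dQ" shows "k \<le> Suc N \<Longrightarrow> \<exists>f. chain_map k f"
proof (induction k)
  case 0
  have "chain_map 0 (\<lambda>_. frag_of zQ)"
    using P.act_base Q.act_base by (auto simp: chain_map_def P.P0 Q.P0 equivariant_on_def P.d_zero Q.d_zero)
  then show ?case by blast
next
  case (Suc k)
  then obtain f where f: "chain_map k f" by auto
  have eq: "equivariant_on G actP actQ (P (Suc k)) (\<lambda>b. frag_extend f (dP b))"
    unfolding equivariant_on_def
    using P.d_act P.d_keys equivariant_on_extend[OF chain_mapD(1)[OF f order_refl]] by simp
  obtain h where h: "equivariant_on G actP actQ (P (Suc k)) h"
    "\<And>b. b \<in> P (Suc k) \<Longrightarrow> keys (h b) \<subseteq> Q (Suc k)"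
    "\<And>b. b \<in> P (Suc k) \<Longrightarrow> frag_extend dQ (h b) = frag_extend f (dP b)"
  proof -
    have kN: "k \<le> N" using Suc.prems by simp
    have "keys (frag_extend f (dP b)) \<subseteq> Q k" "frag_extend dQ (frag_extend f (dP b)) = 0" if "b \<in> P (Suc k)" for b
      using chain_map_extend[OF f order_refl P.d_keys[OF that]] P.d_d[OF that] by simp_all
    from lift_cycles[OF assms kN eq this] that show ?thesis by metis
  qed
  \<comment> \<open>One function serves all degrees; by \<open>degree_unique\<close> the new values
    on \<open>P (Suc k)\<close> do not touch the lower ones.\<close>
  define f' where "f' b = (if b \<in> P (Suc k) then h b else f b)" for b
  have f'_low: "f' b = f b" if "b \<in> P j" "j \<le> k" for b j
    using that P.degree_unique[of b j "Suc k"] by (auto simp: f'_def)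
  have "chain_map (Suc k) f'"
    unfolding chain_map_def
  proof (intro conjI allI impI ballI)
    show "f' zP = frag_of zQ" using f'_low[of zP 0] f P.P0 by (simp add: chain_map_def)
    fix j assume j: "j \<le> Suc k"
    have ext: "frag_extend f' (dP b) = frag_extend f (dP b)" if "b \<in> P j" for b
    proof (cases j)
      case 0
      then show ?thesis using that P.P0 P.d_zero by simp
    next
      case (Suc i)
      then have "keys (dP b) \<subseteq> P i" using that P.d_keys by simp
      then show ?thesis using f'_low Suc j by (intro frag_extend_cong_keys) auto
    qed
    show "equivariant_on G actP actQ (P j) f'"
    proof (cases "j = Suc k")
      case True
      then show ?thesis using h(1) P.act_closed by (simp add: equivariant_on_def f'_def)
    next
      case False
      then have "j \<le> k" using j by simp
      then show ?thesis
        using chain_mapD(1)[OF f, of j] f'_low[of _ j] P.act_closed by (simp add: equivariant_on_def)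
    qed
    fix b assume b: "b \<in> P j"
    show "keys (f' b) \<subseteq> Q j" "frag_extend dQ (f' b) = frag_extend f' (dP b)"
    proof -
      have "keys (f' b) \<subseteq> Q j \<and> frag_extend dQ (f' b) = frag_extend f (dP b)"
      proof (cases "j = Suc k")
        case True
        then show ?thesis using h b by (simp add: f'_def)
      next
        case False
        then have "j \<le> k" using j by simp
        then show ?thesis using chain_mapD(2,3)[OF f _ b] f'_low[OF b] by simp
      qed
      then show "keys (f' b) \<subseteq> Q j" "frag_extend dQ (f' b) = frag_extend f' (dP b)"
        using ext[OF b] by auto
    qed
  qed
  then show ?case by blast
qed

definition homotopy :: "nat \<Rightarrow> ('b \<Rightarrow> 'c \<Rightarrow>\<^sub>0 int) \<Rightarrow> ('b \<Rightarrow> 'c \<Rightarrow>\<^sub>0 int) \<Rightarrow> ('b \<Rightarrow> 'c \<Rightarrow>\<^sub>0 int) \<Rightarrow> bool" where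
  "homotopy N f f' h \<longleftrightarrow>
     (\<forall>k\<le>N. equivariant_on G actP actQ (P k) h \<and>
       (\<forall>b\<in>P k. keys (h b) \<subseteq> Q (Suc k) \<and> frag_extend dQ (h b) = f b - f' b - frag_extend h (dP b)))"

lemma homotopyD:
  assumes "homotopy N f f' h" "k \<le> N"
  shows "equivariant_on G actP actQ (P k) h" "b \<in> P k \<Longrightarrow> keys (h b) \<subseteq> Q (Suc k)"
    "b \<in> P k \<Longrightarrow> frag_extend dQ (h b) = f b - f' b - frag_extend h (dP b)"
  using assms by (auto simp: homotopy_def)

lemma homotopy_extend:
  assumes "homotopy N f f' h" "k \<le> N" "keys c \<subseteq> P k"
  shows "keys (frag_extend h c) \<subseteq> Q (Suc k)"
    "frag_extend dQ (frag_extend h c) = frag_extend f c - frag_extend f' c - frag_extend h (frag_extend dP c)"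
proof -
  show "keys (frag_extend h c) \<subseteq> Q (Suc k)"
    using assms(3) homotopyD(2)[OF assms(1,2)] by (rule frag_extend_subset)
  show "frag_extend dQ (frag_extend h c) = frag_extend f c - frag_extend f' c - frag_extend h (frag_extend dP c)"
    unfolding frag_extend_frag_extend frag_extend_diff_fun[symmetric]
    by (rule frag_extend_cong_keys[OF assms(3)]) (rule homotopyD(3)[OF assms(1,2)])
qed

text \<open>The homotopy at index \<open>k\<close> fills a cycle of the same index \<open>k\<close>
  in \<open>Q\<close>, so in contrast to chain maps it stops at \<open>N\<close>.\<close>

lemma homotopy_exists:
  assumes "exact_upto N Q dQ" and f: "chain_map N f" and f': "chain_map N f'"
  shows "k \<le> N \<Longrightarrow> \<exists>h. homotopy k f f' h"
proof (induction k)
  case 0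
  \<comment> \<open>Both chain maps send the augmentation generator to that of \<open>Q\<close>, so
    there is nothing to fill at index 0.\<close>
  have "homotopy 0 f f' (\<lambda>_. 0)"
    using f f' by (auto simp: homotopy_def P.P0 equivariant_on_def chain_map_def P.d_zero)
  then show ?case by blast
next
  case (Suc k)
  then obtain h where h: "homotopy k f f' h" by auto
  let ?T = "\<lambda>b. f b - f' b - frag_extend h (dP b)"
  have eq: "equivariant_on G actP actQ (P (Suc k)) ?T"
    unfolding equivariant_on_def
    using P.d_act P.d_keys equivariant_on_extend[OF homotopyD(1)[OF h order_refl]]
      equivariant_onD[OF chain_mapD(1)[OF f Suc.prems]] equivariant_onD[OF chain_mapD(1)[OF f' Suc.prems]]
    by (simp add: frag_map_diff)
  obtain u where u: "equivariant_on G actP actQ (P (Suc k)) u"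
    "\<And>b. b \<in> P (Suc k) \<Longrightarrow> keys (u b) \<subseteq> Q (Suc (Suc k))"
    "\<And>b. b \<in> P (Suc k) \<Longrightarrow> frag_extend dQ (u b) = ?T b"
  proof -
    have keysT: "keys (?T b) \<subseteq> Q (Suc k)" and dT: "frag_extend dQ (?T b) = 0" if b: "b \<in> P (Suc k)" for b
    proof -
      show "keys (?T b) \<subseteq> Q (Suc k)"
        using chain_mapD(2)[OF f Suc.prems b] chain_mapD(2)[OF f' Suc.prems b]
          homotopy_extend(1)[OF h order_refl P.d_keys[OF b]] by (intro keys_diff_subset)
      show "frag_extend dQ (?T b) = 0"
        using chain_mapD(3)[OF f Suc.prems b] chain_mapD(3)[OF f' Suc.prems b]
          homotopy_extend(2)[OF h order_refl P.d_keys[OF b]] P.d_d[OF b] by (simp add: frag_extend_diff)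
    qed
    obtain v where "equivariant_on G actP actQ (P (Suc k)) v"
      "\<And>b. b \<in> P (Suc k) \<Longrightarrow> keys (v b) \<subseteq> Q (Suc (Suc k))"
      "\<And>b. b \<in> P (Suc k) \<Longrightarrow> frag_extend dQ (v b) = ?T b"
      using lift_cycles[OF assms(1) Suc.prems eq keysT dT] by metis
    then show ?thesis using that by blast
  qed
  define h' where "h' b = (if b \<in> P (Suc k) then u b else h b)" for b
  have h'_low: "h' b = h b" if "b \<in> P j" "j \<le> k" for b j
    using that P.degree_unique[of b j "Suc k"] by (auto simp: h'_def)
  have "homotopy (Suc k) f f' h'"
    unfolding homotopy_def
  proof (intro conjI allI impI ballI)
    fix j assume j: "j \<le> Suc k"
    have ext: "frag_extend h' (dP b) = frag_extend h (dP b)" if "b \<in> P j" for b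
    proof (cases j)
      case 0
      then show ?thesis using that P.P0 P.d_zero by simp
    next
      case (Suc i)
      then have "keys (dP b) \<subseteq> P i" using that P.d_keys by simp
      then show ?thesis using h'_low Suc j by (intro frag_extend_cong_keys) auto
    qed
    show "equivariant_on G actP actQ (P j) h'"
    proof (cases "j = Suc k")
      case True
      then show ?thesis using u(1) P.act_closed by (simp add: equivariant_on_def h'_def)
    next
      case False
      then have "j \<le> k" using j by simp
      then show ?thesis
        using homotopyD(1)[OF h, of j] h'_low[of _ j] P.act_closed by (simp add: equivariant_on_def)
    qed
    fix b assume b: "b \<in> P j"
    have "keys (h' b) \<subseteq> Q (Suc j) \<and> frag_extend dQ (h' b) = f b - f' b - frag_extend h (dP b)"
    proof (cases "j = Suc k")
      case True
      then show ?thesis using u b by (simp add: h'_def)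
    next
      case False
      then have "j \<le> k" using j by simp
      then show ?thesis using homotopyD(2,3)[OF h _ b] h'_low[OF b] by simp
    qed
    then show "keys (h' b) \<subseteq> Q (Suc j)" "frag_extend dQ (h' b) = f b - f' b - frag_extend h' (dP b)"
      using ext[OF b] by auto
  qed
  then show ?case by blast
qed

end

section \<open>The bar resolution\<close>

text \<open>The homogeneous bar resolution; \<open>bar_d_sum\<close> unrolls the recursion to the
  usual alternating sum of omissions. The empty list generates the augmentation. In recursive form
  the boundary says that prepending \<open>x\<close> is a contracting homotopy.\<close>

fun bar_d :: "'a list \<Rightarrow> 'a list \<Rightarrow>\<^sub>0 int" where
  "bar_d [] = 0"
| "bar_d (x # xs) = frag_of xs - frag_map (Cons x) (bar_d xs)"

definition bar_act :: "('g, 'x) monoid_scheme \<Rightarrow> 'g \<Rightarrow> 'g list \<Rightarrow> 'g list" where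
  "bar_act G g = map (\<lambda>x. g \<otimes>\<^bsub>G\<^esub> x)"

context group
begin

lemma bar_d_keys: "xs \<in> tuples G (Suc k) \<Longrightarrow> keys (bar_d xs) \<subseteq> tuples G k"
proof (induction xs arbitrary: k)
  case (Cons x xs)
  have xs: "xs \<in> tuples G k" "x \<in> carrier G" using Cons.prems by (auto simp: tuples_def)
  have "keys (frag_map (Cons x) (bar_d xs)) \<subseteq> tuples G k"
  proof (cases k)
    case 0
    then show ?thesis using xs by (simp add: tuples_def)
  next
    case (Suc j)
    show ?thesis
      by (rule frag_map_subset[of _ "tuples G j"]) (use Cons.IH[of j] xs Suc in \<open>auto simp: tuples_def\<close>)
  qed
  then show ?case using xs keys_diff_subset[of "frag_of xs" "tuples G k"] by simp
qed (simp add: tuples_def)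

text \<open>Applying the recursion once more to chains that begin with \<open>x\<close> cancels
  \<open>bar_d xs\<close> and leaves \<open>x\<close> prepended to the double boundary of
  \<open>xs\<close>.\<close>

lemma bar_d_d: "frag_extend bar_d (bar_d xs) = 0"
proof (induction xs)
  case (Cons x xs)
  have "frag_extend bar_d (frag_map (Cons x) (bar_d xs)) = bar_d xs - frag_map (Cons x) (frag_extend bar_d (bar_d xs))"
    by (simp add: frag_extend_frag_map frag_extend_diff_fun frag_map_frag_extend frag_extend_frag_of)
  then show ?case using Cons.IH by (simp add: frag_extend_diff)
qed simp

lemma bar_d_map: "bar_d (map f xs) = frag_map (map f) (bar_d xs)"
  by (induction xs) (simp_all add: frag_map_diff frag_map_frag_map)

lemma bar_complex: "augmented_complex G (bar_act G) (tuples G) bar_d []"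
proof (unfold_locales, goal_cases)
  case (3 g h b k)
  then show ?case by (auto simp: bar_act_def tuples_def m_assoc)
next
  case (4 b k)
  then show ?case by (auto simp: bar_act_def tuples_def intro!: map_idI)
next
  case (5 g b k)
  then obtain x xs where b: "b = x # xs" "x \<in> carrier G" by (cases b) (auto simp: tuples_def)
  then have "g \<otimes> x = x" using 5 by (simp add: bar_act_def)
  then have "x \<otimes> inv x = g \<otimes> (x \<otimes> inv x)"
    using b(2) 5(1) m_assoc[of g x "inv x"] by simp
  then show ?case using b(2) 5(1) by simp
next
  case (8 b k)
  then show ?case by (rule bar_d_keys)
qed (auto simp: bar_act_def tuples_def bar_d_d bar_d_map)

text \<open>Prepending \<open>\<one>\<close> contracts the complex in every index. The contraction
  is not equivariant, but exactness concerns the underlying abelian groups.\<close>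

lemma bar_exact: "exact_upto N (tuples G) bar_d"
  unfolding exact_upto_def
proof (intro allI impI, elim conjE)
  fix k and z :: "'a list \<Rightarrow>\<^sub>0 int" assume z: "keys z \<subseteq> tuples G k" "frag_extend bar_d z = 0"
  have "keys (frag_map (Cons \<one>) z) \<subseteq> tuples G (Suc k)"
    by (rule frag_map_subset[OF z(1)]) (auto simp: tuples_def)
  moreover have "frag_extend bar_d (frag_map (Cons \<one>) z) = z - frag_map (Cons \<one>) (frag_extend bar_d z)"
    by (simp add: frag_extend_frag_map frag_extend_diff_fun frag_map_frag_extend frag_extend_frag_of)
  ultimately show "\<exists>w. keys w \<subseteq> tuples G (Suc k) \<and> frag_extend bar_d w = z" using z(2) by auto
qed

end

section \<open>Homogeneous tuples against inhomogeneous cochains\<close>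

abbreviation omit_nth :: "nat \<Rightarrow> 'a list \<Rightarrow> 'a list" where
  "omit_nth i xs \<equiv> take i xs @ drop (Suc i) xs"

lemma bar_d_sum: "bar_d xs = (\<Sum>i<length xs. frag_cmul ((- 1) ^ i) (frag_of (omit_nth i xs)))"
proof (induction xs)
  case (Cons x xs)
  have "frag_map (Cons x) (bar_d xs) = (\<Sum>i<length xs. frag_cmul ((- 1) ^ i) (frag_of (x # omit_nth i xs)))"
    unfolding Cons.IH frag_map_def by (simp add: frag_extend_sum frag_extend_cmul o_def)
  then have "bar_d (x # xs) = frag_of xs + (\<Sum>i<length xs. frag_cmul ((- 1) ^ Suc i) (frag_of (x # omit_nth i xs)))"
    by (simp add: sum_negf flip: minus_frag_cmul)
  then show ?case by (simp add: sum.lessThan_Suc_shift del: sum.lessThan_Suc)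
qed simp

text \<open>The dictionary between inhomogeneous tuples, on which \<open>cochains\<close> are
  defined, and homogeneous ones: once the first entry \<open>h\<close> is fixed,
  \<open>partial_products\<close> and \<open>quotients\<close> are inverse to each other, and the
  group moves only \<open>h\<close>.\<close>

fun partial_products :: "('g, 'x) monoid_scheme \<Rightarrow> 'g \<Rightarrow> 'g list \<Rightarrow> 'g list" where
  "partial_products G h [] = [h]"
| "partial_products G h (g # gs) = h # partial_products G (h \<otimes>\<^bsub>G\<^esub> g) gs"

fun quotients :: "('g, 'x) monoid_scheme \<Rightarrow> 'g list \<Rightarrow> 'g list" where
  "quotients G (x # y # xs) = (inv\<^bsub>G\<^esub> x \<otimes>\<^bsub>G\<^esub> y) # quotients G (y # xs)"
| "quotients G _ = []"

lemma length_partial_products [simp]: "length (partial_products G h gs) = Suc (length gs)"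
  by (induction gs arbitrary: h) auto

lemma hd_partial_products [simp]: "hd (partial_products G h gs) = h"
  by (cases gs) auto

context group
begin

lemma partial_products_tuples:
  "h \<in> carrier G \<Longrightarrow> gs \<in> tuples G k \<Longrightarrow> partial_products G h gs \<in> tuples G (Suc k)"
  by (induction gs arbitrary: h k) (auto simp: tuples_def)

lemma map_partial_products:
  "x \<in> carrier G \<Longrightarrow> h \<in> carrier G \<Longrightarrow> gs \<in> tuples G k \<Longrightarrow>
    bar_act G x (partial_products G h gs) = partial_products G (x \<otimes> h) gs"
  by (induction gs arbitrary: h k) (auto simp: tuples_def bar_act_def m_assoc)

lemma quotients_partial_products:
  "h \<in> carrier G \<Longrightarrow> gs \<in> tuples G k \<Longrightarrow> quotients G (partial_products G h gs) = gs"
proof (induction gs arbitrary: h k)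
  case (Cons g gs)
  then have g: "g \<in> carrier G" "gs \<in> tuples G (length gs)" by (auto simp: tuples_def)
  obtain r where r: "partial_products G (h \<otimes> g) gs = (h \<otimes> g) # r"
    by (cases gs) auto
  have "quotients G (partial_products G (h \<otimes> g) gs) = gs"
    using Cons.IH[of "h \<otimes> g" "length gs"] g Cons.prems(1) by simp
  then show ?case using r g Cons.prems(1) by (simp add: m_assoc[symmetric])
qed simp

lemma quotients_tuples: "xs \<in> tuples G (Suc k) \<Longrightarrow> quotients G xs \<in> tuples G k"
proof (induction xs arbitrary: k rule: induct_list012)
  case (3 x y xs)
  then have "quotients G (y # xs) \<in> tuples G (length xs)" using 3(2)[of "length xs"] by (auto simp: tuples_def)
  then show ?case using 3(3) by (auto simp: tuples_def)
qed (auto simp: tuples_def)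

lemma partial_products_quotients:
  "xs \<in> tuples G (Suc k) \<Longrightarrow> partial_products G (hd xs) (quotients G xs) = xs"
proof (induction xs arbitrary: k rule: induct_list012)
  case (3 x y xs)
  then have "y # xs \<in> tuples G (Suc (length xs))" "x \<in> carrier G" "y \<in> carrier G" by (auto simp: tuples_def)
  then show ?case using 3(2)[of "length xs"] by (simp add: m_assoc[symmetric])
qed (auto simp: tuples_def)

lemma quotients_act: "g \<in> carrier G \<Longrightarrow> xs \<in> tuples G k \<Longrightarrow> quotients G (bar_act G g xs) = quotients G xs"
proof (induction xs arbitrary: k rule: induct_list012)
  case (3 x y xs)
  then have "y # xs \<in> tuples G (Suc (length xs))" and xy: "x \<in> carrier G" "y \<in> carrier G" by (auto simp: tuples_def)
  moreover have "inv (g \<otimes> x) \<otimes> (g \<otimes> y) = inv x \<otimes> y"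
    using xy 3(3) by (simp add: inv_mult_group m_assoc) (simp add: m_assoc[symmetric])
  ultimately show ?case using 3(2)[of "Suc (length xs)"] 3(3) by (simp add: bar_act_def)
qed (auto simp: bar_act_def)

text \<open>Leaving out an inner partial product merges the two factors around it; this is where the
  inner terms of \<open>codiff\<close> come from.\<close>

lemma omit_nth_partial_products:
  assumes "h \<in> carrier G" "gs \<in> tuples G k" "Suc j < length gs"
  shows "omit_nth (Suc j) (partial_products G h gs) = partial_products G h (mult_adjacent G j gs)"
  using assms
proof (induction gs arbitrary: h j k)
  case (Cons g gs)
  then have g: "g \<in> carrier G" "gs \<in> tuples G (length gs)" by (auto simp: tuples_def)
  show ?case
  proof (cases j)
    case 0
    then obtain g' r where r: "gs = g' # r" using Cons.prems(3) by (cases gs) auto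
    then have "g' \<in> carrier G" using g by (auto simp: tuples_def)
    then show ?thesis using 0 r g Cons.prems(1) by (simp add: mult_adjacent_def m_assoc)
  next
    case (Suc i)
    have "omit_nth (Suc i) (partial_products G (h \<otimes> g) gs) = partial_products G (h \<otimes> g) (mult_adjacent G i gs)"
      using Cons.IH[OF _ g(2)] Cons.prems Suc g by simp
    then show ?thesis using Suc by (simp add: mult_adjacent_def)
  qed
qed simp

lemma omit_last_partial_products:
  "gs \<noteq> [] \<Longrightarrow> omit_nth (length gs) (partial_products G h gs) = partial_products G h (butlast gs)"
proof (induction gs arbitrary: h)
  case (Cons g gs)
  then show ?case by (cases gs) auto
qed simp

lemma mult_adjacent_tuples:
  "gs \<in> tuples G (Suc k) \<Longrightarrow> j < k \<Longrightarrow> mult_adjacent G j gs \<in> tuples G k"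
  by (auto simp: mult_adjacent_def tuples_def dest: in_set_takeD in_set_dropD intro!: m_closed)

end

section \<open>Submodules of chains as coefficients, and the use of vanishing cohomology\<close>

locale coefficient_module = group G for G :: "('g, 'x) monoid_scheme" (structure) +
  fixes act :: "'g \<Rightarrow> 'c \<Rightarrow> 'c" and Q :: "'c set" and B :: "('c \<Rightarrow>\<^sub>0 int) set" and D :: "'g list \<Rightarrow> 'c"
  assumes Q: "\<And>g b. g \<in> carrier G \<Longrightarrow> b \<in> Q \<Longrightarrow> act g b \<in> Q"
      "\<And>g h b. g \<in> carrier G \<Longrightarrow> h \<in> carrier G \<Longrightarrow> b \<in> Q \<Longrightarrow> act (g \<otimes> h) b = act g (act h b)"
      "\<And>b. b \<in> Q \<Longrightarrow> act \<one> b = b"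
    and D: "Q \<subseteq> range D"
    and B_keys: "c \<in> B \<Longrightarrow> keys c \<subseteq> Q" and B_zero: "0 \<in> B"
    and B_diff: "a \<in> B \<Longrightarrow> b \<in> B \<Longrightarrow> a - b \<in> B"
    and B_act: "g \<in> carrier G \<Longrightarrow> c \<in> B \<Longrightarrow> frag_map (act g) c \<in> B"
begin

text \<open>Pulling coefficients back along \<open>D\<close> embeds \<open>B\<close> into the type \<^typ>\<open>'g list \<Rightarrow> int\<close> of the modules
  that enter the definition of the cohomological dimension.\<close>

definition code :: "('c \<Rightarrow>\<^sub>0 int) \<Rightarrow> 'g list \<Rightarrow> int" where
  "code c = (\<lambda>t. lookup c (D t))"

definition decode :: "('g list \<Rightarrow> int) \<Rightarrow> 'c \<Rightarrow>\<^sub>0 int" where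
  "decode = inv_into B code"

definition A :: "('g list \<Rightarrow> int) monoid" where
  "A = \<lparr>carrier = code ` B, mult = (\<lambda>f f' t. f t + f' t), one = (\<lambda>_. 0)\<rparr>"

definition act_A :: "'g \<Rightarrow> ('g list \<Rightarrow> int) \<Rightarrow> 'g list \<Rightarrow> int" where
  "act_A g f = code (frag_map (act g) (decode f))"

lemma frag_map_act_mult:
  "g \<in> carrier G \<Longrightarrow> h \<in> carrier G \<Longrightarrow> c \<in> B \<Longrightarrow>
    frag_map (act (g \<otimes> h)) c = frag_map (act g) (frag_map (act h) c)"
  unfolding frag_map_frag_map using B_keys Q(2) by (intro frag_map_cong[of c Q]) auto

lemma B_uminus: "a \<in> B \<Longrightarrow> - a \<in> B"
  using B_diff[OF B_zero, of a] by simp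

lemma B_add: "a \<in> B \<Longrightarrow> b \<in> B \<Longrightarrow> a + b \<in> B"
  using B_diff[OF _ B_uminus, of a b] by simp

lemma B_sum: "(\<And>i. i \<in> I \<Longrightarrow> v i \<in> B) \<Longrightarrow> sum v I \<in> B"
  by (induction I rule: infinite_finite_induct) (auto simp: B_zero B_add)

lemma frag_cmul_sign: "frag_cmul ((- 1) ^ j) c = (if even j then c else - c)"
  by (auto simp: uminus_power_if)

lemma B_sign: "a \<in> B \<Longrightarrow> frag_cmul ((- 1) ^ j) a \<in> B"
  by (simp add: frag_cmul_sign B_uminus)

lemma inj_code: "inj_on code B"
proof (rule inj_onI)
  fix a b assume ab: "a \<in> B" "b \<in> B" "code a = code b"
  show "a = b"
  proof (rule poly_mapping_eqI)
    fix x
    show "lookup a x = lookup b x"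
    proof (cases "x \<in> Q")
      case True
      then obtain t where "x = D t" using D by auto
      then show ?thesis using ab(3) by (metis code_def)
    next
      case False
      then show ?thesis using B_keys ab by (metis in_keys_iff subsetD)
    qed
  qed
qed

lemma decode_code [simp]: "a \<in> B \<Longrightarrow> decode (code a) = a"
  by (simp add: decode_def inj_code)

lemma A_simps: "carrier A = code ` B" "code a \<otimes>\<^bsub>A\<^esub> code b = code (a + b)" "\<one>\<^bsub>A\<^esub> = code 0"
  by (simp_all add: A_def code_def lookup_add)

lemma comm_group_A: "comm_group A"
proof (rule comm_groupI)
  show "\<exists>y\<in>carrier A. y \<otimes>\<^bsub>A\<^esub> x = \<one>\<^bsub>A\<^esub>" if x: "x \<in> carrier A" for x
  proof -
    obtain a where a: "a \<in> B" "x = code a" using x by (auto simp: A_simps(1))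
    show ?thesis by (rule bexI[of _ "code (- a)"]) (use a B_uminus in \<open>simp_all add: A_simps\<close>)
  qed
  show "x \<otimes>\<^bsub>A\<^esub> y \<in> carrier A" if "x \<in> carrier A" "y \<in> carrier A" for x y
    using that by (auto simp: A_simps B_add)
  show "\<one>\<^bsub>A\<^esub> \<in> carrier A" by (simp add: A_simps B_zero)
qed (auto simp: A_def)

sublocale A: comm_group A
  by (rule comm_group_A)

lemma act_A_code: "a \<in> B \<Longrightarrow> act_A g (code a) = code (frag_map (act g) a)"
  by (simp add: act_A_def)

lemma module_A: "group_module G A act_A"
  unfolding group_module_def
proof (intro conjI ballI)
  show "comm_group A" by (rule comm_group_A)
  show "act_A g \<in> hom A A" if "g \<in> carrier G" for g
    using that by (auto simp: hom_def A_simps act_A_code B_act B_add frag_map_add)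
  show "act_A \<one> a = a" if "a \<in> carrier A" for a
    using that Q(3) frag_map_ident[OF B_keys] by (auto simp: A_simps act_A_code)
  show "act_A (g \<otimes> h) a = act_A g (act_A h a)" if gh: "g \<in> carrier G" "h \<in> carrier G" and a: "a \<in> carrier A" for g h a
  proof -
    obtain x where x: "x \<in> B" "a = code x" using a by (auto simp: A_simps(1))
    then show ?thesis using frag_map_act_mult[OF gh x(1)] gh by (simp add: act_A_code B_act)
  qed
qed

lemma finprod_code: "(\<And>i. i \<in> I \<Longrightarrow> v i \<in> B) \<Longrightarrow> finite I \<Longrightarrow> finprod A (\<lambda>i. code (v i)) I = code (sum v I)"
  by (rotate_tac, induction I rule: finite_induct) (auto simp: A_simps B_sum Pi_def)

lemma pow_code: "a \<in> B \<Longrightarrow> code a [^]\<^bsub>A\<^esub> ((- 1 :: int) ^ j) = code (frag_cmul ((- 1) ^ j) a)"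
proof -
  assume a: "a \<in> B"
  have "inv\<^bsub>A\<^esub> (code a) = code (- a)"
    by (rule A.inv_equality) (use a B_uminus in \<open>simp_all add: A_simps\<close>)
  then show ?thesis
    using a by (cases "even j") (simp_all add: frag_cmul_sign A.int_pow_neg A_simps)
qed

text \<open>The equivariant function on homogeneous tuples that corresponds to an inhomogeneous
  cochain \<open>u\<close>: the first entry is split off and acts on the value.\<close>

definition homogenize :: "('g list \<Rightarrow> 'c \<Rightarrow>\<^sub>0 int) \<Rightarrow> 'g list \<Rightarrow> 'c \<Rightarrow>\<^sub>0 int" where
  "homogenize u ys = frag_map (act (hd ys)) (u (quotients G ys))"

lemma homogenize_partial_products:
  "h \<in> carrier G \<Longrightarrow> gs \<in> tuples G m \<Longrightarrow> homogenize u (partial_products G h gs) = frag_map (act h) (u gs)"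
  by (simp add: homogenize_def quotients_partial_products)

text \<open>On a tuple that starts with \<open>\<one>\<close> the homogeneous boundary reproduces
  \<open>codiff\<close> term by term. Omitting the first entry leaves a tuple that starts with
  \<open>g\<close> and gives the action term, inner omissions multiply neighbours, and the last
  omission gives \<open>butlast\<close>.\<close>

lemma codiff_code:
  assumes u: "\<And>xs. xs \<in> tuples G m \<Longrightarrow> u xs \<in> B" and gs: "gs \<in> tuples G (Suc m)"
  shows "codiff G A act_A m (\<lambda>xs\<in>tuples G m. code (u xs)) gs =
    code (frag_extend (homogenize u) (bar_d (partial_products G \<one> gs)))"
proof -
  obtain g r where g: "gs = g # r" "g \<in> carrier G" "r \<in> tuples G m" "length r = m"
    using gs by (cases gs) (auto simp: tuples_def)
  have bl: "butlast gs \<in> tuples G m" using gs by (auto simp: tuples_def dest: in_set_butlastD)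
  have u1: "frag_map (act \<one>) (u xs) = u xs" if "xs \<in> tuples G m" for xs
    using frag_map_ident[OF B_keys[OF u[OF that]]] Q(3) by simp
  let ?h = "\<lambda>i. homogenize u (omit_nth i (partial_products G \<one> gs))"
  have first: "?h 0 = frag_map (act g) (u r)"
    using g homogenize_partial_products[OF g(2,3)] by simp
  have mid: "?h (Suc j) = u (mult_adjacent G j gs)" if "j < m" for j
    using omit_nth_partial_products[OF one_closed gs, of j] that g
      homogenize_partial_products[OF one_closed mult_adjacent_tuples[OF gs that]]
      u1[OF mult_adjacent_tuples[OF gs that]] by simp
  have last: "?h (Suc m) = u (butlast gs)"
    using omit_last_partial_products[of gs \<one>] g homogenize_partial_products[OF one_closed bl] u1[OF bl] by simp
  have "frag_extend (homogenize u) (bar_d (partial_products G \<one> gs)) =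
      (\<Sum>i<Suc (Suc m). frag_cmul ((- 1) ^ i) (?h i))"
    unfolding bar_d_sum using g by (simp add: frag_extend_sum frag_extend_cmul o_def frag_extend_add)
  also have "\<dots> = ?h 0 + (\<Sum>j<m. frag_cmul ((- 1) ^ Suc j) (?h (Suc j))) + frag_cmul ((- 1) ^ Suc m) (?h (Suc m))"
    by (subst sum.lessThan_Suc, subst sum.lessThan_Suc_shift) simp
  also have "\<dots> = frag_map (act g) (u r) + (\<Sum>j<m. frag_cmul ((- 1) ^ Suc j) (u (mult_adjacent G j gs)))
      + frag_cmul ((- 1) ^ Suc m) (u (butlast gs))"
    unfolding first last by (simp add: mid)
  finally have *: "frag_extend (homogenize u) (bar_d (partial_products G \<one> gs)) = \<dots>" .
  define f where "f = (\<lambda>xs\<in>tuples G m. code (u xs))"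
  have f: "f xs = code (u xs)" if "xs \<in> tuples G m" for xs using that by (simp add: f_def)
  have "finprod A (\<lambda>i. f (mult_adjacent G i gs) [^]\<^bsub>A\<^esub> ((- 1 :: int) ^ Suc i)) {..<m}
     = finprod A (\<lambda>i. code (frag_cmul ((- 1) ^ Suc i) (u (mult_adjacent G i gs)))) {..<m}"
  proof (rule A.finprod_cong')
    fix i assume "i \<in> {..<m}"
    then have i: "mult_adjacent G i gs \<in> tuples G m" using mult_adjacent_tuples[OF gs] by simp
    show "f (mult_adjacent G i gs) [^]\<^bsub>A\<^esub> ((- 1 :: int) ^ Suc i) =
        code (frag_cmul ((- 1) ^ Suc i) (u (mult_adjacent G i gs)))"
      unfolding f[OF i] by (rule pow_code[OF u[OF i]])
  next
    show "(\<lambda>i. code (frag_cmul ((- 1) ^ Suc i) (u (mult_adjacent G i gs)))) \<in> {..<m} \<rightarrow> carrier A"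
      using B_sign[OF u[OF mult_adjacent_tuples[OF gs]]] unfolding A_simps(1) by blast
  qed simp
  also have "\<dots> = code (\<Sum>i<m. frag_cmul ((- 1) ^ Suc i) (u (mult_adjacent G i gs)))"
    by (rule finprod_code[OF B_sign[OF u[OF mult_adjacent_tuples[OF gs]]]]) simp_all
  finally have mid': "finprod A (\<lambda>i. f (mult_adjacent G i gs) [^]\<^bsub>A\<^esub> ((- 1 :: int) ^ Suc i)) {..<m} = \<dots>" .
  have "codiff G A act_A m f gs = act_A g (f r) \<otimes>\<^bsub>A\<^esub>
      finprod A (\<lambda>i. f (mult_adjacent G i gs) [^]\<^bsub>A\<^esub> ((- 1 :: int) ^ Suc i)) {..<m} \<otimes>\<^bsub>A\<^esub>
      f (butlast gs) [^]\<^bsub>A\<^esub> ((- 1 :: int) ^ Suc m)"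
    using gs unfolding codiff_def by (simp only: restrict_apply' g(1) list.sel)
  also have "\<dots> = code (frag_extend (homogenize u) (bar_d (partial_products G \<one> gs)))"
    unfolding mid' f[OF bl] f[OF g(3)] pow_code[OF u[OF bl]] act_A_code[OF u[OF g(3)]] A_simps(2) * ..
  finally show ?thesis by (simp add: f_def)
qed

lemma cochain_codeE:
  assumes "b \<in> cochains G A m"
  obtains u where "\<And>xs. xs \<in> tuples G m \<Longrightarrow> u xs \<in> B" "b = (\<lambda>xs\<in>tuples G m. code (u xs))"
proof
  have *: "b xs \<in> code ` B" if "xs \<in> tuples G m" for xs
    using assms that by (auto simp: cochains_def A_simps)
  show "decode (b xs) \<in> B" if "xs \<in> tuples G m" for xs using *[OF that] by auto
  show "b = (\<lambda>xs\<in>tuples G m. code (decode (b xs)))"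
  proof
    fix xs show "b xs = (\<lambda>xs\<in>tuples G m. code (decode (b xs))) xs"
    proof (cases "xs \<in> tuples G m")
      case True
      then show ?thesis using *[OF True] by auto
    next
      case False
      then show ?thesis using assms by (auto simp: cochains_def PiE_def extensional_def)
    qed
  qed
qed

text \<open>The form in which the cohomological hypothesis is used. The cocycle \<open>c\<close> is
  restricted to tuples that start with \<open>\<one>\<close>, where it is a coboundary, and the
  cochain obtained is made equivariant again. Homogeneous lists are one longer than the degree,
  hence \<open>Suc (Suc m)\<close> for degree \<open>Suc m\<close>.\<close>

lemma cocycle_lift:
  assumes H: "cocycles G A act_A (Suc m) = coboundaries G A act_A (Suc m)"
    and c: "equivariant_on G (bar_act G) act (tuples G (Suc (Suc m))) c"
      "\<And>xs. xs \<in> tuples G (Suc (Suc m)) \<Longrightarrow> c xs \<in> B"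
    and dc: "\<And>ys. ys \<in> tuples G (Suc (Suc (Suc m))) \<Longrightarrow> frag_extend c (bar_d ys) = 0"
  obtains b where "equivariant_on G (bar_act G) act (tuples G (Suc m)) b"
    "\<And>xs. xs \<in> tuples G (Suc m) \<Longrightarrow> b xs \<in> B"
    "\<And>xs. xs \<in> tuples G (Suc (Suc m)) \<Longrightarrow> frag_extend b (bar_d xs) = c xs"
proof -
  let ?u = "\<lambda>gs. c (partial_products G \<one> gs)"
  have u: "?u gs \<in> B" if "gs \<in> tuples G (Suc m)" for gs
    using c(2) partial_products_tuples[OF one_closed that] by simp
  have hom_u: "homogenize ?u xs = c xs" if xs: "xs \<in> tuples G (Suc (Suc m))" for xs
  proof -
    have hx: "hd xs \<in> carrier G" using xs by (cases xs) (auto simp: tuples_def)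
    have "homogenize ?u xs = c (bar_act G (hd xs) (partial_products G \<one> (quotients G xs)))"
      using equivariant_onD[OF c(1) hx partial_products_tuples[OF one_closed quotients_tuples[OF xs]]]
      by (simp add: homogenize_def)
    then show ?thesis
      using map_partial_products[OF hx one_closed quotients_tuples[OF xs]] partial_products_quotients[OF xs] hx
      by simp
  qed
  define f where "f = (\<lambda>xs\<in>tuples G (Suc m). code (?u xs))"
  have "f \<in> cocycles G A act_A (Suc m)"
  proof -
    have "f \<in> cochains G A (Suc m)" using u by (auto simp: f_def cochains_def A_simps)
    moreover have "codiff G A act_A (Suc m) f = (\<lambda>_\<in>tuples G (Suc (Suc m)). \<one>\<^bsub>A\<^esub>)"
    proof
      fix gs
      show "codiff G A act_A (Suc m) f gs = (\<lambda>_\<in>tuples G (Suc (Suc m)). \<one>\<^bsub>A\<^esub>) gs"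
      proof (cases "gs \<in> tuples G (Suc (Suc m))")
        case True
        let ?p = "partial_products G \<one> gs"
        have p: "?p \<in> tuples G (Suc (Suc (Suc m)))" using partial_products_tuples[OF one_closed True] .
        have "codiff G A act_A (Suc m) f gs = code (frag_extend (homogenize ?u) (bar_d ?p))"
          unfolding f_def by (rule codiff_code[OF u True])
        also have "frag_extend (homogenize ?u) (bar_d ?p) = frag_extend c (bar_d ?p)"
          by (rule frag_extend_cong_keys[OF bar_d_keys[OF p]]) (rule hom_u)
        finally show ?thesis using dc[OF p] True by (simp add: A_simps)
      qed (simp add: codiff_def)
    qed
    ultimately show ?thesis by (simp add: cocycles_def)
  qed
  then have "f \<in> codiff G A act_A m ` cochains G A m" using H by (simp add: coboundaries_def)
  then obtain b where b: "b \<in> cochains G A m" "f = codiff G A act_A m b" by blast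
  obtain v where v: "\<And>xs. xs \<in> tuples G m \<Longrightarrow> v xs \<in> B" "b = (\<lambda>xs\<in>tuples G m. code (v xs))"
    using cochain_codeE[OF b(1)] by metis
  have hdc: "hd xs \<in> carrier G" if "xs \<in> tuples G (Suc k)" for xs k
    using that by (cases xs) (auto simp: tuples_def)
  have equiv: "equivariant_on G (bar_act G) act (tuples G (Suc m)) (homogenize v)"
    unfolding equivariant_on_def
  proof (intro ballI)
    fix g xs assume g: "g \<in> carrier G" and xs: "xs \<in> tuples G (Suc m)"
    have "hd (bar_act G g xs) = g \<otimes> hd xs" using xs by (cases xs) (auto simp: tuples_def bar_act_def)
    then show "homogenize v (bar_act G g xs) = frag_map (act g) (homogenize v xs)"
      using quotients_act[OF g xs] frag_map_act_mult[OF g hdc[OF xs] v(1)[OF quotients_tuples[OF xs]]]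
      by (simp add: homogenize_def)
  qed
  have vB: "homogenize v xs \<in> B" if "xs \<in> tuples G (Suc m)" for xs
    unfolding homogenize_def by (rule B_act[OF hdc[OF that] v(1)[OF quotients_tuples[OF that]]])
  have "frag_extend (homogenize v) (bar_d xs) = c xs" if xs: "xs \<in> tuples G (Suc (Suc m))" for xs
  proof -
    let ?q = "quotients G xs" and ?p = "partial_products G \<one> (quotients G xs)"
    have q: "?q \<in> tuples G (Suc m)" using quotients_tuples[OF xs] .
    have p: "?p \<in> tuples G (Suc (Suc m))" using partial_products_tuples[OF one_closed q] .
    \<comment> \<open>\<open>code\<close> is injective on \<open>B\<close> only, so this membership
      is what turns equality of codes into equality of chains.\<close>
    have dB: "frag_extend (homogenize v) (bar_d ?p) \<in> B"
      unfolding frag_extend_def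
    proof (rule B_sum)
      fix i assume "i \<in> keys (bar_d ?p)"
      then have i: "homogenize v i \<in> B" using bar_d_keys[OF p] vB by blast
      show "frag_cmul (lookup (bar_d ?p) i) (homogenize v i) \<in> B"
        by (rule frag_closure_minus_cmul) (use i B_zero B_diff in auto)
    qed
    have "code (?u ?q) = code (frag_extend (homogenize v) (bar_d ?p))"
      using fun_cong[OF b(2), of ?q] codiff_code[OF v(1) q] q unfolding v(2) f_def by simp
    then have eq: "c ?p = frag_extend (homogenize v) (bar_d ?p)"
      using inj_onD[OF inj_code _ u[OF q] dB] by simp
    \<comment> \<open>Equality is known on tuples that start with \<open>\<one>\<close>; every tuple
      is a translate of one of these, and both sides are equivariant.\<close>
    have xs_eq: "xs = bar_act G (hd xs) ?p"
      using map_partial_products[OF hdc[OF xs] one_closed q] partial_products_quotients[OF xs] hdc[OF xs] by simp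
    have "c xs = frag_map (act (hd xs)) (c ?p)"
      using equivariant_onD[OF c(1) hdc[OF xs] p] xs_eq by simp
    also have "\<dots> = frag_extend (homogenize v) (frag_map (bar_act G (hd xs)) (bar_d ?p))"
      unfolding eq using equivariant_on_extend[OF equiv hdc[OF xs] bar_d_keys[OF p]] by simp
    also have "frag_map (bar_act G (hd xs)) (bar_d ?p) = bar_d xs"
      unfolding bar_act_def bar_d_map[symmetric] by (rule arg_cong[OF xs_eq[unfolded bar_act_def], symmetric])
    finally show ?thesis by simp
  qed
  with equiv vB show ?thesis by (rule that)
qed

end

section \<open>Splitting and bounded fillings\<close>

lemma complex_pairI:
  "augmented_complex G actP P dP zP \<Longrightarrow> augmented_complex G actQ Q dQ zQ \<Longrightarrow>
    complex_pair G actP P dP zP actQ Q dQ zQ"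
  by (simp add: complex_pair_def)

lemma (in complex_pair) chain_map_mono: "chain_map N f \<Longrightarrow> M \<le> N \<Longrightarrow> chain_map M f"
  unfolding chain_map_def by (meson order_trans)

lemma chain_map_compose:
  assumes "complex_pair G actP P dP zP actQ Q dQ zQ" "complex_pair G actQ Q dQ zQ actR R dR zR"
    and f: "complex_pair.chain_map G actP P dP zP actQ Q dQ zQ N f"
    and g: "complex_pair.chain_map G actQ Q dQ zQ actR R dR zR N g"
  shows "complex_pair.chain_map G actP P dP zP actR R dR zR N (\<lambda>b. frag_extend g (f b))"
proof -
  interpret PQ: complex_pair G actP P dP zP actQ Q dQ zQ by fact
  interpret QR: complex_pair G actQ Q dQ zQ actR R dR zR by fact
  interpret PR: complex_pair G actP P dP zP actR R dR zR
    by (rule complex_pairI) unfold_locales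
  show ?thesis
    unfolding PR.chain_map_def
  proof (intro conjI allI impI ballI)
    show "frag_extend g (f zP) = frag_of zR"
      using f g by (simp add: PQ.chain_map_def QR.chain_map_def)
    fix k assume k: "k \<le> N"
    note fk = PQ.chain_mapD[OF f k] and gk = QR.chain_map_extend[OF g k]
    show "equivariant_on G actP actR (P k) (\<lambda>b. frag_extend g (f b))"
      unfolding equivariant_on_def
      using equivariant_onD[OF fk(1)] equivariant_on_extend[OF QR.chain_mapD(1)[OF g k]] fk(2) by simp
    fix b assume b: "b \<in> P k"
    show "keys (frag_extend g (f b)) \<subseteq> R k" using gk(1)[OF fk(2)[OF b]] .
    show "frag_extend dR (frag_extend g (f b)) = frag_extend (\<lambda>b. frag_extend g (f b)) (dP b)"
      using gk(2)[OF fk(2)[OF b]] fk(3)[OF b] by (simp add: frag_extend_frag_extend)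
  qed
qed

lemma (in augmented_complex) chain_map_id: "complex_pair.chain_map G act P d z act P d z N frag_of"
proof -
  interpret complex_pair G act P d z act P d z by (rule complex_pairI) unfold_locales
  show ?thesis by (simp add: chain_map_def equivariant_on_def frag_extend_frag_of)
qed

lemma cohomology_vanishes:
  fixes A :: "('g list \<Rightarrow> int) monoid"
  assumes "cohomological_dim (G :: ('g, 'x) monoid_scheme) = enat m" "m < k" "group_module G A act"
  shows "cocycles G A act k = coboundaries G A act k"
proof (rule ccontr)
  assume "cocycles G A act k \<noteq> coboundaries G A act k"
  then have "enat k \<le> cohomological_dim G"
    unfolding cohomological_dim_def using assms(3) by (intro SUP_upper) blast
  then show False using assms(1,2) by simp
qed

context augmented_complex
begin

lemma d_equivariant: "equivariant_on G act act (P k) d"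
  using d_act by (simp add: equivariant_on_def)

text \<open>Dimension shifting: the vanishing cohomology class of the \<open>(N + 1)\<close>-cocycle that a chain map
  from the bar resolution defines with values in the cycles splits \<open>d\<close> off the top chain group.\<close>

lemma equivariant_projection:
  fixes D :: "'g list \<Rightarrow> 'b"
  assumes ex: "exact_upto N P d" and D: "P (Suc N) \<subseteq> range D"
    and H: "\<And>(A :: ('g list \<Rightarrow> int) monoid) act'. group_module G A act' \<Longrightarrow>
      cocycles G A act' (Suc N) = coboundaries G A act' (Suc N)"
  obtains \<pi> where "equivariant_on G act act (P (Suc N)) \<pi>"
    "\<And>b. b \<in> P (Suc N) \<Longrightarrow> keys (\<pi> b) \<subseteq> P (Suc N)"
    "\<And>b. b \<in> P (Suc N) \<Longrightarrow> frag_extend d (\<pi> b) = d b"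
    "\<And>c. keys c \<subseteq> P (Suc N) \<Longrightarrow> frag_extend d c = 0 \<Longrightarrow> frag_extend \<pi> c = 0"
proof -
  interpret bar: augmented_complex G "bar_act G" "tuples G" bar_d "[]" by (rule bar_complex)
  interpret BX: complex_pair G "bar_act G" "tuples G" bar_d "[]" act P d z by (rule complex_pairI) unfold_locales
  interpret XB: complex_pair G act P d z "bar_act G" "tuples G" bar_d "[]" by (rule complex_pairI) unfold_locales
  interpret XX: complex_pair G act P d z act P d z by (rule complex_pairI) unfold_locales
  obtain \<phi> where \<phi>: "BX.chain_map (Suc N) \<phi>" using BX.chain_map_exists[OF ex] by blast
  obtain \<psi> where \<psi>: "XB.chain_map (Suc N) \<psi>" using XB.chain_map_exists[OF bar_exact[of N]] by blast
  have "XX.chain_map (Suc N) (\<lambda>b. frag_extend \<phi> (\<psi> b))"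
    by (rule chain_map_compose[OF _ _ \<psi> \<phi>]) unfold_locales
  then have "XX.chain_map N (\<lambda>b. frag_extend \<phi> (\<psi> b))" by (rule XX.chain_map_mono) simp
  then obtain h where h: "XX.homotopy N (\<lambda>b. frag_extend \<phi> (\<psi> b)) frag_of h"
    using XX.homotopy_exists[OF ex _ chain_map_id] by blast
  define B where "B = {c. keys c \<subseteq> P (Suc N) \<and> frag_extend d c = 0}"
  interpret M: coefficient_module G act "P (Suc N)" B D
  proof unfold_locales
    show "act (g \<otimes> h) b = act g (act h b)" if "g \<in> carrier G" "h \<in> carrier G" "b \<in> P (Suc N)" for g h b
      using act_mult that .
    show "P (Suc N) \<subseteq> range D" by (rule D)
    show "a - b \<in> B" if "a \<in> B" "b \<in> B" for a b
      using that keys_diff_subset[of a "P (Suc N)" b] by (simp add: B_def frag_extend_diff)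
    show "frag_map (act g) c \<in> B" if "g \<in> carrier G" "c \<in> B" for g c
      using that frag_map_subset[of c "P (Suc N)" "act g" "P (Suc N)"] act_closed
        equivariant_on_extend[OF d_equivariant[of "Suc N"] that(1)] by (simp add: B_def)
  qed (auto simp: B_def act_closed act_one)
  \<comment> \<open>This is the coboundary of \<open>\<phi>\<close>, but \<open>\<phi>\<close> has
    values in all chains while \<open>c\<close> has values in the cycles \<open>B\<close>. With
    coefficients in \<open>B\<close> its class is therefore not trivially zero.\<close>
  define c where "c xs = frag_extend \<phi> (bar_d xs)" for xs
  have c_eq: "equivariant_on G (bar_act G) act (tuples G (Suc (Suc N))) c"
    unfolding equivariant_on_def c_def
    using bar.d_act bar.d_keys equivariant_on_extend[OF BX.chain_mapD(1)[OF \<phi> order_refl]] by simp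
  have cB: "c xs \<in> B" if "xs \<in> tuples G (Suc (Suc N))" for xs
    using BX.chain_map_extend[OF \<phi> order_refl bar.d_keys[OF that]] bar.d_d[OF that] by (simp add: B_def c_def)
  have dc: "frag_extend c (bar_d ys) = 0" for ys
    using bar_d_d[of ys] frag_extend_frag_extend[of \<phi> bar_d "bar_d ys"] unfolding c_def by simp
  obtain b where b: "equivariant_on G (bar_act G) act (tuples G (Suc N)) b"
    "\<And>xs. xs \<in> tuples G (Suc N) \<Longrightarrow> b xs \<in> B"
    "\<And>xs. xs \<in> tuples G (Suc (Suc N)) \<Longrightarrow> frag_extend b (bar_d xs) = c xs"
    using M.cocycle_lift[OF H[OF M.module_A] c_eq cB dc] by metis
  \<comment> \<open>The correction \<open>b\<close> takes values in cycles, so the boundary of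
    \<open>\<phi>\<close> is unchanged, while \<open>\<phi>'\<close> now vanishes on boundaries of
    the bar resolution.\<close>
  define \<phi>' where "\<phi>' xs = \<phi> xs - b xs" for xs
  have \<phi>'_eq: "equivariant_on G (bar_act G) act (tuples G (Suc N)) \<phi>'"
    using equivariant_onD[OF b(1)] equivariant_onD[OF BX.chain_mapD(1)[OF \<phi> order_refl]]
    by (simp add: equivariant_on_def \<phi>'_def frag_map_diff)
  have \<phi>'_keys: "keys (\<phi>' xs) \<subseteq> P (Suc N)" if "xs \<in> tuples G (Suc N)" for xs
    unfolding \<phi>'_def by (rule keys_diff_subset) (use b(2) BX.chain_mapD(2)[OF \<phi> order_refl] that in \<open>auto simp: B_def\<close>)
  have \<phi>'_d: "frag_extend d (\<phi>' xs) = frag_extend \<phi> (bar_d xs)" if "xs \<in> tuples G (Suc N)" for xs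
    using b(2)[OF that] BX.chain_mapD(3)[OF \<phi> order_refl that] by (simp add: \<phi>'_def frag_extend_diff B_def)
  have \<phi>'_boundary: "frag_extend \<phi>' (bar_d xs) = 0" if "xs \<in> tuples G (Suc (Suc N))" for xs
    using b(3)[OF that] unfolding \<phi>'_def frag_extend_diff_fun by (simp add: c_def)
  \<comment> \<open>After applying \<open>d\<close>, the first term gives \<open>\<phi>\<close>
    composed with \<open>\<psi>\<close> on \<open>d x\<close>; the homotopy term replaces this by
    \<open>d x\<close> itself. Both terms respect the group, and the second one vanishes on
    cycles.\<close>
  define \<pi> where "\<pi> x = frag_extend \<phi>' (\<psi> x) - frag_extend h (d x)" for x
  note \<psi>D = XB.chain_mapD[OF \<psi> order_refl] and hD = XX.homotopyD[OF h order_refl]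
  show ?thesis
  proof (rule that)
    show "equivariant_on G act act (P (Suc N)) \<pi>"
      unfolding equivariant_on_def \<pi>_def
      using equivariant_onD[OF \<psi>D(1)] equivariant_on_extend[OF \<phi>'_eq] \<psi>D(2) d_act d_keys
        equivariant_on_extend[OF hD(1)] by (simp add: frag_map_diff)
    show "keys (\<pi> x) \<subseteq> P (Suc N)" if "x \<in> P (Suc N)" for x
      unfolding \<pi>_def
    proof (rule keys_diff_subset)
      show "keys (frag_extend \<phi>' (\<psi> x)) \<subseteq> P (Suc N)"
        by (rule frag_extend_subset[OF \<psi>D(2)[OF that] \<phi>'_keys])
      show "keys (frag_extend h (d x)) \<subseteq> P (Suc N)"
        by (rule XX.homotopy_extend(1)[OF h order_refl d_keys[OF that]])
    qed
    show "frag_extend d (\<pi> x) = d x" if "x \<in> P (Suc N)" for x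
    proof -
      have "frag_extend d (frag_extend \<phi>' (\<psi> x)) = frag_extend \<phi> (frag_extend bar_d (\<psi> x))"
        unfolding frag_extend_frag_extend by (rule frag_extend_cong_keys[OF \<psi>D(2)[OF that] \<phi>'_d])
      also have "\<dots> = frag_extend (\<lambda>b. frag_extend \<phi> (\<psi> b)) (d x)"
        using \<psi>D(3)[OF that] by (simp add: frag_extend_frag_extend)
      finally show ?thesis
        using XX.homotopy_extend(2)[OF h order_refl d_keys[OF that]] d_d[OF that]
        by (simp add: \<pi>_def frag_extend_diff frag_extend_frag_of)
    qed
    show "frag_extend \<pi> y = 0" if y: "keys y \<subseteq> P (Suc N)" "frag_extend d y = 0" for y
    proof -
      have "keys (frag_extend \<psi> y) \<subseteq> tuples G (Suc N)" "frag_extend bar_d (frag_extend \<psi> y) = 0"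
        using XB.chain_map_extend[OF \<psi> order_refl y(1)] y(2) by simp_all
      \<comment> \<open>The bar resolution is exact in every index, so the image of a cycle bounds
        there even though \<open>P\<close> is not assumed exact at index
        \<open>Suc N\<close>.\<close>
      then obtain w where w: "keys w \<subseteq> tuples G (Suc (Suc N))" "frag_extend bar_d w = frag_extend \<psi> y"
        using bar_exact[of "Suc N"] unfolding exact_upto_def by blast
      have "frag_extend \<pi> y = frag_extend \<phi>' (frag_extend \<psi> y) - frag_extend h (frag_extend d y)"
        unfolding \<pi>_def frag_extend_diff_fun frag_extend_frag_extend ..
      also have "\<dots> = frag_extend (\<lambda>xs. frag_extend \<phi>' (bar_d xs)) w"
        unfolding w(2)[symmetric] frag_extend_frag_extend[of \<phi>'] y(2) by simp
      also have "\<dots> = 0" by (rule frag_extend_eq_0) (use w(1) \<phi>'_boundary in auto)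
      finally show ?thesis .
    qed
  qed
qed

end

section \<open>The l1-norm, finite sets of orbits and the transfer of fillings\<close>

definition l1 :: "('a \<Rightarrow>\<^sub>0 int) \<Rightarrow> real" where
  "l1 c = (\<Sum>x\<in>keys c. \<bar>real_of_int (lookup c x)\<bar>)"

lemma l1_superset: "finite E \<Longrightarrow> keys c \<subseteq> E \<Longrightarrow> l1 c = (\<Sum>x\<in>E. \<bar>real_of_int (lookup c x)\<bar>)"
  unfolding l1_def by (rule sum.mono_neutral_left) (auto simp: in_keys_iff)

lemma l1_nonneg: "0 \<le> l1 c"
  by (simp add: l1_def sum_nonneg)

lemma l1_zero [simp]: "l1 0 = 0"
  by (simp add: l1_def)

lemma l1_add: "l1 (a + b) \<le> l1 a + l1 b"
proof -
  let ?E = "keys a \<union> keys b"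
  have "l1 (a + b) = (\<Sum>x\<in>?E. \<bar>real_of_int (lookup (a + b) x)\<bar>)"
    using keys_add[of a b] by (intro l1_superset) auto
  also have "\<dots> \<le> (\<Sum>x\<in>?E. \<bar>real_of_int (lookup a x)\<bar> + \<bar>real_of_int (lookup b x)\<bar>)"
    by (intro sum_mono) (simp add: lookup_add)
  also have "\<dots> = l1 a + l1 b"
    by (simp add: sum.distrib l1_superset[of ?E a] l1_superset[of ?E b])
  finally show ?thesis .
qed

lemma l1_uminus [simp]: "l1 (- a) = l1 a"
  by (simp add: l1_def)

lemma l1_diff: "l1 (a - b) \<le> l1 a + l1 b"
  using l1_add[of a "- b"] by simp

lemma l1_sum: "l1 (sum f I) \<le> (\<Sum>i\<in>I. l1 (f i))"
proof (induction I rule: infinite_finite_induct)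
  case (insert x F)
  then show ?case using l1_add[of "f x" "sum f F"] by simp
qed auto

lemma l1_cmul: "l1 (frag_cmul k c) = \<bar>real_of_int k\<bar> * l1 c"
  by (subst l1_superset[of "keys c"]) (auto simp: keys_cmul l1_def sum_distrib_left abs_mult)

lemma l1_extend:
  assumes "keys c \<subseteq> E" "\<And>x. x \<in> E \<Longrightarrow> l1 (f x) \<le> C"
  shows "l1 (frag_extend f c) \<le> C * l1 c"
proof -
  have "l1 (frag_extend f c) \<le> (\<Sum>x\<in>keys c. \<bar>real_of_int (lookup c x)\<bar> * l1 (f x))"
    unfolding frag_extend_def using l1_sum by (simp flip: l1_cmul)
  also have "\<dots> \<le> (\<Sum>x\<in>keys c. \<bar>real_of_int (lookup c x)\<bar> * C)"
    using assms by (intro sum_mono mult_left_mono) auto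
  finally show ?thesis by (simp add: l1_def sum_distrib_left mult.commute)
qed

lemma l1_map: "l1 (frag_map f c) \<le> l1 c"
  using l1_extend[of c UNIV "\<lambda>x. frag_of (f x)" 1] by (simp add: frag_map_def l1_def)

definition finite_orbits :: "('g, 'x) monoid_scheme \<Rightarrow> ('g \<Rightarrow> 'b \<Rightarrow> 'b) \<Rightarrow> 'b set \<Rightarrow> bool" where
  "finite_orbits G act E \<longleftrightarrow>
     (\<exists>R. finite R \<and> R \<subseteq> E \<and> (\<forall>b\<in>E. \<exists>g\<in>carrier G. \<exists>r\<in>R. b = act g r))"

text \<open>The norm does not grow under the action on chains, so on each orbit \<open>f\<close> is
  bounded by its norm at a representative.\<close>

lemma equivariant_bounded:
  assumes "finite_orbits G act E" "equivariant_on G act act' E f"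
  obtains C where "C \<ge> 0" "\<And>b. b \<in> E \<Longrightarrow> l1 (f b) \<le> C"
proof -
  obtain R where R: "finite R" "R \<subseteq> E" "\<And>b. b \<in> E \<Longrightarrow> \<exists>g\<in>carrier G. \<exists>r\<in>R. b = act g r"
    using assms(1) by (auto simp: finite_orbits_def)
  have bound: "l1 (f b) \<le> (\<Sum>r\<in>R. l1 (f r))" if b: "b \<in> E" for b
  proof -
    obtain g r where r: "g \<in> carrier G" "r \<in> R" "b = act g r" using R(3)[OF b] by blast
    then have "l1 (f b) \<le> l1 (f r)"
      using l1_map equivariant_onD[OF assms(2) r(1)] R(2) by (metis subsetD)
    also have "\<dots> \<le> (\<Sum>r\<in>R. l1 (f r))" using r R(1) by (intro member_le_sum) (auto simp: l1_nonneg)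
    finally show ?thesis .
  qed
  show ?thesis by (rule that[OF sum_nonneg bound]) (rule l1_nonneg)
qed

lemma augmented_complex_subgroup:
  assumes "augmented_complex G act P d z" "subgroup H G"
  shows "augmented_complex (G\<lparr>carrier := H\<rparr>) act P d z"
proof -
  interpret augmented_complex G act P d z by fact
  interpret H: group "G\<lparr>carrier := H\<rparr>" using subgroup.subgroup_is_group[OF assms(2)] group_axioms by blast
  have H: "h \<in> carrier G" if "h \<in> H" for h using subgroup.mem_carrier[OF assms(2) that] .
  show ?thesis
    by unfold_locales
      (use H P0 act_closed act_mult act_one act_free degree_unique d_zero d_keys d_d d_act in auto)
qed

text \<open>Here \<open>x\<close> is the image of \<open>y\<close> under an equivariant chain map
  and \<open>S\<close> is an arbitrary filling of it. All bounds are linear, so the exponent of the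
  isoperimetric inequality enters only when \<open>S\<close> is chosen.\<close>

lemma filling_transfer:
  assumes X: "augmented_complex G actX P d zX" and exX: "exact_upto N P d"
    and \<pi>: "equivariant_on G actX actX (P (Suc N)) \<pi>"
      "\<And>b. b \<in> P (Suc N) \<Longrightarrow> keys (\<pi> b) \<subseteq> P (Suc N)"
      "\<And>b. b \<in> P (Suc N) \<Longrightarrow> frag_extend d (\<pi> b) = d b"
      "\<And>c. keys c \<subseteq> P (Suc N) \<Longrightarrow> frag_extend d c = 0 \<Longrightarrow> frag_extend \<pi> c = 0"
    and orbX: "finite_orbits G actX (P (Suc N))"
    and H: "subgroup H G"
    and Y: "augmented_complex (G\<lparr>carrier := H\<rparr>) actY Q e zY" and exY: "exact_upto N Q e"
    and orbY: "finite_orbits (G\<lparr>carrier := H\<rparr>) actY (Q N)"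
      "finite_orbits (G\<lparr>carrier := H\<rparr>) actY (Q (Suc N))"
  obtains C where "C \<ge> 0"
    "\<And>y. keys y \<subseteq> Q N \<Longrightarrow> frag_extend e y = 0 \<Longrightarrow>
       \<exists>x. keys x \<subseteq> P N \<and> frag_extend d x = 0 \<and> l1 x \<le> C * l1 y \<and>
         (\<forall>S. keys S \<subseteq> P (Suc N) \<and> frag_extend d S = x \<longrightarrow>
           (\<exists>W. keys W \<subseteq> Q (Suc N) \<and> frag_extend e W = y \<and> l1 W \<le> C * (l1 S + l1 y)))"
proof -
  let ?H = "G\<lparr>carrier := H\<rparr>"
  interpret XG: augmented_complex G actX P d zX by (rule X)
  interpret X: augmented_complex ?H actX P d zX by (rule augmented_complex_subgroup[OF X H])
  interpret Y: augmented_complex ?H actY Q e zY by (rule Y)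
  interpret YX: complex_pair ?H actY Q e zY actX P d zX by (rule complex_pairI) unfold_locales
  interpret XY: complex_pair ?H actX P d zX actY Q e zY by (rule complex_pairI) unfold_locales
  interpret YY: complex_pair ?H actY Q e zY actY Q e zY by (rule complex_pairI) unfold_locales
  have HG: "h \<in> carrier G" if "h \<in> H" for h using subgroup.mem_carrier[OF H that] .
  obtain f where f: "YX.chain_map (Suc N) f" using YX.chain_map_exists[OF exX] by blast
  obtain g where g: "XY.chain_map (Suc N) g" using XY.chain_map_exists[OF exY] by blast
  have "YY.chain_map (Suc N) (\<lambda>b. frag_extend g (f b))"
    by (rule chain_map_compose[OF _ _ f g]) unfold_locales
  then have "YY.chain_map N (\<lambda>b. frag_extend g (f b))" by (rule YY.chain_map_mono) simp
  then obtain h where h: "YY.homotopy N (\<lambda>b. frag_extend g (f b)) frag_of h"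
    using YY.homotopy_exists[OF exY _ Y.chain_map_id] by blast
  have N: "N \<le> Suc N" by simp
  have \<pi>H: "equivariant_on ?H actX actX (P (Suc N)) \<pi>"
    using \<pi>(1) HG by (simp add: equivariant_on_def)
  \<comment> \<open>\<open>P (Suc N)\<close> has finitely many orbits under \<open>G\<close> but
    perhaps not under \<open>H\<close>. The set \<open>F\<close> has finitely many under
    \<open>H\<close>, because \<open>Q (Suc N)\<close> does and each chain
    \<open>frag_extend \<pi> (f \<tau>)\<close> has finite support.\<close>
  define F where "F = (\<Union>\<tau>\<in>Q (Suc N). keys (frag_extend \<pi> (f \<tau>)))"
  have f_keys: "keys (f \<tau>) \<subseteq> P (Suc N)" if "\<tau> \<in> Q (Suc N)" for \<tau>
    using YX.chain_mapD(2)[OF f order_refl that] .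
  have FP: "F \<subseteq> P (Suc N)"
    unfolding F_def by (intro UN_least frag_extend_subset[OF f_keys \<pi>(2)])
  have orbF: "finite_orbits ?H actX F"
  proof -
    obtain R where R: "finite R" "R \<subseteq> Q (Suc N)"
      "\<And>b. b \<in> Q (Suc N) \<Longrightarrow> \<exists>g\<in>carrier ?H. \<exists>r\<in>R. b = actY g r"
      using orbY(2) by (auto simp: finite_orbits_def)
    let ?R = "\<Union>\<tau>\<in>R. keys (frag_extend \<pi> (f \<tau>))"
    have "\<exists>h\<in>carrier ?H. \<exists>r\<in>?R. x = actX h r" if x: "x \<in> F" for x
    proof -
      obtain \<tau> where \<tau>: "\<tau> \<in> Q (Suc N)" "x \<in> keys (frag_extend \<pi> (f \<tau>))" using x by (auto simp: F_def)
      obtain h r where r: "h \<in> carrier ?H" "r \<in> R" "\<tau> = actY h r" using R(3)[OF \<tau>(1)] by blast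
      have rQ: "r \<in> Q (Suc N)" using r R by blast
      have "frag_extend \<pi> (f \<tau>) = frag_map (actX h) (frag_extend \<pi> (f r))"
        using equivariant_onD[OF YX.chain_mapD(1)[OF f order_refl] r(1) rQ]
          equivariant_on_extend[OF \<pi>H r(1) f_keys[OF rQ]] r(3) by simp
      then have "x \<in> actX h ` keys (frag_extend \<pi> (f r))"
        using \<tau>(2) frag_map_subset[of "frag_extend \<pi> (f r)" _ "actX h" "actX h ` keys (frag_extend \<pi> (f r))"]
        by auto
      then show ?thesis using r by blast
    qed
    then show ?thesis
      unfolding finite_orbits_def using R(1,2) by (intro exI[of _ ?R]) (auto simp: F_def)
  qed
  obtain Cf where Cf: "Cf \<ge> 0" "\<And>b. b \<in> Q N \<Longrightarrow> l1 (f b) \<le> Cf"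
    using equivariant_bounded[OF orbY(1) YX.chain_mapD(1)[OF f N]] by blast
  obtain Ch where Ch: "Ch \<ge> 0" "\<And>b. b \<in> Q N \<Longrightarrow> l1 (h b) \<le> Ch"
    using equivariant_bounded[OF orbY(1) YY.homotopyD(1)[OF h order_refl]] by blast
  \<comment> \<open>Here the orbits of \<open>G\<close> suffice, since \<open>\<pi>\<close> is
    equivariant under all of \<open>G\<close>; for \<open>g\<close>, equivariant under
    \<open>H\<close> only, the orbits of \<open>H\<close> in \<open>F\<close> are used next.\<close>
  obtain Cp where Cp: "Cp \<ge> 0" "\<And>b. b \<in> P (Suc N) \<Longrightarrow> l1 (\<pi> b) \<le> Cp"
    using equivariant_bounded[OF orbX \<pi>(1)] by blast
  have "equivariant_on ?H actX actY F g"
    using XY.chain_mapD(1)[OF g order_refl] FP by (auto simp: equivariant_on_def)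
  then obtain Cg where Cg: "Cg \<ge> 0" "\<And>b. b \<in> F \<Longrightarrow> l1 (g b) \<le> Cg"
    using equivariant_bounded[OF orbF] by blast
  \<comment> \<open>\<open>Cf\<close> bounds the image of \<open>y\<close>, \<open>Cg * Cp\<close>
    the part of the new filling that comes from \<open>S\<close>, and \<open>Ch\<close> the homotopy
    term; one constant covers all three.\<close>
  define C where "C = Cf + Cg * Cp + Ch"
  have C: "0 \<le> C" "Cf \<le> C" "Cg * Cp \<le> C" "Ch \<le> C"
    using Cf(1) Cg(1) Cp(1) Ch(1) by (auto simp: C_def)
  show ?thesis
  proof (rule that[OF C(1)])
    fix y assume y: "keys y \<subseteq> Q N" "frag_extend e y = 0"
    let ?x = "frag_extend f y"
    have x: "keys ?x \<subseteq> P N" "frag_extend d ?x = 0"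
      using YX.chain_map_extend[OF f N y(1)] y(2) by simp_all
    have "l1 ?x \<le> Cf * l1 y" by (rule l1_extend[OF y(1) Cf(2)])
    also have "\<dots> \<le> C * l1 y" by (rule mult_right_mono[OF C(2) l1_nonneg])
    finally have lx: "l1 ?x \<le> C * l1 y" .
    have "\<exists>W. keys W \<subseteq> Q (Suc N) \<and> frag_extend e W = y \<and> l1 W \<le> C * (l1 S + l1 y)"
      if S: "keys S \<subseteq> P (Suc N)" "frag_extend d S = ?x" for S
    proof -
      \<comment> \<open>No bound on \<open>T\<close> is available. It serves only to locate the
        support of \<open>frag_extend \<pi> S\<close> inside \<open>F\<close>.\<close>
      obtain T where T: "keys T \<subseteq> Q (Suc N)" "frag_extend e T = y"
        using exY y unfolding exact_upto_def by blast
      have fT: "keys (frag_extend f T) \<subseteq> P (Suc N)" "frag_extend d (frag_extend f T) = ?x"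
        using YX.chain_map_extend[OF f order_refl T(1)] T(2) by simp_all
      have "frag_extend \<pi> (S - frag_extend f T) = 0"
        using \<pi>(4)[OF keys_diff_subset[OF S(1) fT(1)]] S(2) fT(2) by (simp add: frag_extend_diff)
      then have \<pi>S: "frag_extend \<pi> S = frag_extend (\<lambda>\<tau>. frag_extend \<pi> (f \<tau>)) T"
        by (simp add: frag_extend_diff frag_extend_frag_extend)
      have \<pi>S_F: "keys (frag_extend \<pi> S) \<subseteq> F"
        unfolding \<pi>S by (rule frag_extend_subset[OF T(1)]) (auto simp: F_def)
      have d\<pi>S: "frag_extend d (frag_extend \<pi> S) = ?x"
        unfolding frag_extend_frag_extend S(2)[symmetric] by (rule frag_extend_cong_keys[OF S(1) \<pi>(3)])
      \<comment> \<open>The boundary of the first term is \<open>frag_extend g ?x\<close>, that of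
        the second is the same chain minus \<open>y\<close>; so the difference fills
        \<open>y\<close>.\<close>
      let ?W = "frag_extend g (frag_extend \<pi> S) - frag_extend h y"
      have g\<pi>S: "keys (frag_extend g (frag_extend \<pi> S)) \<subseteq> Q (Suc N)"
        "frag_extend e (frag_extend g (frag_extend \<pi> S)) = frag_extend g ?x"
        using XY.chain_map_extend[OF g order_refl order_trans[OF \<pi>S_F FP]] d\<pi>S by simp_all
      have hy: "keys (frag_extend h y) \<subseteq> Q (Suc N)"
        "frag_extend e (frag_extend h y) = frag_extend g ?x - y"
        using YY.homotopy_extend[OF h order_refl y(1)] y(2)
        by (simp_all add: frag_extend_frag_extend frag_extend_frag_of)
      have "l1 ?W \<le> l1 (frag_extend g (frag_extend \<pi> S)) + l1 (frag_extend h y)" by (rule l1_diff)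
      also have "l1 (frag_extend g (frag_extend \<pi> S)) \<le> Cg * l1 (frag_extend \<pi> S)"
        by (rule l1_extend[OF \<pi>S_F Cg(2)])
      also have "Cg * l1 (frag_extend \<pi> S) \<le> Cg * (Cp * l1 S)"
        by (rule mult_left_mono[OF l1_extend[OF S(1) Cp(2)] Cg(1)])
      also have "\<dots> \<le> C * l1 S" using mult_right_mono[OF C(3) l1_nonneg[of S]] by (simp add: mult.assoc)
      also have "l1 (frag_extend h y) \<le> Ch * l1 y" by (rule l1_extend[OF y(1) Ch(2)])
      also have "Ch * l1 y \<le> C * l1 y" by (rule mult_right_mono[OF C(4) l1_nonneg])
      finally have "l1 ?W \<le> C * (l1 S + l1 y)" by (simp add: distrib_left)
      moreover have "frag_extend e ?W = y" using g\<pi>S(2) hy(2) by (simp add: frag_extend_diff)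
      moreover have "keys ?W \<subseteq> Q (Suc N)" by (rule keys_diff_subset[OF g\<pi>S(1) hy(1)])
      ultimately show ?thesis by blast
    qed
    then show "\<exists>x. keys x \<subseteq> P N \<and> frag_extend d x = 0 \<and> l1 x \<le> C * l1 y \<and>
         (\<forall>S. keys S \<subseteq> P (Suc N) \<and> frag_extend d S = x \<longrightarrow>
           (\<exists>W. keys W \<subseteq> Q (Suc N) \<and> frag_extend e W = y \<and> l1 W \<le> C * (l1 S + l1 y)))"
      using x lx by blast
  qed
qed

section \<open>Simplicial chains of a universal cover\<close>

definition below :: "('a \<Rightarrow> nat) \<Rightarrow> 'a set \<Rightarrow> 'a \<Rightarrow> nat" where
  "below p \<sigma> v = card {u\<in>\<sigma>. p u < p v}"

text \<open>Vertices are ordered by their \<open>p\<close>-images. On a single vertex the result is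
  the empty face, that is, the augmentation which \<open>boundary\<close> leaves out.\<close>

definition ordered_boundary :: "('a \<Rightarrow> nat) \<Rightarrow> 'a set \<Rightarrow> 'a set \<Rightarrow>\<^sub>0 int" where
  "ordered_boundary p \<sigma> = (\<Sum>v\<in>\<sigma>. frag_cmul ((- 1) ^ below p \<sigma> v) (frag_of (\<sigma> - {v})))"

abbreviation (input) bdry :: "('a \<Rightarrow> nat) \<Rightarrow> ('a set \<Rightarrow>\<^sub>0 int) \<Rightarrow> 'a set \<Rightarrow>\<^sub>0 int" where
  "bdry p \<equiv> frag_extend (ordered_boundary p)"

lemma below_remove:
  assumes "finite \<sigma>" "u \<in> \<sigma>" "p u \<noteq> p v"
  shows "below p \<sigma> v = below p (\<sigma> - {u}) v + (if p u < p v then 1 else 0)"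
proof (cases "p u < p v")
  case True
  have "{w\<in>\<sigma>. p w < p v} = insert u {w\<in>\<sigma> - {u}. p w < p v}" using assms True by auto
  then show ?thesis using True assms by (simp add: below_def)
next
  case False
  have "{w\<in>\<sigma>. p w < p v} = {w\<in>\<sigma> - {u}. p w < p v}" using False by auto
  then show ?thesis using False by (simp add: below_def)
qed

lemma frag_eq_uminusD: "x = - x \<Longrightarrow> x = (0 :: 'a \<Rightarrow>\<^sub>0 int)"
proof (rule poly_mapping_eqI)
  fix k assume "x = - x"
  then have "lookup x k = - lookup x k" by (metis lookup_uminus)
  then show "lookup x k = lookup 0 k" by simp
qed

lemma neg_one_power_adjacent: "a = Suc b \<or> Suc a = b \<Longrightarrow> (- 1 :: int) ^ a = - ((- 1) ^ b)"
  by auto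

text \<open>Removing \<open>u\<close> and \<open>v\<close> in the two possible orders gives opposite
  signs, so the double sum equals its own negative; integral chains have no 2-torsion.\<close>

lemma ordered_boundary_boundary:
  assumes fin: "finite \<sigma>" and inj: "inj_on p \<sigma>"
  shows "bdry p (ordered_boundary p \<sigma>) = 0"
proof -
  let ?t = "\<lambda>v u. frag_cmul ((- 1) ^ (below p \<sigma> v + below p (\<sigma> - {v}) u)) (frag_of (\<sigma> - {v} - {u}))"
  let ?T = "\<lambda>v u. if u = v then 0 else ?t v u"
  have anti: "?T u v = - ?T v u" if "u \<in> \<sigma>" "v \<in> \<sigma>" for u v
  proof (cases "u = v")
    case False
    then have "p u \<noteq> p v" using inj that by (meson inj_onD)
    then have "below p \<sigma> u + below p (\<sigma> - {u}) v = Suc (below p \<sigma> v + below p (\<sigma> - {v}) u) \<or>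
       Suc (below p \<sigma> u + below p (\<sigma> - {u}) v) = below p \<sigma> v + below p (\<sigma> - {v}) u"
      using below_remove[OF fin that(1), of p v] below_remove[OF fin that(2), of p u] by auto
    then have "((- 1) ^ (below p \<sigma> u + below p (\<sigma> - {u}) v) :: int) = - ((- 1) ^ (below p \<sigma> v + below p (\<sigma> - {v}) u))"
      by (rule neg_one_power_adjacent)
    moreover have "\<sigma> - {u} - {v} = \<sigma> - {v} - {u}" by auto
    ultimately show ?thesis using False by (simp add: power_add)
  qed simp
  have "bdry p (ordered_boundary p \<sigma>) = (\<Sum>v\<in>\<sigma>. \<Sum>u\<in>\<sigma> - {v}. ?t v u)"
    unfolding ordered_boundary_def[of p \<sigma>]
    by (simp add: frag_extend_sum fin o_def frag_extend_cmul ordered_boundary_def frag_cmul_sum power_add)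
  also have "\<dots> = (\<Sum>v\<in>\<sigma>. \<Sum>u\<in>\<sigma>. ?T v u)"
  proof (rule sum.cong[OF refl])
    fix v assume v: "v \<in> \<sigma>"
    have "(\<Sum>u\<in>\<sigma>. ?T v u) = ?T v v + (\<Sum>u\<in>\<sigma> - {v}. ?T v u)" by (rule sum.remove[OF fin v])
    also have "(\<Sum>u\<in>\<sigma> - {v}. ?T v u) = (\<Sum>u\<in>\<sigma> - {v}. ?t v u)" by (rule sum.cong) auto
    finally show "(\<Sum>u\<in>\<sigma> - {v}. ?t v u) = (\<Sum>u\<in>\<sigma>. ?T v u)" by simp
  qed
  finally have eq: "bdry p (ordered_boundary p \<sigma>) = \<dots>" .
  have "(\<Sum>v\<in>\<sigma>. \<Sum>u\<in>\<sigma>. ?T v u) = (\<Sum>v\<in>\<sigma>. \<Sum>u\<in>\<sigma>. ?T u v)" by (rule sum.swap)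
  also have "\<dots> = (\<Sum>v\<in>\<sigma>. \<Sum>u\<in>\<sigma>. - ?T v u)" by (intro sum.cong refl anti)
  also have "\<dots> = - (\<Sum>v\<in>\<sigma>. \<Sum>u\<in>\<sigma>. ?T v u)" by (simp only: sum_negf)
  finally show ?thesis using frag_eq_uminusD unfolding eq by blast
qed

text \<open>The sign that compares the orientation of a simplex by the order of its vertices with its
  orientation by the order of their \<open>p\<close>-images; only the latter is invariant under deck maps.\<close>

definition orientation_sign :: "(nat \<Rightarrow> nat) \<Rightarrow> nat set \<Rightarrow> int" where
  "orientation_sign p \<sigma> = (- 1) ^ card {(u, v). u \<in> \<sigma> \<and> v \<in> \<sigma> \<and> u < v \<and> p v < p u}"

lemma orientation_sign_cases: "orientation_sign p \<sigma> = 1 \<or> orientation_sign p \<sigma> = - 1"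
proof -
  have "(- 1 :: int) ^ n = 1 \<or> (- 1 :: int) ^ n = - 1" for n by (cases "even n") auto
  then show ?thesis unfolding orientation_sign_def .
qed

lemma orientation_sign_simps [simp]:
  "orientation_sign p \<sigma> * orientation_sign p \<sigma> = 1" "orientation_sign p \<sigma> \<noteq> 0" "\<bar>orientation_sign p \<sigma>\<bar> = 1"
  using orientation_sign_cases[of p \<sigma>] by auto

text \<open>A count modulo 2. The inversions lost with \<open>v\<close> are the smaller vertices of
  larger image (\<open>?lg\<close>) and the larger ones of smaller image (\<open>?gl\<close>). The
  predecessors of \<open>v\<close> in the two orders share \<open>?ll\<close> and otherwise are just
  \<open>?lg\<close> and \<open>?gl\<close>. This makes \<open>unorient\<close> commute with the
  boundaries.\<close>

lemma orientation_sign_remove: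
  assumes fin: "finite \<sigma>" and inj: "inj_on p \<sigma>" and v: "v \<in> \<sigma>"
  shows "orientation_sign p (\<sigma> - {v}) * (- 1) ^ below p \<sigma> v = orientation_sign p \<sigma> * (- 1) ^ card {u\<in>\<sigma>. u < v}"
proof -
  let ?I = "\<lambda>\<sigma>. {(u, v). u \<in> \<sigma> \<and> v \<in> \<sigma> \<and> u < v \<and> p v < p u}"
  let ?ll = "{u\<in>\<sigma>. u < v \<and> p u < p v}" and ?lg = "{u\<in>\<sigma>. u < v \<and> p v < p u}" and ?gl = "{u\<in>\<sigma>. v < u \<and> p u < p v}"
  have ne: "p u \<noteq> p v" if "u \<in> \<sigma>" "u \<noteq> v" for u using inj that v by (meson inj_onD)
  have finI: "finite (?I (\<sigma> - {v}))"
    by (rule finite_subset[of _ "\<sigma> \<times> \<sigma>"]) (use fin in auto)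
  have I_eq: "?I \<sigma> = ?I (\<sigma> - {v}) \<union> ((\<lambda>u. (u, v)) ` ?lg \<union> (\<lambda>u. (v, u)) ` ?gl)" using v by auto
  have "card (?I \<sigma>) = card (?I (\<sigma> - {v})) + card ((\<lambda>u. (u, v)) ` ?lg \<union> (\<lambda>u. (v, u)) ` ?gl)"
    unfolding I_eq by (rule card_Un_disjoint) (use finI fin in auto)
  also have "card ((\<lambda>u. (u, v)) ` ?lg \<union> (\<lambda>u. (v, u)) ` ?gl) = card ((\<lambda>u. (u, v)) ` ?lg) + card ((\<lambda>u. (v, u)) ` ?gl)"
    by (rule card_Un_disjoint) (use fin in auto)
  also have "card ((\<lambda>u. (u, v)) ` ?lg) = card ?lg" by (rule card_image) (simp add: inj_on_def)
  also have "card ((\<lambda>u. (v, u)) ` ?gl) = card ?gl" by (rule card_image) (simp add: inj_on_def)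
  finally have 1: "card (?I \<sigma>) = card (?I (\<sigma> - {v})) + (card ?lg + card ?gl)" .
  have "p u < p v \<or> p v < p u" if "u \<in> \<sigma>" "u < v" for u using ne[of u] that by auto
  then have eq2: "{u\<in>\<sigma>. u < v} = ?ll \<union> ?lg" by blast
  have 2: "card {u\<in>\<sigma>. u < v} = card ?ll + card ?lg"
    unfolding eq2 by (rule card_Un_disjoint) (use fin in auto)
  have "u < v \<or> v < u" if "p u < p v" for u using that by (metis less_irrefl linorder_neqE_nat)
  then have eq3: "{u\<in>\<sigma>. p u < p v} = ?ll \<union> ?gl" by blast
  have 3: "below p \<sigma> v = card ?ll + card ?gl"
    unfolding below_def eq3 by (rule card_Un_disjoint) (use fin in auto)
  have "even (card (?I (\<sigma> - {v})) + below p \<sigma> v) \<longleftrightarrow> even (card (?I \<sigma>) + card {u\<in>\<sigma>. u < v})"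
    unfolding 1 2 3 by auto
  then show ?thesis
    unfolding orientation_sign_def power_add[symmetric] by (simp only: minus_one_power_iff)
qed

definition unorient :: "(nat \<Rightarrow> nat) \<Rightarrow> (nat set \<Rightarrow>\<^sub>0 int) \<Rightarrow> nat set \<Rightarrow> int" where
  "unorient p c = (\<lambda>\<sigma>. orientation_sign p \<sigma> * lookup c \<sigma>)"

lemma unorient_support: "{\<sigma>. unorient p c \<sigma> \<noteq> 0} = keys c"
  by (auto simp: unorient_def in_keys_iff)

lemma lookup_sum: "lookup (sum f I) x = (\<Sum>i\<in>I. lookup (f i) x :: int)"
  by (induction I rule: infinite_finite_induct) (simp_all add: lookup_add)

lemma lookup_frag_extend: "lookup (frag_extend f c) x = (\<Sum>i\<in>keys c. lookup c i * lookup (f i) x)"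
  by (simp add: frag_extend_def lookup_sum)

lemma boundary_unorient:
  assumes "\<And>\<sigma>. \<sigma> \<in> keys c \<Longrightarrow> finite \<sigma> \<and> inj_on p \<sigma>" and "\<tau> \<noteq> {}"
  shows "boundary (unorient p c) \<tau> = unorient p (bdry p c) \<tau>"
proof -
  have "boundary (unorient p c) \<tau> =
      (\<Sum>\<sigma>\<in>keys c. \<Sum>v\<in>\<sigma>. if \<sigma> - {v} = \<tau> then (- 1) ^ card {u\<in>\<sigma>. u < v} * unorient p c \<sigma> else 0)"
    using assms(2) by (simp add: boundary_def unorient_support)
  also have "\<dots> = (\<Sum>\<sigma>\<in>keys c. \<Sum>v\<in>\<sigma>. if \<sigma> - {v} = \<tau>
      then orientation_sign p \<tau> * (- 1) ^ below p \<sigma> v * lookup c \<sigma> else 0)"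
  proof (intro sum.cong refl if_cong)
    fix \<sigma> v assume *: "\<sigma> \<in> keys c" "v \<in> \<sigma>" "\<sigma> - {v} = \<tau>"
    then have "orientation_sign p \<tau> * (- 1) ^ below p \<sigma> v = orientation_sign p \<sigma> * (- 1) ^ card {u\<in>\<sigma>. u < v}"
      using orientation_sign_remove[of \<sigma> p v] assms(1) by auto
    then show "(- 1) ^ card {u\<in>\<sigma>. u < v} * unorient p c \<sigma> = orientation_sign p \<tau> * (- 1) ^ below p \<sigma> v * lookup c \<sigma>"
      by (simp add: unorient_def mult.commute mult.left_commute)
  qed
  also have "\<dots> = (\<Sum>\<sigma>\<in>keys c. orientation_sign p \<tau> * (lookup c \<sigma> * lookup (ordered_boundary p \<sigma>) \<tau>))"
  proof (rule sum.cong[OF refl])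
    fix \<sigma>
    have "lookup (ordered_boundary p \<sigma>) \<tau> = (\<Sum>v\<in>\<sigma>. if \<sigma> - {v} = \<tau> then (- 1) ^ below p \<sigma> v else 0)"
      unfolding ordered_boundary_def lookup_sum by (intro sum.cong refl) auto
    then show "(\<Sum>v\<in>\<sigma>. if \<sigma> - {v} = \<tau> then orientation_sign p \<tau> * (- 1) ^ below p \<sigma> v * lookup c \<sigma> else 0) =
        orientation_sign p \<tau> * (lookup c \<sigma> * lookup (ordered_boundary p \<sigma>) \<tau>)"
      by (simp add: sum_distrib_left if_distrib mult.commute mult.left_commute cong: if_cong)
  qed
  also have "\<dots> = unorient p (bdry p c) \<tau>"
    by (simp add: unorient_def lookup_frag_extend sum_distrib_left)
  finally show ?thesis .
qed

text \<open>Indexed by the number of vertices, with the empty face in index 0: the basis of the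
  augmented complex, where index \<open>k\<close> is dimension \<open>k - 1\<close>.\<close>

definition faces :: "metric_complex \<Rightarrow> nat \<Rightarrow> nat set set" where
  "faces X k = {\<sigma> \<in> insert {} (simplices X). card \<sigma> = k}"

lemma chains_unorient: "chains X k = unorient p ` {c. keys c \<subseteq> faces X (Suc k)}"
proof (intro equalityI subsetI)
  fix Z assume Z: "Z \<in> chains X k"
  define c where "c = Abs_poly_mapping (\<lambda>\<sigma>. orientation_sign p \<sigma> * Z \<sigma>)"
  have "finite {\<sigma>. orientation_sign p \<sigma> * Z \<sigma> \<noteq> 0}" using Z by (simp add: chains_def)
  then have c: "lookup c = (\<lambda>\<sigma>. orientation_sign p \<sigma> * Z \<sigma>)" by (simp add: c_def)
  have "Z = unorient p c" by (simp add: unorient_def c fun_eq_iff flip: mult.assoc)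
  moreover have "keys c \<subseteq> faces X (Suc k)"
    using Z by (auto simp: in_keys_iff c chains_def faces_def)
  ultimately show "Z \<in> unorient p ` {c. keys c \<subseteq> faces X (Suc k)}" by blast
next
  fix Z assume "Z \<in> unorient p ` {c. keys c \<subseteq> faces X (Suc k)}"
  then obtain c where c: "keys c \<subseteq> faces X (Suc k)" "Z = unorient p c" by auto
  then show "Z \<in> chains X k"
    unfolding chains_def c(2) mem_Collect_eq unorient_support by (auto simp: faces_def)
qed

lemma mass_unorient: "mass X (unorient p c) = (\<Sum>\<sigma>\<in>keys c. \<bar>real_of_int (lookup c \<sigma>)\<bar> * simplex_vol X \<sigma>)"
proof -
  have "\<bar>real_of_int (unorient p c \<sigma>)\<bar> = \<bar>real_of_int (lookup c \<sigma>)\<bar>" for \<sigma>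
    using orientation_sign_cases[of p \<sigma>] by (auto simp: unorient_def)
  then show ?thesis by (simp add: mass_def unorient_support)
qed

lemma below_image:
  assumes "inj_on f \<sigma>" "v \<in> \<sigma>" "\<And>u. u \<in> \<sigma> \<Longrightarrow> p (f u) = p u"
  shows "below p (f ` \<sigma>) (f v) = below p \<sigma> v"
proof -
  have "{u \<in> f ` \<sigma>. p u < p (f v)} = f ` {u\<in>\<sigma>. p u < p v}" using assms(2,3) by auto
  moreover have "inj_on f {u\<in>\<sigma>. p u < p v}" using assms(1) by (rule inj_on_subset) auto
  ultimately show ?thesis by (simp add: below_def card_image)
qed

lemma ordered_boundary_image:
  assumes "inj_on f \<sigma>" "\<And>u. u \<in> \<sigma> \<Longrightarrow> p (f u) = p u"
  shows "ordered_boundary p (f ` \<sigma>) = frag_map ((`) f) (ordered_boundary p \<sigma>)"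
proof (cases "finite \<sigma>")
  case True
  have "ordered_boundary p (f ` \<sigma>) =
      (\<Sum>v\<in>\<sigma>. frag_cmul ((- 1) ^ below p (f ` \<sigma>) (f v)) (frag_of (f ` \<sigma> - {f v})))"
    unfolding ordered_boundary_def using sum.reindex[OF assms(1)] by (simp add: o_def)
  also have "\<dots> = (\<Sum>v\<in>\<sigma>. frag_cmul ((- 1) ^ below p \<sigma> v) (frag_of (f ` (\<sigma> - {v}))))"
  proof (rule sum.cong[OF refl])
    fix v assume v: "v \<in> \<sigma>"
    have "f ` \<sigma> - {f v} = f ` (\<sigma> - {v})" using inj_on_image_set_diff[OF assms(1), of \<sigma> "{v}"] v by simp
    then show "frag_cmul ((- 1) ^ below p (f ` \<sigma>) (f v)) (frag_of (f ` \<sigma> - {f v})) =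
        frag_cmul ((- 1) ^ below p \<sigma> v) (frag_of (f ` (\<sigma> - {v})))"
      using below_image[OF assms(1) v, of p] assms(2) by simp
  qed
  also have "\<dots> = frag_map ((`) f) (ordered_boundary p \<sigma>)"
    unfolding ordered_boundary_def frag_map_def using True by (simp add: frag_extend_sum o_def frag_extend_cmul)
  finally show ?thesis .
next
  case False
  then show ?thesis using finite_image_iff[OF assms(1)] by (simp add: ordered_boundary_def)
qed

lemma chart_cong_cell_image:
  assumes X: "euclidean_complex X" and X': "euclidean_complex X'"
    and \<sigma>: "\<sigma> \<in> simplices X" and \<tau>: "\<tau> \<in> simplices X'" and m: "bij_betw m \<sigma> \<tau>"
    and ch: "\<And>v. v \<in> \<sigma> \<Longrightarrow> chart X' \<tau> (m v) = chart X \<sigma> v"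
  shows "{\<lambda>i\<in>I. \<Sum>v\<in>\<sigma>. x v * chart X \<sigma> v i | x. x \<in> cell X \<sigma>} \<subseteq>
    {\<lambda>i\<in>I. \<Sum>v\<in>\<tau>. x v * chart X' \<tau> v i | x. x \<in> cell X' \<tau>}"
proof clarify
  fix x assume x: "x \<in> cell X \<sigma>"
  define y where "y w = (if w \<in> \<tau> then x (inv_into \<sigma> m w) else 0)" for w
  have ym: "y (m v) = x v" if "v \<in> \<sigma>" for v
    using that m by (simp add: y_def bij_betw_inv_into_left bij_betw_apply)
  have sums: "(\<Sum>w\<in>\<tau>. y w * F w) = (\<Sum>v\<in>\<sigma>. x v * F (m v))" for F :: "nat \<Rightarrow> real"
    using sum.reindex_bij_betw[OF m, of "\<lambda>w. y w * F w", symmetric] ym by simp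
  have "y \<in> cell X' \<tau>"
    using x sums[of "\<lambda>_. 1"] by (auto simp: cell_iff[OF X \<sigma>] cell_iff[OF X' \<tau>] y_def)
  moreover have "(\<lambda>i\<in>I. \<Sum>v\<in>\<sigma>. x v * chart X \<sigma> v i) = (\<lambda>i\<in>I. \<Sum>w\<in>\<tau>. y w * chart X' \<tau> w i)"
    using sums ch by simp
  ultimately show "\<exists>y. (\<lambda>i\<in>I. \<Sum>v\<in>\<sigma>. x v * chart X \<sigma> v i) = (\<lambda>i\<in>I. \<Sum>w\<in>\<tau>. y w * chart X' \<tau> w i) \<and> y \<in> cell X' \<tau>"
    by blast
qed

text \<open>Applied with \<open>m = p\<close>, it lets volumes in the cover be read off in
  \<open>K\<close>, where a finite skeleton leaves only finitely many values.\<close>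

lemma simplex_vol_cong:
  assumes X: "euclidean_complex X" and X': "euclidean_complex X'"
    and \<sigma>: "\<sigma> \<in> simplices X" and \<tau>: "\<tau> \<in> simplices X'" and m: "bij_betw m \<sigma> \<tau>"
    and ch: "\<And>v. v \<in> \<sigma> \<Longrightarrow> chart X' \<tau> (m v) = chart X \<sigma> v"
  shows "simplex_vol X \<sigma> = simplex_vol X' \<tau>"
proof -
  have "simplex_dim \<sigma> = simplex_dim \<tau>" using bij_betw_same_card[OF m] by (simp add: simplex_dim_def)
  moreover have "chart X \<sigma> (inv_into \<sigma> m w) = chart X' \<tau> w" if "w \<in> \<tau>" for w
    using ch[of "inv_into \<sigma> m w"] that m bij_betw_inv_into_right[OF m that]
    by (metis bij_betw_imp_surj_on inv_into_into)
  then have "{\<lambda>i\<in>I. \<Sum>v\<in>\<sigma>. x v * chart X \<sigma> v i | x. x \<in> cell X \<sigma>} =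
    {\<lambda>i\<in>I. \<Sum>v\<in>\<tau>. x v * chart X' \<tau> v i | x. x \<in> cell X' \<tau>}" for I
    using chart_cong_cell_image[OF X X' \<sigma> \<tau> m ch]
      chart_cong_cell_image[OF X' X \<tau> \<sigma> bij_betw_inv_into[OF m]] by blast
  ultimately show ?thesis by (simp add: simplex_vol_def)
qed

text \<open>Lists have every length even over a one-element type, so lengths enumerate the naturals
  and these encode all finite vertex sets. This supplies the map \<open>D\<close> of the coefficient
  module.\<close>

lemma set_decode_length_surj: "{A. finite A} \<subseteq> range (\<lambda>t :: 'g list. set_decode (length t))"
proof
  fix A :: "nat set" assume "A \<in> {A. finite A}"
  then have "A = set_decode (length (replicate (set_encode A) (undefined :: 'g)))"
    by (simp add: set_encode_inverse)
  then show "A \<in> range (\<lambda>t :: 'g list. set_decode (length t))" by blast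
qed

section \<open>Finite chains lie in balls, so the filling conditions yield exactness\<close>

definition reaches :: "metric_complex \<Rightarrow> (nat \<Rightarrow> real) \<Rightarrow> (nat \<Rightarrow> real) \<Rightarrow> real \<Rightarrow> bool" where
  "reaches X x y R \<longleftrightarrow> 0 \<le> R \<and> (\<exists>xs. xs \<noteq> [] \<and> hd xs = x \<and> last xs = y \<and>
     (\<Sum>i<length xs - 1. segment_length X (xs ! i) (xs ! Suc i)) \<le> ennreal R)"

lemma reaches_refl: "reaches X x x 0"
  unfolding reaches_def by (intro conjI exI[of _ "[x]"]) auto

lemma reaches_length_dist: "reaches X x y R \<Longrightarrow> length_dist X x y \<le> ennreal R"
  unfolding reaches_def length_dist_def by (auto intro: INF_lower2)

lemma reaches_step:
  assumes "reaches X x y R" "segment_length X y z \<le> ennreal s" "0 \<le> s"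
  shows "reaches X x z (R + s)"
proof -
  obtain xs where xs: "xs \<noteq> []" "hd xs = x" "last xs = y" "0 \<le> R"
    "(\<Sum>i<length xs - 1. segment_length X (xs ! i) (xs ! Suc i)) \<le> ennreal R"
    using assms(1) by (auto simp: reaches_def)
  obtain k where k: "length xs = Suc k" using xs(1) by (cases xs) auto
  have "(\<Sum>i<length (xs @ [z]) - 1. segment_length X ((xs @ [z]) ! i) ((xs @ [z]) ! Suc i)) =
      (\<Sum>i<k. segment_length X (xs ! i) (xs ! Suc i)) + segment_length X y z"
  proof -
    have "(\<Sum>i<k. segment_length X ((xs @ [z]) ! i) ((xs @ [z]) ! Suc i)) =
        (\<Sum>i<k. segment_length X (xs ! i) (xs ! Suc i))"
      using k by (intro sum.cong refl) (simp add: nth_append)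
    moreover have "(xs @ [z]) ! k = y" "(xs @ [z]) ! Suc k = z"
      using k xs(1,3) by (simp_all add: nth_append last_conv_nth)
    ultimately show ?thesis using k by simp
  qed
  also have "\<dots> \<le> ennreal R + ennreal s" using xs(5) k assms(2) by (intro add_mono) auto
  finally show ?thesis
    unfolding reaches_def using xs assms(3) by (intro conjI exI[of _ "xs @ [z]"]) auto
qed

context
  fixes X assumes X: "euclidean_complex X"
begin

lemma segment_length_bounded:
  assumes \<sigma>: "\<sigma> \<in> simplices X"
  obtains B where "B \<ge> 0" "\<And>x y. x \<in> cell X \<sigma> \<Longrightarrow> y \<in> cell X \<sigma> \<Longrightarrow> segment_length X x y \<le> ennreal B"
proof
  let ?B = "sqrt (\<Sum>i<simplex_dim \<sigma>. (\<Sum>v\<in>\<sigma>. \<bar>chart X \<sigma> v i\<bar>)\<^sup>2)"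
  show "?B \<ge> 0" by (simp add: sum_nonneg)
  fix x y assume xy: "x \<in> cell X \<sigma>" "y \<in> cell X \<sigma>"
  have bd: "\<bar>x v - y v\<bar> \<le> 1" for v
  proof -
    have "x \<in> unit_cube" "y \<in> unit_cube"
      using xy cell_subset[OF X] realization_subset_unit_cube[OF X] by blast+
    then have "0 \<le> x v" "x v \<le> 1" "0 \<le> y v" "y v \<le> 1" by (auto simp: unit_cube_def)
    then show ?thesis by linarith
  qed
  have "\<bar>\<Sum>v\<in>\<sigma>. (x v - y v) * chart X \<sigma> v i\<bar> \<le> (\<Sum>v\<in>\<sigma>. \<bar>chart X \<sigma> v i\<bar>)" for i
    by (rule order_trans[OF sum_abs sum_mono]) (use bd in \<open>simp add: abs_mult mult_left_le_one_le\<close>)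
  then have "cell_dist X \<sigma> x y \<le> ?B"
    unfolding cell_dist_def
    by (intro real_sqrt_le_mono sum_mono) (metis abs_le_square_iff abs_of_nonneg abs_ge_zero order_trans)
  then show "segment_length X x y \<le> ennreal ?B"
    unfolding segment_length_def using \<sigma> xy by (intro INF_lower2[of \<sigma>]) (auto intro: ennreal_leI)
qed

lemma reaches_vertex:
  assumes "connected (realization X)" "{u} \<in> simplices X" "{v} \<in> simplices X"
  shows "\<exists>R. reaches X (vtx u) (vtx v) R"
  using edge_path[OF X assms]
proof (induction rule: rtrancl_induct)
  case base
  then show ?case using reaches_refl by blast
next
  case (step a b)
  then obtain R where R: "reaches X (vtx u) (vtx a) R" by blast
  have ab: "{a, b} \<in> simplices X" using step by simp
  obtain B where "B \<ge> 0" "\<And>x y. x \<in> cell X {a, b} \<Longrightarrow> y \<in> cell X {a, b} \<Longrightarrow> segment_length X x y \<le> ennreal B"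
    using segment_length_bounded[OF ab] by blast
  then show ?case using reaches_step[OF R] vtx_in_cell[OF X ab] by blast
qed

text \<open>\<open>satisfies_CI\<close> speaks of cycles supported in a ball. Vertices are joined by
  edge paths of finite length and cells have bounded diameter, so every finite chain is covered by
  it.\<close>

lemma finite_support_in_ball:
  assumes con: "connected (realization X)" and u: "{u} \<in> simplices X"
    and F: "finite F" "F \<subseteq> simplices X"
  obtains r where "r > 0" "(\<Union>\<sigma>\<in>F. cell X \<sigma>) \<subseteq> length_ball X (vtx u) r"
proof -
  have "\<exists>r\<ge>0. cell X \<sigma> \<subseteq> length_ball X (vtx u) r" if \<sigma>: "\<sigma> \<in> F" for \<sigma>
  proof -
    have \<sigma>X: "\<sigma> \<in> simplices X" using \<sigma> F by auto
    obtain v where v: "v \<in> \<sigma>" using simplex_nonempty[OF X \<sigma>X] by auto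
    obtain R where R: "reaches X (vtx u) (vtx v) R"
      using reaches_vertex[OF con u simplex_vertex[OF X \<sigma>X v]] by blast
    obtain B where B: "B \<ge> 0" "\<And>x y. x \<in> cell X \<sigma> \<Longrightarrow> y \<in> cell X \<sigma> \<Longrightarrow> segment_length X x y \<le> ennreal B"
      using segment_length_bounded[OF \<sigma>X] by blast
    have "cell X \<sigma> \<subseteq> length_ball X (vtx u) (R + B)"
    proof
      fix x assume x: "x \<in> cell X \<sigma>"
      have "reaches X (vtx u) x (R + B)"
        by (rule reaches_step[OF R B(2)[OF vtx_in_cell[OF X \<sigma>X v] x] B(1)])
      then show "x \<in> length_ball X (vtx u) (R + B)"
        using reaches_length_dist subsetD[OF cell_subset[OF X] x] by (simp add: length_ball_def)
    qed
    moreover have "R + B \<ge> 0" using R B by (simp add: reaches_def)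
    ultimately show ?thesis by blast
  qed
  then obtain r where r: "\<And>\<sigma>. \<sigma> \<in> F \<Longrightarrow> r \<sigma> \<ge> 0" "\<And>\<sigma>. \<sigma> \<in> F \<Longrightarrow> cell X \<sigma> \<subseteq> length_ball X (vtx u) (r \<sigma>)" by metis
  have le: "r \<sigma> \<le> sum r F + 1" if "\<sigma> \<in> F" for \<sigma>
    using member_le_sum[OF that, of r] r(1) F(1) by fastforce
  show ?thesis
  proof (rule that)
    show "sum r F + 1 > 0" using r(1) by (intro add_nonneg_pos sum_nonneg) auto
    show "(\<Union>\<sigma>\<in>F. cell X \<sigma>) \<subseteq> length_ball X (vtx u) (sum r F + 1)"
    proof (rule UN_least)
      fix \<sigma> assume \<sigma>: "\<sigma> \<in> F"
      have "ennreal (r \<sigma>) \<le> ennreal (sum r F + 1)" by (rule ennreal_leI[OF le[OF \<sigma>]])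
      then show "cell X \<sigma> \<subseteq> length_ball X (vtx u) (sum r F + 1)"
        using r(2)[OF \<sigma>] by (auto simp: length_ball_def intro: order_trans)
    qed
  qed
qed

lemma satisfies_CI_imp_fillings:
  assumes con: "connected (realization X)" and u: "{u} \<in> simplices X"
    and CI: "satisfies_CI m X" and k: "k \<in> {1..m}" and Z: "Z \<in> cycles X k"
  shows "\<exists>S\<in>chains X (Suc k). boundary S = Z"
proof -
  have fin: "finite {\<sigma>. Z \<sigma> \<noteq> 0}" "{\<sigma>. Z \<sigma> \<noteq> 0} \<subseteq> simplices X"
    using Z by (auto simp: cycles_def chains_def)
  obtain r where r: "r > 0" "chain_support X Z \<subseteq> length_ball X (vtx u) r"
    using finite_support_in_ball[OF con u fin] unfolding chain_support_def by blast
  obtain c where "\<forall>x0\<in>realization X. \<forall>r>0. \<forall>k\<in>{1..m}. \<forall>Z\<in>cycles X k.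
      chain_support X Z \<subseteq> length_ball X x0 r \<longrightarrow>
        (\<exists>S\<in>chains X (Suc k). boundary S = Z \<and> mass X S \<le> c * r * mass X Z)"
    using CI unfolding satisfies_CI_def by blast
  then show ?thesis using vtx_in_realization[OF X u] r k Z by blast
qed

end

lemma satisfies_CI_mono:
  assumes "satisfies_CI m X" "l \<le> m" shows "satisfies_CI l X"
proof -
  obtain c where c: "c > 0" "\<forall>x\<in>realization X. \<forall>x'\<in>realization X. \<exists>\<gamma>. path \<gamma> \<and> path_image \<gamma> \<subseteq> realization X \<and>
      pathstart \<gamma> = x \<and> pathfinish \<gamma> = x' \<and> path_length X \<gamma> \<le> ennreal c * length_dist X x x'"
    "\<forall>x0\<in>realization X. \<forall>r>0. \<forall>k\<in>{1..m}. \<forall>Z\<in>cycles X k.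
      chain_support X Z \<subseteq> length_ball X x0 r \<longrightarrow>
        (\<exists>S\<in>chains X (Suc k). boundary S = Z \<and> mass X S \<le> c * r * mass X Z)"
    using assms(1) unfolding satisfies_CI_def by blast
  have "{1..l} \<subseteq> {1..m}" using assms(2) by auto
  then have "\<forall>x0\<in>realization X. \<forall>r>0. \<forall>k\<in>{1..l}. \<forall>Z\<in>cycles X k.
      chain_support X Z \<subseteq> length_ball X x0 r \<longrightarrow>
        (\<exists>S\<in>chains X (Suc k). boundary S = Z \<and> mass X S \<le> c * r * mass X Z)"
    using c(3) by blast
  then show ?thesis unfolding satisfies_CI_def using c(1,2) by blast
qed

section \<open>The augmented simplicial complex of a cover under its deck group\<close>

locale cover_action = simplicial_cover X p K + group G
  for X p K and G :: "('g, 'x) monoid_scheme" (structure) +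
  fixes act :: "'g \<Rightarrow> nat \<Rightarrow> nat"
  assumes act_simplex: "g \<in> carrier G \<Longrightarrow> \<sigma> \<in> simplices X \<Longrightarrow> act g ` \<sigma> \<in> simplices X"
    and p_act: "g \<in> carrier G \<Longrightarrow> {v} \<in> simplices X \<Longrightarrow> p (act g v) = p v"
    and act_mult: "g \<in> carrier G \<Longrightarrow> h \<in> carrier G \<Longrightarrow> {v} \<in> simplices X \<Longrightarrow> act (g \<otimes> h) v = act g (act h v)"
    and act_one: "{v} \<in> simplices X \<Longrightarrow> act \<one> v = v"
    and act_free: "g \<in> carrier G \<Longrightarrow> {v} \<in> simplices X \<Longrightarrow> act g v = v \<Longrightarrow> g = \<one>"
    and act_trans: "{u} \<in> simplices X \<Longrightarrow> {v} \<in> simplices X \<Longrightarrow> p u = p v \<Longrightarrow> \<exists>g\<in>carrier G. act g u = v"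
    and nonempty: "realization X \<noteq> {}"
begin

lemma face_zero: "faces X 0 = {{}}"
  using simplex_finite[OF X] simplex_nonempty[OF X] by (auto simp: faces_def)

lemma faces_Suc: "faces X (Suc k) = {\<sigma> \<in> simplices X. card \<sigma> = Suc k}"
  by (auto simp: faces_def)

lemma face_finite: "\<sigma> \<in> faces X k \<Longrightarrow> finite \<sigma>"
  and face_vertex: "\<sigma> \<in> faces X k \<Longrightarrow> v \<in> \<sigma> \<Longrightarrow> {v} \<in> simplices X"
  and face_inj: "\<sigma> \<in> faces X k \<Longrightarrow> inj_on p \<sigma>"
  using simplex_finite[OF X] simplex_vertex[OF X] p_inj_on by (auto simp: faces_def)

lemma act_inj_on:
  assumes "g \<in> carrier G" "\<sigma> \<in> faces X k" shows "inj_on (act g) \<sigma>"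
proof (rule inj_onI)
  fix u v assume uv: "u \<in> \<sigma>" "v \<in> \<sigma>" "act g u = act g v"
  then have "p u = p v" using p_act[OF assms(1) face_vertex[OF assms(2)]] by metis
  then show "u = v" using face_inj[OF assms(2)] uv by (meson inj_onD)
qed

lemma act_face: "g \<in> carrier G \<Longrightarrow> \<sigma> \<in> faces X k \<Longrightarrow> act g ` \<sigma> \<in> faces X k"
  using card_image[OF act_inj_on] act_simplex by (auto simp: faces_def)

lemma remove_face:
  assumes "\<sigma> \<in> faces X (Suc k)" "v \<in> \<sigma>" shows "\<sigma> - {v} \<in> faces X k"
proof -
  have "card (\<sigma> - {v}) = k" using assms face_finite[OF assms(1)] by (simp add: faces_def)
  moreover have "\<sigma> - {v} = {} \<or> \<sigma> - {v} \<in> simplices X"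
    using simplex_face[OF X, of \<sigma> "\<sigma> - {v}"] assms by (auto simp: faces_def)
  ultimately show ?thesis by (auto simp: faces_def)
qed

lemma ordered_boundary_keys:
  assumes "\<sigma> \<in> faces X (Suc k)" shows "keys (ordered_boundary p \<sigma>) \<subseteq> faces X k"
proof -
  have "keys (ordered_boundary p \<sigma>) \<subseteq> (\<Union>v\<in>\<sigma>. keys (frag_cmul ((- 1) ^ below p \<sigma> v) (frag_of (\<sigma> - {v}))))"
    unfolding ordered_boundary_def by (rule keys_sum)
  also have "\<dots> \<subseteq> faces X k" using remove_face[OF assms] by (auto split: if_splits)
  finally show ?thesis .
qed

text \<open>Freeness on simplices comes from freeness on vertices: an element that preserves a
  simplex sends each vertex to a vertex of the same simplex with the same image, and
  \<open>p\<close> is injective there, so it fixes every vertex.\<close>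

lemma simplicial_complex: "augmented_complex G (\<lambda>g. (`) (act g)) (faces X) (ordered_boundary p) {}"
proof (unfold_locales, goal_cases)
  case 1
  show ?case by (rule face_zero)
next
  case (2 g b k)
  then show ?case by (rule act_face)
next
  case (3 g h b k)
  then have "act (g \<otimes> h) v = act g (act h v)" if "v \<in> b" for v using act_mult face_vertex that by blast
  then show ?case by (simp add: image_image)
next
  case (4 b k)
  then have "act \<one> v = v" if "v \<in> b" for v using act_one face_vertex that by blast
  then show ?case by simp
next
  case (5 g b k)
  then have "b \<noteq> {}" by (auto simp: faces_def)
  then obtain v where v: "v \<in> b" by blast
  then have "act g v \<in> b" using 5(3) by blast
  then have "act g v = v"
    using inj_onD[OF face_inj[OF 5(2)] p_act[OF 5(1) face_vertex[OF 5(2) v]]] v by blast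
  then show ?case using act_free[OF 5(1) face_vertex[OF 5(2) v]] by simp
next
  case (6 b k l)
  then show ?case by (simp add: faces_def)
next
  case 7
  then show ?case by (simp add: ordered_boundary_def)
next
  case (8 b k)
  then show ?case by (rule ordered_boundary_keys)
next
  case (9 b k)
  then show ?case using ordered_boundary_boundary face_finite face_inj by blast
next
  case (10 g b k)
  then show ?case using ordered_boundary_image[of "act g" b p, OF act_inj_on[OF 10] p_act[OF 10(1) face_vertex[OF 10(2)]]] by blast
qed

lemma connected_X: "connected (realization X)"
  using path_connected_X by (rule path_connected_imp_connected)

lemma vertex_exists: obtains u where "{u} \<in> simplices X"
proof -
  obtain x where "x \<in> realization X" using nonempty by auto
  then have "supp x \<in> simplices X" by (rule supp_simplex[OF X])
  then show ?thesis using simplex_nonempty[OF X] simplex_vertex[OF X] that by blast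
qed

lemma vertex_difference:
  assumes "{u} \<in> simplices X" "{v} \<in> simplices X"
  shows "\<exists>w. keys w \<subseteq> faces X 2 \<and> bdry p w = frag_of {v} - frag_of {u}"
  using edge_path[OF X connected_X assms]
proof (induction rule: rtrancl_induct)
  case base
  show ?case by (rule exI[of _ 0]) simp
next
  case (step a b)
  then obtain w where w: "keys w \<subseteq> faces X 2" "bdry p w = frag_of {a} - frag_of {u}"
    by blast
  have ab: "{a, b} \<in> simplices X" using step by simp
  show ?case
  proof (cases "a = b")
    case True
    then show ?thesis using w by blast
  next
    case False
    then have ne: "p a \<noteq> p b" using p_inj_on[OF ab] by (auto dest: inj_onD)
    have f: "{a, b} \<in> faces X 2" using ab False by (simp add: faces_def)
    have sets: "{a, b} - {a} = {b}" "{a, b} - {b} = {a}" using False by auto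
    have bd: "ordered_boundary p {a, b} = frag_cmul ((- 1) ^ below p {a, b} a) (frag_of {b})
        + frag_cmul ((- 1) ^ below p {a, b} b) (frag_of {a})"
      using False sets by (simp add: ordered_boundary_def)
    have "{u. (u = a \<or> u = b) \<and> p u < p a} = (if p a < p b then {} else {b})"
      "{u. (u = a \<or> u = b) \<and> p u < p b} = (if p a < p b then {a} else {})"
      using ne by auto
    then have below: "below p {a, b} a = (if p a < p b then 0 else 1)" "below p {a, b} b = (if p a < p b then 1 else 0)"
      by (simp_all add: below_def)
    \<comment> \<open>The edge is oriented towards its vertex of larger image, so it is added or
      subtracted according to that order.\<close>
    define w' where "w' = (if p a < p b then w + frag_of {a, b} else w - frag_of {a, b})"
    have "keys w' \<subseteq> faces X 2"
      using w(1) f keys_add[of w "frag_of {a, b}"] keys_diff[of w "frag_of {a, b}"] by (auto simp: w'_def split: if_splits)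
    moreover have "bdry p w' = frag_of {b} - frag_of {u}"
      unfolding w'_def by (simp add: frag_extend_add frag_extend_diff w(2) bd below)
    ultimately show ?thesis by blast
  qed
qed

text \<open>At \<open>{}\<close> the two operators differ on vertices, since only
  \<open>ordered_boundary\<close> is augmented; simplices with at least two vertices have nonempty
  faces, so nothing arises there.\<close>

lemma boundary_unorient_eq:
  assumes c: "keys c \<subseteq> faces X (Suc (Suc k))"
  shows "boundary (unorient p c) = unorient p (bdry p c)"
proof
  fix \<tau>
  have dc: "keys (bdry p c) \<subseteq> faces X (Suc k)"
    by (rule frag_extend_subset[OF c]) (rule ordered_boundary_keys)
  show "boundary (unorient p c) \<tau> = unorient p (bdry p c) \<tau>"
  proof (cases "\<tau> = {}")
    case True
    then show ?thesis using dc by (auto simp: boundary_def unorient_def faces_def in_keys_iff subset_iff)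
  next
    case False
    then show ?thesis using boundary_unorient[of c p \<tau>] face_finite face_inj c by blast
  qed
qed

lemma unorient_inject: "unorient p a = unorient p b \<longleftrightarrow> a = b"
  by (auto simp: unorient_def fun_eq_iff intro: poly_mapping_eqI)

lemma cycles_unorient:
  "cycles X (Suc k) = unorient p ` {c. keys c \<subseteq> faces X (Suc (Suc k)) \<and> bdry p c = 0}"
proof -
  have "unorient p 0 = (\<lambda>_. 0)" by (simp add: unorient_def)
  then have "boundary (unorient p c) = (\<lambda>_. 0) \<longleftrightarrow> bdry p c = 0"
    if "keys c \<subseteq> faces X (Suc (Suc k))" for c
    using boundary_unorient_eq[OF that] unorient_inject by metis
  then show ?thesis unfolding cycles_def chains_unorient[of X _ p] by blast
qed

text \<open>Index 0 asks for a vertex, index 1 for connectedness in the form of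
  \<open>vertex_difference\<close>, and index \<open>k + 1\<close> with \<open>k \<ge> 1\<close> is
  the filling of \<open>k\<close>-cycles.\<close>

lemma exact_faces:
  assumes fill: "\<And>k Z. k \<in> {1..n} \<Longrightarrow> Z \<in> cycles X k \<Longrightarrow> \<exists>S\<in>chains X (Suc k). boundary S = Z"
  shows "exact_upto (Suc n) (faces X) (ordered_boundary p)"
  unfolding exact_upto_def
proof (intro allI impI, elim conjE)
  fix k z assume k: "k \<le> Suc n" and z: "keys z \<subseteq> faces X k" "bdry p z = 0"
  obtain u where u: "{u} \<in> simplices X" by (rule vertex_exists)
  have bd_u: "ordered_boundary p {v} = frag_of {}" for v
  proof -
    have "below p {v} v = 0" by (auto simp: below_def card_eq_0_iff)
    then show ?thesis by (simp add: ordered_boundary_def)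
  qed
  consider "k = 0" | "k = 1" | j where "k = Suc (Suc j)" by (metis One_nat_def not0_implies_Suc)
  then show "\<exists>w. keys w \<subseteq> faces X (Suc k) \<and> bdry p w = z"
  proof cases
    case 1
    let ?w = "frag_map (\<lambda>_. {u}) z"
    have "bdry p ?w = frag_extend frag_of z"
      unfolding frag_extend_frag_map bd_u
      by (rule frag_extend_cong_keys[OF z(1)]) (use 1 face_zero in auto)
    moreover have "keys ?w \<subseteq> faces X (Suc k)"
      by (rule frag_map_subset[OF z(1)]) (use u 1 in \<open>simp add: faces_def\<close>)
    ultimately show ?thesis using frag_extend_frag_of by metis
  next
    case 2
    have single: "\<exists>v. \<sigma> = {v} \<and> {v} \<in> simplices X" if "\<sigma> \<in> faces X 1" for \<sigma>
      using that by (auto simp: faces_def card_1_singleton_iff)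
    then have "\<exists>w. keys w \<subseteq> faces X 2 \<and> bdry p w = frag_of \<sigma> - frag_of {u}"
      if "\<sigma> \<in> faces X 1" for \<sigma> using vertex_difference[OF u] that by metis
    then obtain W where W: "\<And>\<sigma>. \<sigma> \<in> faces X 1 \<Longrightarrow> keys (W \<sigma>) \<subseteq> faces X 2"
      "\<And>\<sigma>. \<sigma> \<in> faces X 1 \<Longrightarrow> bdry p (W \<sigma>) = frag_of \<sigma> - frag_of {u}" by metis
    have z1: "keys z \<subseteq> faces X 1" using z(1) 2 by simp
    \<comment> \<open>Sending the empty face to \<open>{u}\<close> turns the vanishing augmentation
      of \<open>z\<close> into the statement that its coefficients sum to zero, so the terms
      \<open>frag_of {u}\<close> below cancel.\<close>
    have "0 = frag_map (\<lambda>_. {u}) (bdry p z)" using z(2) by simp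
    also have "\<dots> = frag_extend (\<lambda>_. frag_of {u}) z"
      unfolding frag_map_frag_extend by (rule frag_extend_cong_keys[OF z1]) (use single bd_u in fastforce)
    finally have sum0: "frag_extend (\<lambda>_. frag_of {u}) z = 0" by simp
    have "bdry p (frag_extend W z) = frag_extend (\<lambda>\<sigma>. frag_of \<sigma> - frag_of {u}) z"
      unfolding frag_extend_frag_extend by (rule frag_extend_cong_keys[OF z1 W(2)])
    also have "\<dots> = z" using sum0 by (simp add: frag_extend_diff_fun frag_extend_frag_of)
    finally have "bdry p (frag_extend W z) = z" .
    moreover have "keys (frag_extend W z) \<subseteq> faces X 2" by (rule frag_extend_subset[OF z1 W(1)])
    ultimately show ?thesis using 2 by (auto simp: numeral_2_eq_2)
  next
    case 3
    have "unorient p z \<in> cycles X (Suc j)" using z 3 by (auto simp: cycles_unorient)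
    then obtain S where S: "S \<in> chains X (Suc (Suc j))" "boundary S = unorient p z"
      using fill[of "Suc j"] 3 k by auto
    then obtain w where w: "keys w \<subseteq> faces X (Suc k)" "S = unorient p w"
      using 3 by (auto simp: chains_unorient[of X _ p])
    then have "bdry p w = z"
      using S(2) boundary_unorient_eq[of w "Suc j"] unorient_inject 3 by simp
    then show ?thesis using w(1) by blast
  qed
qed

text \<open>A deck transformation matches one vertex of \<open>\<sigma>\<close> with the vertex of
  \<open>\<tau>\<close> over the same point. Two simplices with equal images and a common vertex
  coincide, by \<open>star_inj\<close> at that vertex.\<close>

lemma transitive_on_simplices:
  assumes \<sigma>: "\<sigma> \<in> simplices X" and \<tau>: "\<tau> \<in> simplices X" and eq: "p ` \<sigma> = p ` \<tau>"
  obtains g where "g \<in> carrier G" "\<tau> = act g ` \<sigma>"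
proof -
  obtain u where u: "u \<in> \<sigma>" using simplex_nonempty[OF X \<sigma>] by auto
  then obtain v where v: "v \<in> \<tau>" "p u = p v" using eq by (metis imageE imageI)
  obtain g where g: "g \<in> carrier G" "act g u = v"
    using act_trans[OF simplex_vertex[OF X \<sigma> u] simplex_vertex[OF X \<tau> v(1)] v(2)] by blast
  have g\<sigma>: "act g ` \<sigma> \<in> simplices X" by (rule act_simplex[OF g(1) \<sigma>])
  have p_eq: "p ` act g ` \<sigma> = p ` \<tau>"
    using p_act[OF g(1) simplex_vertex[OF X \<sigma>]] eq by (simp add: image_image)
  have edge: "{v, w} \<in> simplices X" if "w \<in> \<rho>" "v \<in> \<rho>" "\<rho> \<in> simplices X" for w \<rho>
    using simplex_face[OF X that(3), of "{v, w}"] that by auto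
  have v': "v \<in> act g ` \<sigma>" using g u by auto
  have sub: "A \<subseteq> B" if A: "A \<in> simplices X" "v \<in> A" and B: "B \<in> simplices X" "v \<in> B" and AB: "p ` A = p ` B" for A B
  proof
    fix w assume w: "w \<in> A"
    then obtain w' where w': "w' \<in> B" "p w = p w'" using AB by (metis imageE imageI)
    have "w = w'" by (rule star_inj[OF edge[OF w A(2,1)] edge[OF w'(1) B(2,1)] w'(2)])
    then show "w \<in> B" using w' by simp
  qed
  have "\<tau> = act g ` \<sigma>"
    using sub[OF g\<sigma> v' \<tau> v(1) p_eq] sub[OF \<tau> v(1) g\<sigma> v' p_eq[symmetric]] by blast
  then show ?thesis using that g(1) by blast
qed

lemma p_image_face: "\<sigma> \<in> faces X (Suc k) \<Longrightarrow> p ` \<sigma> \<in> {\<tau>\<in>simplices K. simplex_dim \<tau> = k}"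
  using image_simplex card_image[OF p_inj_on] by (auto simp: faces_Suc simplex_dim_def)

lemma finite_face_images:
  assumes "finite_skeleton m K" "k \<le> m"
  shows "finite ((`) p ` faces X (Suc k))"
  by (rule finite_subset[OF _ assms(1)[unfolded finite_skeleton_def]]) (use p_image_face assms(2) in auto)

lemma finite_orbits_faces:
  assumes "finite_skeleton m K" "k \<le> m"
  shows "finite_orbits G (\<lambda>g. (`) (act g)) (faces X (Suc k))"
proof -
  \<comment> \<open>One face over each simplex of \<open>K\<close> that lies under some face; by
    \<open>transitive_on_simplices\<close> these meet all orbits.\<close>
  let ?c = "\<lambda>\<tau>. SOME \<sigma>. \<sigma> \<in> faces X (Suc k) \<and> p ` \<sigma> = \<tau>"
  have c: "?c (p ` \<sigma>) \<in> faces X (Suc k) \<and> p ` ?c (p ` \<sigma>) = p ` \<sigma>" if "\<sigma> \<in> faces X (Suc k)" for \<sigma>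
    by (rule someI[of _ \<sigma>]) (use that in simp)
  show ?thesis
    unfolding finite_orbits_def
  proof (intro exI conjI ballI)
    show "finite (?c ` (`) p ` faces X (Suc k))" using finite_face_images[OF assms] by simp
    show "?c ` (`) p ` faces X (Suc k) \<subseteq> faces X (Suc k)" using c by blast
    fix \<sigma> assume \<sigma>: "\<sigma> \<in> faces X (Suc k)"
    obtain g where "g \<in> carrier G" "\<sigma> = act g ` ?c (p ` \<sigma>)"
      using transitive_on_simplices[of "?c (p ` \<sigma>)" \<sigma>] c[OF \<sigma>] \<sigma> by (auto simp: faces_Suc)
    then show "\<exists>g\<in>carrier G. \<exists>r\<in>?c ` (`) p ` faces X (Suc k). \<sigma> = act g ` r" using \<sigma> by blast
  qed
qed

lemma vol_eq: "\<sigma> \<in> simplices X \<Longrightarrow> simplex_vol X \<sigma> = simplex_vol K (p ` \<sigma>)"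
  using p_inj_on chart_eq by (intro simplex_vol_cong[OF X K _ image_simplex, where m=p]) (auto simp: bij_betw_def)

lemma mass_bounds:
  assumes "finite_skeleton m K" "k \<le> m"
  obtains a b where "0 < a" "0 < b"
    "\<And>c. keys c \<subseteq> faces X (Suc k) \<Longrightarrow> a * l1 c \<le> mass X (unorient p c)"
    "\<And>c. keys c \<subseteq> faces X (Suc k) \<Longrightarrow> mass X (unorient p c) \<le> b * l1 c"
proof -
  \<comment> \<open>The inserted 1 keeps the set nonempty when there are no faces of this dimension,
    so that its \<open>Min\<close> and \<open>Max\<close> are still positive numbers.\<close>
  let ?V = "insert 1 (simplex_vol K ` (`) p ` faces X (Suc k))"
  have fin: "finite ?V" using finite_face_images[OF assms] by simp
  have pos: "v > 0" if "v \<in> ?V" for v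
    using that simplex_vol_pos[OF K] p_image_face by auto
  have vol: "simplex_vol X \<sigma> \<in> ?V" if "\<sigma> \<in> faces X (Suc k)" for \<sigma>
    using that vol_eq by (auto simp: faces_Suc)
  show ?thesis
  proof (rule that)
    show "0 < Min ?V" using fin pos by (subst Min_gr_iff) auto
    show "0 < Max ?V" using fin by (subst Max_gr_iff) auto
    fix c :: "nat set \<Rightarrow>\<^sub>0 int" assume c: "keys c \<subseteq> faces X (Suc k)"
    have b: "Min ?V \<le> simplex_vol X \<sigma>" "simplex_vol X \<sigma> \<le> Max ?V" if "\<sigma> \<in> keys c" for \<sigma>
    proof -
      have "simplex_vol X \<sigma> \<in> ?V" using vol c that by blast
      then show "Min ?V \<le> simplex_vol X \<sigma>" "simplex_vol X \<sigma> \<le> Max ?V"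
        using Min_le[OF fin] Max_ge[OF fin] by simp_all
    qed
    show "Min ?V * l1 c \<le> mass X (unorient p c)"
      unfolding mass_unorient l1_def sum_distrib_left
      by (intro sum_mono, subst mult.commute, rule mult_left_mono[OF b(1)]) simp_all
    show "mass X (unorient p c) \<le> Max ?V * l1 c"
      unfolding mass_unorient l1_def sum_distrib_left
      by (intro sum_mono, subst mult.commute, rule mult_right_mono[OF b(2)]) simp_all
  qed
qed

end

lemma cover_action_exists:
  fixes G :: "('g, 'x) monoid_scheme"
  assumes G: "group G" and K1: "simplicial_metric_K1 G K" and cov: "universal_cover X p K"
  obtains act where "cover_action X p K G act"
proof -
  interpret simplicial_cover X p K
    using cov K1 by unfold_locales (auto simp: simplicial_metric_K1_def)
  obtain a where a: "a \<in> realization K" "fundamental_group (realization K) a \<cong> G"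
    using K1 by (auto simp: simplicial_metric_K1_def)
  have "realization X \<noteq> {}" using a(1) covering_space_imp_surjective[OF covering] by auto
  note nonempty = this
  show ?thesis
  proof (rule deck_action[OF G a])
    fix act :: "'g \<Rightarrow> nat \<Rightarrow> nat"
    assume
      "\<And>g \<sigma>. g \<in> carrier G \<Longrightarrow> \<sigma> \<in> simplices X \<Longrightarrow> act g ` \<sigma> \<in> simplices X"
      "\<And>g v. g \<in> carrier G \<Longrightarrow> {v} \<in> simplices X \<Longrightarrow> p (act g v) = p v"
      "\<And>g h v. g \<in> carrier G \<Longrightarrow> h \<in> carrier G \<Longrightarrow> {v} \<in> simplices X \<Longrightarrow> act (g \<otimes>\<^bsub>G\<^esub> h) v = act g (act h v)"
      "\<And>v. {v} \<in> simplices X \<Longrightarrow> act \<one>\<^bsub>G\<^esub> v = v"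
      "\<And>g v. g \<in> carrier G \<Longrightarrow> {v} \<in> simplices X \<Longrightarrow> act g v = v \<Longrightarrow> g = \<one>\<^bsub>G\<^esub>"
      "\<And>u v. {u} \<in> simplices X \<Longrightarrow> {v} \<in> simplices X \<Longrightarrow> p u = p v \<Longrightarrow> \<exists>g\<in>carrier G. act g u = v"
    then have "cover_action X p K G act"
      using G nonempty by (intro cover_action.intro cover_action_axioms.intro simplicial_cover_axioms) auto
    then show ?thesis by (rule that)
  qed
qed

section \<open>From norms to masses: the isoperimetric estimate\<close>

lemma l1_ge_one: "c \<noteq> 0 \<Longrightarrow> 1 \<le> l1 c"
proof -
  assume "c \<noteq> 0"
  then obtain x where x: "x \<in> keys c" by (metis all_not_in_conv keys_eq_empty)
  then have "1 \<le> \<bar>real_of_int (lookup c x)\<bar>" by (simp add: in_keys_iff abs_le_iff flip: of_int_abs) 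
  also have "\<dots> \<le> l1 c" unfolding l1_def using x by (intro member_le_sum) auto
  finally show ?thesis .
qed

text \<open>Integrality is essential: nonzero chains have norm at least 1, so the linear error term
  of the transferred filling is absorbed by the power in the isoperimetric inequality.\<close>

lemma l1_le_powr: "1 \<le> e \<Longrightarrow> l1 c \<le> l1 c powr e"
proof (cases "c = 0")
  case False
  assume "1 \<le> e"
  then have "l1 c powr 1 \<le> l1 c powr e" using l1_ge_one[OF False] by (intro powr_mono) auto
  then show ?thesis using l1_ge_one[OF False] by simp
qed simp

theorem corollary1p2:
  fixes G :: "('g, 'x) monoid_scheme" and H :: "'g set" and n :: nat
  assumes "group G"
    and "n \<ge> 1"
    and "rank_hyperbolic_group n G"
    and "cohomological_dim G = enat (n + 1)"
    and "subgroup H G"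
    and "CI_group n (G\<lparr>carrier := H\<rparr>)"
  shows "rank_hyperbolic_group n (G\<lparr>carrier := H\<rparr>)"
proof -
  let ?H = "G\<lparr>carrier := H\<rparr>"
  let ?e = "(real n + 1) / real n"
  have H: "group ?H" using subgroup.subgroup_is_group[OF assms(5,1)] .
  obtain m where m: "n = Suc m" using assms(2) by (cases n) auto
  obtain K X p where K: "simplicial_metric_K1 G K" "finite_skeleton (n + 1) K" "universal_cover X p K"
    and X: "satisfies_CI (n - 1) X"
      "\<exists>C. \<forall>Z\<in>cycles X n. \<exists>S\<in>chains X (Suc n). boundary S = Z \<and> mass X S \<le> C * mass X Z powr ?e"
    using assms(3) unfolding rank_hyperbolic_group_def rank_hyperbolic_def by blast
  obtain L Y r where L: "simplicial_metric_K1 ?H L" "finite_skeleton (n + 1) L" "universal_cover Y r L"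
    and Y: "satisfies_CI n Y"
    using assms(6) unfolding CI_group_def by blast
  obtain actX where "cover_action X p K G actX" by (rule cover_action_exists[OF assms(1) K(1,3)])
  then interpret X: cover_action X p K G actX .
  obtain actY where "cover_action Y r L ?H actY" by (rule cover_action_exists[OF H L(1,3)])
  then interpret Y: cover_action Y r L ?H actY .
  obtain C0 where C0: "\<And>Z. Z \<in> cycles X n \<Longrightarrow>
      \<exists>S\<in>chains X (Suc n). boundary S = Z \<and> mass X S \<le> C0 * mass X Z powr ?e"
    using X(2) by blast
  obtain u where u: "{u} \<in> simplices X" by (rule X.vertex_exists)
  obtain v where v: "{v} \<in> simplices Y" by (rule Y.vertex_exists)
  \<comment> \<open>Cycles of dimension below \<open>n\<close> are filled by
    \<open>satisfies_CI\<close>, those of dimension \<open>n\<close> by the isoperimetric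
    inequality; in index terms this is exactness through \<open>Suc n\<close>.\<close>
  have exX: "exact_upto (Suc n) (faces X) (ordered_boundary p)"
  proof (rule X.exact_faces)
    fix k Z assume k: "k \<in> {1..n}" and Z: "Z \<in> cycles X k"
    show "\<exists>S\<in>chains X (Suc k). boundary S = Z"
    proof (cases "k = n")
      case True
      then show ?thesis using C0 Z by blast
    next
      case False
      then have "k \<in> {1..n - 1}" using k by auto
      then show ?thesis using satisfies_CI_imp_fillings[OF X.X X.connected_X u X(1) _ Z] by blast
    qed
  qed
  have exY: "exact_upto (Suc n) (faces Y) (ordered_boundary r)"
    by (rule Y.exact_faces) (rule satisfies_CI_imp_fillings[OF Y.X Y.connected_X v Y])
  \<comment> \<open>Coding the top simplices by lists over \<open>G\<close> puts the coefficient
    module into the type over which \<open>cohomological_dim\<close> ranges.\<close>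
  have "faces X (Suc (Suc n)) \<subseteq> range (\<lambda>t :: 'g list. set_decode (length t))"
    using X.face_finite set_decode_length_surj by blast
  then obtain \<pi> where \<pi>: "equivariant_on G (\<lambda>g. (`) (actX g)) (\<lambda>g. (`) (actX g)) (faces X (Suc (Suc n))) \<pi>"
    "\<And>b. b \<in> faces X (Suc (Suc n)) \<Longrightarrow> keys (\<pi> b) \<subseteq> faces X (Suc (Suc n))"
    "\<And>b. b \<in> faces X (Suc (Suc n)) \<Longrightarrow> bdry p (\<pi> b) = ordered_boundary p b"
    "\<And>c. keys c \<subseteq> faces X (Suc (Suc n)) \<Longrightarrow> bdry p c = 0 \<Longrightarrow> frag_extend \<pi> c = 0"
    \<comment> \<open>With \<open>N = Suc n\<close> the cohomology that has to vanish is in degree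
      \<open>Suc N = n + 2\<close>, the first one above the dimension \<open>n + 1\<close>.\<close>
    using augmented_complex.equivariant_projection[OF X.simplicial_complex exX _ cohomology_vanishes[OF assms(4)]]
    by (metis Suc_eq_plus1 lessI)
  have orbX: "finite_orbits G (\<lambda>g. (`) (actX g)) (faces X (Suc (Suc n)))"
    and orbY: "finite_orbits ?H (\<lambda>g. (`) (actY g)) (faces Y (Suc n))"
      "finite_orbits ?H (\<lambda>g. (`) (actY g)) (faces Y (Suc (Suc n)))"
    using X.finite_orbits_faces[OF K(2)] Y.finite_orbits_faces[OF L(2)] by simp_all
  obtain C where C: "C \<ge> 0" and fill: "\<And>y. keys y \<subseteq> faces Y (Suc n) \<Longrightarrow> bdry r y = 0 \<Longrightarrow>
       \<exists>x. keys x \<subseteq> faces X (Suc n) \<and> bdry p x = 0 \<and> l1 x \<le> C * l1 y \<and>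
         (\<forall>S. keys S \<subseteq> faces X (Suc (Suc n)) \<and> bdry p S = x \<longrightarrow>
           (\<exists>W. keys W \<subseteq> faces Y (Suc (Suc n)) \<and> bdry r W = y \<and> l1 W \<le> C * (l1 S + l1 y)))"
    using filling_transfer[OF X.simplicial_complex exX \<pi> orbX assms(5) Y.simplicial_complex exY orbY] by metis
  have le: "n \<le> n + 1" "Suc n \<le> n + 1" by simp_all
  obtain a1 b1 where a1b1: "0 < a1" "0 < b1"
    "\<And>c. keys c \<subseteq> faces X (Suc n) \<Longrightarrow> a1 * l1 c \<le> mass X (unorient p c)"
    "\<And>c. keys c \<subseteq> faces X (Suc n) \<Longrightarrow> mass X (unorient p c) \<le> b1 * l1 c"
    using X.mass_bounds[OF K(2) le(1)] by metis
  obtain a2 b2 where a2b2: "0 < a2" "0 < b2"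
    "\<And>c. keys c \<subseteq> faces X (Suc (Suc n)) \<Longrightarrow> a2 * l1 c \<le> mass X (unorient p c)"
    "\<And>c. keys c \<subseteq> faces X (Suc (Suc n)) \<Longrightarrow> mass X (unorient p c) \<le> b2 * l1 c"
    using X.mass_bounds[OF K(2) le(2)] by metis
  obtain a3 b3 where a3b3: "0 < a3" "0 < b3"
    "\<And>c. keys c \<subseteq> faces Y (Suc n) \<Longrightarrow> a3 * l1 c \<le> mass Y (unorient r c)"
    "\<And>c. keys c \<subseteq> faces Y (Suc n) \<Longrightarrow> mass Y (unorient r c) \<le> b3 * l1 c"
    using Y.mass_bounds[OF L(2) le(1)] by metis
  obtain a4 b4 where a4b4: "0 < a4" "0 < b4"
    "\<And>c. keys c \<subseteq> faces Y (Suc (Suc n)) \<Longrightarrow> a4 * l1 c \<le> mass Y (unorient r c)"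
    "\<And>c. keys c \<subseteq> faces Y (Suc (Suc n)) \<Longrightarrow> mass Y (unorient r c) \<le> b4 * l1 c"
    using Y.mass_bounds[OF L(2) le(2)] by metis
  have e: "?e \<ge> 1" using assms(2) by (simp add: field_simps)
  \<comment> \<open>The sign of \<open>C0\<close> is not known, and inequalities are going to be
    multiplied by it.\<close>
  define C1 where "C1 = max C0 0"
  \<comment> \<open>The mass of \<open>x\<close> is at most \<open>b1 * C\<close> times the norm of
    \<open>y\<close>; the power and \<open>C1\<close> come from filling in \<open>X\<close>, and
    division by \<open>a2\<close> returns from the mass of \<open>S\<close> to its norm.\<close>
  define C2 where "C2 = C1 * (b1 * C) powr ?e / a2"
  have C12: "C0 \<le> C1" "0 \<le> C1" "0 \<le> C2" using a2b2(1) by (auto simp: C1_def C2_def)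
  \<comment> \<open>The factors of the constant in order: \<open>b4\<close> passes from the norm of
    the new filling to its mass, \<open>C\<close> is the transfer, \<open>C2 + 1\<close> collects
    the norms of \<open>S\<close> and \<open>y\<close>, and the power of \<open>1 / a3\<close>
    returns from the norm of \<open>y\<close> to the mass of \<open>Z\<close>.\<close>
  have "\<exists>S\<in>chains Y (Suc n). boundary S = Z \<and> mass Y S \<le> (b4 * C * (C2 + 1) * (1 / a3) powr ?e) * mass Y Z powr ?e"
    if Z: "Z \<in> cycles Y n" for Z
  proof -
    obtain y where y: "keys y \<subseteq> faces Y (Suc n)" "bdry r y = 0" "Z = unorient r y"
      using Z unfolding m Y.cycles_unorient by blast
    obtain x where x: "keys x \<subseteq> faces X (Suc n)" "bdry p x = 0" "l1 x \<le> C * l1 y"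
      and refill: "\<And>S. keys S \<subseteq> faces X (Suc (Suc n)) \<Longrightarrow> bdry p S = x \<Longrightarrow>
           \<exists>W. keys W \<subseteq> faces Y (Suc (Suc n)) \<and> bdry r W = y \<and> l1 W \<le> C * (l1 S + l1 y)"
      using fill[OF y(1,2)] by blast
    have "unorient p x \<in> cycles X n" using x(1,2) unfolding m X.cycles_unorient by blast
    then obtain S' where S': "S' \<in> chains X (Suc n)" "boundary S' = unorient p x"
      "mass X S' \<le> C0 * mass X (unorient p x) powr ?e" using C0 by blast
    then obtain S where S: "keys S \<subseteq> faces X (Suc (Suc n))" "S' = unorient p S"
      unfolding chains_unorient[of X _ p] by blast
    have dS: "bdry p S = x"
      using S'(2) X.boundary_unorient_eq[OF S(1)] X.unorient_inject unfolding S(2) by metis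
    obtain W where W: "keys W \<subseteq> faces Y (Suc (Suc n))" "bdry r W = y"
      "l1 W \<le> C * (l1 S + l1 y)" using refill[OF S(1) dS] by blast
    have mx: "0 \<le> mass X (unorient p x)"
      by (simp add: mass_def sum_nonneg simplex_vol_def)
    have "mass X (unorient p x) \<le> b1 * l1 x" by (rule a1b1(4)[OF x(1)])
    also have "\<dots> \<le> b1 * (C * l1 y)" using x(3) a1b1(2) by simp
    finally have "mass X (unorient p x) powr ?e \<le> (b1 * C * l1 y) powr ?e"
      using mx e by (intro powr_mono2) (auto simp: mult.assoc)
    also have "\<dots> = (b1 * C) powr ?e * l1 y powr ?e"
      by (rule powr_mult)
    finally have mxe: "mass X (unorient p x) powr ?e \<le> (b1 * C) powr ?e * l1 y powr ?e" .
    have "a2 * l1 S \<le> C0 * mass X (unorient p x) powr ?e" using a2b2(3)[OF S(1)] S'(3) S(2) by simp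
    also have "\<dots> \<le> C1 * mass X (unorient p x) powr ?e" by (rule mult_right_mono[OF C12(1)]) simp
    also have "\<dots> \<le> C1 * ((b1 * C) powr ?e * l1 y powr ?e)" by (rule mult_left_mono[OF mxe C12(2)])
    finally have lS: "l1 S \<le> C2 * l1 y powr ?e"
      using a2b2(1) by (simp add: C2_def field_simps)
    have "l1 S + l1 y \<le> C2 * l1 y powr ?e + l1 y powr ?e" by (rule add_mono[OF lS l1_le_powr[OF e]])
    then have "C * (l1 S + l1 y) \<le> C * ((C2 + 1) * l1 y powr ?e)"
      using C by (intro mult_left_mono) (auto simp: distrib_right)
    then have lW: "l1 W \<le> C * (C2 + 1) * l1 y powr ?e" using W(3) by (simp add: mult.assoc)
    have "l1 y \<le> 1 / a3 * mass Y Z" using a3b3(3)[OF y(1)] a3b3(1) y(3) by (simp add: field_simps)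
    then have "l1 y powr ?e \<le> (1 / a3 * mass Y Z) powr ?e"
      using e l1_nonneg by (intro powr_mono2) auto
    also have "\<dots> = (1 / a3) powr ?e * mass Y Z powr ?e"
      by (rule powr_mult)
    finally have ly: "l1 y powr ?e \<le> (1 / a3) powr ?e * mass Y Z powr ?e" .
    have "mass Y (unorient r W) \<le> b4 * l1 W" by (rule a4b4(4)[OF W(1)])
    also have "\<dots> \<le> b4 * (C * (C2 + 1) * l1 y powr ?e)" using lW a4b4(2) by simp
    also have "\<dots> \<le> b4 * (C * (C2 + 1) * ((1 / a3) powr ?e * mass Y Z powr ?e))"
      using ly a4b4(2) C C12(3) by (intro mult_left_mono) auto
    finally have "mass Y (unorient r W) \<le> (b4 * C * (C2 + 1) * (1 / a3) powr ?e) * mass Y Z powr ?e"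
      by (simp add: mult.assoc)
    moreover have "boundary (unorient r W) = Z" using Y.boundary_unorient_eq[OF W(1)] W(2) y(3) by simp
    moreover have "unorient r W \<in> chains Y (Suc n)" using W(1) unfolding chains_unorient[of Y _ r] by blast
    ultimately show ?thesis by blast
  qed
  then have "rank_hyperbolic n Y"
    unfolding rank_hyperbolic_def using Y.X satisfies_CI_mono[OF Y diff_le_self] by blast
  then show ?thesis unfolding rank_hyperbolic_group_def using L by blast
qed

end
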